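(* Let $K/F$ be a field extension of degree $n$ with ramification index $e=e(K/F)$, let $\beta\in O_K$ satisfy $O_K=O_F[\beta]$ and $T_{K/F}(\beta)=0$, and let $r\geq 2$ be an integer. Let $\delta$ be an irreducible complex representation of the finite group $G(O_F/\mathfrak{p}^r)$, where $G=SL_n$, such that the restriction of $\delta$ to $G(\mathfrak{p}^l/\mathfrak{p}^r)$ contains the character $\psi_\beta$. Regard $\delta$ as a representation of $G(O_F)$ via the canonical surjection $G(O_F)\to G(O_F/\mathfrak{p}^r)$. If $r\geq 2e$, then the compactly induced representation $\mathrm{ind}_{G(O_F)}^{G(F)}\delta$ is an irreducible supercuspidal representation of $G(F)$.
   Context: $F$ is a non-archimedean local field whose residue characteristic $p$ is not $2$; $O_F$ is its ring of integers, $\mathfrak{p}=\varpi O_F$ its maximal ideal. $n$ is a positive integer with $p\nmid n$ (so every degree $n$ extension $K/F$ is tamely ramified). $\tau:F\to\mathbb{C}^\times$ is a fixed continuous unitary additive character with $\{x\in F\mid \tau(xO_F)=1\}=O_F$. $G=SL_n$ is regarded as a group scheme over $O_F$. $O_K$ is the integer ring of $K$ and $T_{K/F}$ the trace. $K$ is identified with an $F$-subalgebra of $M_n(F)$ by the regular representation with respect to an $O_F$-basis of $O_K$; thus $\beta\in O_K\subset M_n(O_F)$ has trace $0$. For $r\ge 2$ write $r=l+l'$ where $l$ is the minimal integer with $0<l'\leq l$, i.e. $l'=[r/2]$. For $0<l<r$, $G(\mathfrak{p}^l/\mathfrak{p}^r)$ denotes the kernel of the canonical surjection $G(O_F/\mathfrak{p}^r)\to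 G(O_F/\mathfrak{p}^l)$. Every element of $G(\mathfrak{p}^l/\mathfrak{p}^r)$ has the form $h=1_n+\varpi^lX \bmod \mathfrak{p}^r$ with $X\bmod\mathfrak{p}^{l'}$ a uniquely determined trace-zero matrix over $O_F/\mathfrak{p}^{l'}$, and the character $\psi_\beta:G(\mathfrak{p}^l/\mathfrak{p}^r)\to\mathbb{C}^\times$ is defined by $\psi_\beta(h)=\tau(\varpi^{-l'}\mathrm{tr}(X\beta))$. *)

theory Defs
  imports
    "HOL-Analysis.Analysis"
    "HOL-Algebra.Coset"
    "HOL-Library.Function_Algebras"
    "HOL-Computational_Algebra.Polynomial"
begin

section \<open>Non-archimedean local fields\<close>

text \<open>
  A non-archimedean local field is a field that is complete with respect to a discrete,
  nontrivial, ultrametric absolute value and has a finite residue field.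
\<close>

locale nonarch_local_field =
  fixes nm :: "'f::field \<Rightarrow> real"
  assumes nm_nonneg: "0 \<le> nm x"
    and nm_eq_0_iff: "nm x = 0 \<longleftrightarrow> x = 0"
    and nm_mult: "nm (x * y) = nm x * nm y"
    and nm_ultrametric: "nm (x + y) \<le> max (nm x) (nm y)"
    and nm_discrete: "\<exists>w. 0 < nm w \<and> nm w < 1 \<and> (\<forall>x. nm x < 1 \<longrightarrow> nm x \<le> nm w)"
    and finite_residue_field: "\<exists>S. finite S \<and> (\<forall>x. nm x \<le> 1 \<longrightarrow> (\<exists>s\<in>S. nm (x - s) < 1))"
    and nm_complete: "Metric_space.mcomplete (UNIV :: 'f set) (\<lambda>x y. nm (x - y))"

definition ring_of_integers :: "('f::field \<Rightarrow> real) \<Rightarrow> 'f set" where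
  "ring_of_integers nm = {x. nm x \<le> 1}"

definition maximal_ideal :: "('f::field \<Rightarrow> real) \<Rightarrow> 'f set" where
  "maximal_ideal nm = {x. nm x < 1}"

definition is_uniformizer :: "('f::field \<Rightarrow> real) \<Rightarrow> 'f \<Rightarrow> bool" where
  "is_uniformizer nm \<pi> \<longleftrightarrow> maximal_ideal nm = {\<pi> * x | x. x \<in> ring_of_integers nm}"

definition ideal_power :: "('f::field \<Rightarrow> real) \<Rightarrow> 'f \<Rightarrow> nat \<Rightarrow> 'f set" where
  "ideal_power nm \<pi> k = {\<pi> ^ k * x | x. x \<in> ring_of_integers nm}"

definition residue_characteristic :: "('f::field \<Rightarrow> real) \<Rightarrow> nat" where
  "residue_characteristic nm = (LEAST p. 0 < p \<and> of_nat p \<in> maximal_ideal nm)"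

definition field_topology :: "('f::field \<Rightarrow> real) \<Rightarrow> 'f topology" where
  "field_topology nm = Metric_space.mtopology UNIV (\<lambda>x y. nm (x - y))"

definition matrix_topology :: "('f::field \<Rightarrow> real) \<Rightarrow> ('f ^ 'n::finite ^ 'n) topology" where
  "matrix_topology nm =
     Metric_space.mtopology UNIV (\<lambda>A B. Max (range (\<lambda>(i, j). nm (A $ i $ j - B $ i $ j))))"

definition unitary_additive_character :: "('f::field \<Rightarrow> real) \<Rightarrow> ('f \<Rightarrow> complex) \<Rightarrow> bool" where
  "unitary_additive_character nm \<tau> \<longleftrightarrow>
     (\<forall>x y. \<tau> (x + y) = \<tau> x * \<tau> y) \<and> (\<forall>x. cmod (\<tau> x) = 1) \<and>
     continuous_map (field_topology nm) euclidean \<tau>"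

text \<open>
  \<open>is_residue_ring nm \<pi> r \<rho>\<close>: the map \<open>\<rho>\<close>, restricted to the ring of integers, is a surjective ring
  homomorphism with kernel the \<open>r\<close>-th power of the maximal ideal, i.e. it identifies the ring \<open>'q\<close>
  with the quotient of the ring of integers by that power. Values of \<open>\<rho>\<close> elsewhere are irrelevant.
\<close>

definition is_residue_ring ::
    "('f::field \<Rightarrow> real) \<Rightarrow> 'f \<Rightarrow> nat \<Rightarrow> ('f \<Rightarrow> 'q::comm_ring_1) \<Rightarrow> bool" where
  "is_residue_ring nm \<pi> r \<rho> \<longleftrightarrow>
     \<rho> 1 = 1 \<and>
     (\<forall>x\<in>ring_of_integers nm. \<forall>y\<in>ring_of_integers nm. \<rho> (x + y) = \<rho> x + \<rho> y) \<and>
     (\<forall>x\<in>ring_of_integers nm. \<forall>y\<in>ring_of_integers nm. \<rho> (x * y) = \<rho> x * \<rho> y) \<and>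
     \<rho> ` ring_of_integers nm = UNIV \<and>
     {x \<in> ring_of_integers nm. \<rho> x = 0} = ideal_power nm \<pi> r"


section \<open>Extensions of local fields\<close>

text \<open>An extension \<open>K/F\<close> is given by an embedding \<open>\<iota>\<close> of \<open>F\<close> into \<open>K\<close>.\<close>

definition is_field_embedding :: "('f::field \<Rightarrow> 'k::field) \<Rightarrow> bool" where
  "is_field_embedding \<iota> \<longleftrightarrow>
     \<iota> 1 = 1 \<and> (\<forall>x y. \<iota> (x + y) = \<iota> x + \<iota> y) \<and> (\<forall>x y. \<iota> (x * y) = \<iota> x * \<iota> y)"

text \<open>
  For an infinite extension, \<open>extension_degree\<close> is \<open>0\<close>; hence a positive value means
  that the extension is finite.
\<close>

definition extension_degree :: "('f::field \<Rightarrow> 'k::field) \<Rightarrow> nat" where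
  "extension_degree \<iota> = vector_space.dim (\<lambda>a x. \<iota> a * x) UNIV"

text \<open>The trace of multiplication by \<open>x\<close>, computed in an arbitrary \<open>F\<close>-basis of \<open>K\<close>.\<close>

definition field_trace :: "('f::field \<Rightarrow> 'k::field) \<Rightarrow> 'k \<Rightarrow> 'f" where
  "field_trace \<iota> x =
     (let sc = (\<lambda>a y. \<iota> a * y); B = vector_space.extend_basis sc {}
      in \<Sum>y\<in>B. module.representation sc B (x * y) y)"

text \<open>The integer ring of \<open>K\<close> is the integral closure of the integer ring of \<open>F\<close>.\<close>

definition extension_integers :: "('f::field \<Rightarrow> real) \<Rightarrow> ('f \<Rightarrow> 'k::field) \<Rightarrow> 'k set" where
  "extension_integers nm \<iota> =
     {x. \<exists>p. lead_coeff p = 1 \<and> (\<forall>i. coeff p i \<in> ring_of_integers nm) \<and> poly (map_poly \<iota> p) x = 0}"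

text \<open>
  \<open>P\<close> generates the maximal ideal (the non-units) of the integer ring of \<open>K\<close>, and the maximal
  ideal of \<open>F\<close>, generated by \<open>\<pi>\<close>, generates in it the \<open>e\<close>-th power of that ideal.
\<close>

definition is_ramification_index ::
    "('f::field \<Rightarrow> real) \<Rightarrow> 'f \<Rightarrow> ('f \<Rightarrow> 'k::field) \<Rightarrow> nat \<Rightarrow> bool" where
  "is_ramification_index nm \<pi> \<iota> e \<longleftrightarrow>
     (let R = extension_integers nm \<iota> in
      \<exists>P. {x \<in> R. \<not> (\<exists>y\<in>R. x * y = 1)} = {P * y | y. y \<in> R} \<and>
          {\<iota> \<pi> * y | y. y \<in> R} = {P ^ e * y | y. y \<in> R})"

definition adjoin_integral :: "('f::field \<Rightarrow> real) \<Rightarrow> ('f \<Rightarrow> 'k::field) \<Rightarrow> 'k \<Rightarrow> 'k set" where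
  "adjoin_integral nm \<iota> x =
     {poly (map_poly \<iota> p) x | p. \<forall>i. coeff p i \<in> ring_of_integers nm}"

definition is_integral_basis ::
    "('f::field \<Rightarrow> real) \<Rightarrow> ('f \<Rightarrow> 'k::field) \<Rightarrow> ('n::finite \<Rightarrow> 'k) \<Rightarrow> bool" where
  "is_integral_basis nm \<iota> b \<longleftrightarrow>
     (\<forall>i. b i \<in> extension_integers nm \<iota>) \<and>
     (\<forall>x\<in>extension_integers nm \<iota>.
        \<exists>!c. (\<forall>i. c i \<in> ring_of_integers nm) \<and> x = (\<Sum>i\<in>UNIV. \<iota> (c i) * b i))"

text \<open>The matrix of multiplication by \<open>x\<close> in the basis \<open>b\<close> (columns are images of basis vectors).\<close>

definition regular_matrix ::
    "('f::field \<Rightarrow> 'k::field) \<Rightarrow> ('n::finite \<Rightarrow> 'k) \<Rightarrow> 'k \<Rightarrow> 'f ^ 'n ^ 'n" where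
  "regular_matrix \<iota> b x = (THE A. \<forall>j. x * b j = (\<Sum>i\<in>UNIV. \<iota> (A $ i $ j) * b i))"


section \<open>Complex representations of groups\<close>

text \<open>
  The representation space is a subspace \<open>V\<close> of an ambient complex vector space with scalar
  multiplication \<open>sc\<close>; operators outside the carrier and vectors outside \<open>V\<close> are irrelevant.
\<close>

locale complex_rep =
  group G + vector_space sc
  for G :: "('g, 'z) monoid_scheme" (structure)
    and sc :: "complex \<Rightarrow> 'v::ab_group_add \<Rightarrow> 'v" +
  fixes V :: "'v set" and \<sigma> :: "'g \<Rightarrow> 'v \<Rightarrow> 'v"
  assumes rep_subspace: "subspace V"
    and rep_closed: "g \<in> carrier G \<Longrightarrow> v \<in> V \<Longrightarrow> \<sigma> g v \<in> V"
    and rep_add: "g \<in> carrier G \<Longrightarrow> v \<in> V \<Longrightarrow> w \<in> V \<Longrightarrow> \<sigma> g (v + w) = \<sigma> g v + \<sigma> g w"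
    and rep_scale: "g \<in> carrier G \<Longrightarrow> v \<in> V \<Longrightarrow> \<sigma> g (sc c v) = sc c (\<sigma> g v)"
    and rep_one: "v \<in> V \<Longrightarrow> \<sigma> \<one> v = v"
    and rep_mult: "g \<in> carrier G \<Longrightarrow> h \<in> carrier G \<Longrightarrow> v \<in> V \<Longrightarrow> \<sigma> (g \<otimes> h) v = \<sigma> g (\<sigma> h v)"

definition irreducible_rep ::
    "('g, 'z) monoid_scheme \<Rightarrow> (complex \<Rightarrow> 'v::ab_group_add \<Rightarrow> 'v) \<Rightarrow> 'v set \<Rightarrow>
     ('g \<Rightarrow> 'v \<Rightarrow> 'v) \<Rightarrow> bool" where
  "irreducible_rep G sc V \<sigma> \<longleftrightarrow>
     complex_rep G sc V \<sigma> \<and> V \<noteq> {0} \<and>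
     (\<forall>W. module.subspace sc W \<and> W \<subseteq> V \<and> (\<forall>g\<in>carrier G. \<forall>w\<in>W. \<sigma> g w \<in> W) \<longrightarrow>
        W = {0} \<or> W = V)"

definition contains_character ::
    "(complex \<Rightarrow> 'v::ab_group_add \<Rightarrow> 'v) \<Rightarrow> 'v set \<Rightarrow> ('g \<Rightarrow> 'v \<Rightarrow> 'v) \<Rightarrow>
     'g set \<Rightarrow> ('g \<Rightarrow> complex) \<Rightarrow> bool" where
  "contains_character sc V \<sigma> H \<psi> \<longleftrightarrow> (\<exists>v\<in>V. v \<noteq> 0 \<and> (\<forall>h\<in>H. \<sigma> h v = sc (\<psi> h) v))"

text \<open>Below, \<open>T\<close> is the topology of the group \<open>G\<close>.\<close>

definition open_subgroup :: "('g, 'z) monoid_scheme \<Rightarrow> 'g topology \<Rightarrow> 'g set \<Rightarrow> bool" where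
  "open_subgroup G T U \<longleftrightarrow> subgroup U G \<and> openin T U"

definition smooth_rep ::
    "('g, 'z) monoid_scheme \<Rightarrow> 'g topology \<Rightarrow> (complex \<Rightarrow> 'v::ab_group_add \<Rightarrow> 'v) \<Rightarrow> 'v set \<Rightarrow>
     ('g \<Rightarrow> 'v \<Rightarrow> 'v) \<Rightarrow> bool" where
  "smooth_rep G T sc V \<sigma> \<longleftrightarrow>
     complex_rep G sc V \<sigma> \<and>
     (\<forall>v\<in>V. \<exists>U. open_subgroup G T U \<and> (\<forall>u\<in>U. \<sigma> u v = v))"

definition smooth_dual ::
    "('g, 'z) monoid_scheme \<Rightarrow> 'g topology \<Rightarrow> (complex \<Rightarrow> 'v::ab_group_add \<Rightarrow> 'v) \<Rightarrow> 'v set \<Rightarrow>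
     ('g \<Rightarrow> 'v \<Rightarrow> 'v) \<Rightarrow> ('v \<Rightarrow> complex) set" where
  "smooth_dual G T sc V \<sigma> =
     {\<phi>. (\<forall>v\<in>V. \<forall>w\<in>V. \<phi> (v + w) = \<phi> v + \<phi> w) \<and> (\<forall>c. \<forall>v\<in>V. \<phi> (sc c v) = c * \<phi> v) \<and>
         (\<exists>U. open_subgroup G T U \<and> (\<forall>u\<in>U. \<forall>v\<in>V. \<phi> (\<sigma> u v) = \<phi> v))}"

definition group_center :: "('g, 'z) monoid_scheme \<Rightarrow> 'g set" where
  "group_center G = {z \<in> carrier G. \<forall>g\<in>carrier G. z \<otimes>\<^bsub>G\<^esub> g = g \<otimes>\<^bsub>G\<^esub> z}"

text \<open>
  Supercuspidal: irreducible and smooth, and all matrix coefficients are compactly supported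
  modulo the centre. Matrix coefficients are locally constant, so their supports are the sets
  where they do not vanish.
\<close>

definition supercuspidal_rep ::
    "('g, 'z) monoid_scheme \<Rightarrow> 'g topology \<Rightarrow> (complex \<Rightarrow> 'v::ab_group_add \<Rightarrow> 'v) \<Rightarrow> 'v set \<Rightarrow>
     ('g \<Rightarrow> 'v \<Rightarrow> 'v) \<Rightarrow> bool" where
  "supercuspidal_rep G T sc V \<sigma> \<longleftrightarrow>
     irreducible_rep G sc V \<sigma> \<and> smooth_rep G T sc V \<sigma> \<and>
     (\<forall>v\<in>V. \<forall>\<phi>\<in>smooth_dual G T sc V \<sigma>.
        \<exists>C. compactin T C \<and> {g \<in> carrier G. \<phi> (\<sigma> g v) \<noteq> 0} \<subseteq> group_center G <#>\<^bsub>G\<^esub> C)"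

text \<open>
  The space of the representation compactly induced from \<open>(\<sigma>, V)\<close> on the open subgroup \<open>H\<close>:
  locally constant functions on \<open>G\<close> that transform on the left under \<open>H\<close> by \<open>\<sigma>\<close> and have compact
  support modulo \<open>H\<close>. Functions are extended by \<open>0\<close> outside the carrier.
\<close>

definition compact_ind_space ::
    "('g, 'z) monoid_scheme \<Rightarrow> 'g topology \<Rightarrow> 'g set \<Rightarrow> 'v::ab_group_add set \<Rightarrow>
     ('g \<Rightarrow> 'v \<Rightarrow> 'v) \<Rightarrow> ('g \<Rightarrow> 'v) set" where
  "compact_ind_space G T H V \<sigma> =
     {f. (\<forall>x. x \<notin> carrier G \<longrightarrow> f x = 0) \<and>
         (\<forall>x\<in>carrier G. f x \<in> V) \<and>
         (\<forall>h\<in>H. \<forall>x\<in>carrier G. f (h \<otimes>\<^bsub>G\<^esub> x) = \<sigma> h (f x)) \<and>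
         (\<exists>U. open_subgroup G T U \<and> (\<forall>u\<in>U. \<forall>x\<in>carrier G. f (x \<otimes>\<^bsub>G\<^esub> u) = f x)) \<and>
         (\<exists>C. compactin T C \<and> {x \<in> carrier G. f x \<noteq> 0} \<subseteq> H <#>\<^bsub>G\<^esub> C)}"

definition right_translation ::
    "('g, 'z) monoid_scheme \<Rightarrow> 'g \<Rightarrow> ('g \<Rightarrow> 'v::zero) \<Rightarrow> 'g \<Rightarrow> 'v" where
  "right_translation G g f = (\<lambda>x. if x \<in> carrier G then f (x \<otimes>\<^bsub>G\<^esub> g) else 0)"

definition pointwise_scale :: "(complex \<Rightarrow> 'v \<Rightarrow> 'v) \<Rightarrow> complex \<Rightarrow> ('g \<Rightarrow> 'v) \<Rightarrow> 'g \<Rightarrow> 'v" where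
  "pointwise_scale sc c f = (\<lambda>x. sc c (f x))"


section \<open>The special linear group and its congruence subquotients\<close>

definition SL :: "'a::comm_ring_1 set \<Rightarrow> ('a ^ 'n::finite ^ 'n) monoid" where
  "SL R = \<lparr>carrier = {A. (\<forall>i j. A $ i $ j \<in> R) \<and> det A = 1}, mult = (**), one = mat 1\<rparr>"

definition SL_topology :: "('f::field \<Rightarrow> real) \<Rightarrow> ('f ^ 'n::finite ^ 'n) topology" where
  "SL_topology nm = subtopology (matrix_topology nm) (carrier (SL UNIV))"

text \<open>
  The kernel of reduction from level \<open>r\<close> to level \<open>l\<close>: since the ring \<open>'q\<close> stands for the integers
  modulo the \<open>r\<close>-th power of the maximal ideal, reduction modulo the \<open>l\<close>-th power has the image
  under \<open>\<rho>\<close> of that power as its kernel.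
\<close>

definition congruence_kernel ::
    "('f::field \<Rightarrow> real) \<Rightarrow> 'f \<Rightarrow> ('f \<Rightarrow> 'q::comm_ring_1) \<Rightarrow> nat \<Rightarrow> ('q ^ 'n::finite ^ 'n) set" where
  "congruence_kernel nm \<pi> \<rho> l =
     {h \<in> carrier (SL UNIV). \<forall>i j. h $ i $ j - mat 1 $ i $ j \<in> \<rho> ` ideal_power nm \<pi> l}"

text \<open>
  The character \<open>\<psi>\<^sub>\<beta>\<close>, where \<open>l' = r div 2\<close>, \<open>l = r - l'\<close>, and \<open>B\<close> is the matrix of \<open>\<beta>\<close>.
  The choice of \<open>X\<close> is irrelevant: it is determined modulo the \<open>l'\<close>-th power of the maximal
  ideal, \<open>B\<close> is integral and \<open>\<tau>\<close> is trivial on the integers.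
\<close>

definition congruence_character ::
    "('f::field \<Rightarrow> real) \<Rightarrow> 'f \<Rightarrow> ('f \<Rightarrow> 'q::comm_ring_1) \<Rightarrow> ('f \<Rightarrow> complex) \<Rightarrow> nat \<Rightarrow>
     'f ^ 'n::finite ^ 'n \<Rightarrow> 'q ^ 'n ^ 'n \<Rightarrow> complex" where
  "congruence_character nm \<pi> \<rho> \<tau> r B h =
     (let l' = r div 2; l = r - l';
          X = (SOME X. (\<forall>i j. X $ i $ j \<in> ring_of_integers nm) \<and>
                 h = map_matrix \<rho> (mat 1 + map_matrix (\<lambda>x. \<pi> ^ l * x) X))
      in \<tau> (inverse (\<pi> ^ l') * trace (X ** B)))"

end

theory Submission
  imports Defs
begin

text \<open>
  Let \<open>H = SL(O)\<close>, and let \<open>v0\<close> be an eigenvector with character \<open>\<psi>\<close> of the congruence subgroup of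
  level \<open>l\<close> in the inflation of \<open>\<delta>\<close>. The key point is arithmetic: if \<open>\<psi>\<close> is trivial on the \<open>h\<close> of level \<open>l\<close> for which
  \<open>g\<inverse> h g\<close> has level \<open>m \<ge> r\<close>, then \<open>g\<close> is bounded in terms of \<open>m\<close>, and \<open>g \<in> H\<close> if \<open>m = r\<close>. Testing
  with conjugates of elementary matrices along a Cartan decomposition of \<open>g\<close> produces an integral
  matrix \<open>\<gamma>\<close>, congruent to the matrix of \<open>\<beta>\<close> modulo the power \<open>l'\<close> of the maximal ideal, such that
  \<open>g\<inverse> \<gamma> g\<close> is integral up to the factor \<open>\<pi> ^ (m - r)\<close>. Since \<open>r \<ge> 2 e\<close>, either \<open>e = 1\<close> or
  \<open>l' \<ge> 2\<close>, and then a uniformizer \<open>p(\<beta>)\<close> of \<open>K\<close> and \<open>p(\<gamma>)\<close> differ by a unit. Hence the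
  \<open>\<gamma>\<close>-stable lattices are the powers of \<open>p(\<gamma>)\<close> applied to the standard lattice, and the
  determinant singles out the standard one.

  For irreducibility, take a nonzero function in a stable subspace and project it to the
  \<open>\<psi>\<close>-eigenspace: by the key point with \<open>m = r\<close> the result is supported on \<open>H\<close>, and such functions
  generate the induced space. For supercuspidality, the vectors whose coefficients against a given
  smooth functional have bounded support form a stable subspace, which by the key point contains the
  function supported on \<open>H\<close> with value \<open>v0\<close>.
\<close>

section \<open>Matrices over a field with an absolute value\<close>

text \<open>Only a perturbation \<open>\<gamma>\<close> of \<open>\<beta>\<close> can be recovered,
  for a reason of duality: under the trace form the dual of an intersection of two lattices is the
  sum of their duals. The \<open>X\<close> with \<open>1 + \<pi>^l X\<close> of level
  \<open>m\<close> after conjugation form such an intersection, so triviality of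
  \<open>\<psi>\<close> splits the matrix of \<open>\<beta>\<close> into a part divisible by
  \<open>\<pi>^l'\<close> and a part that is integral after conjugation and scaling. In
  \<open>SL\<close> the tests must have determinant exactly 1, hence conjugates of off-diagonal
  elementary matrices; the diagonal cannot be tested this way, but its entries do not change under
  the diagonal Cartan factor.

  The bound \<open>l' \<ge> 2\<close> comes from the inverse of \<open>p(\<beta>)\<close>, which has
  one factor \<open>\<pi>\<close> in the denominator: \<open>p(\<gamma>) - p(\<beta>)\<close> must
  be divisible by \<open>\<pi>^2\<close>. For \<open>e = 1\<close> the uniformizer is
  \<open>\<pi>\<close>, so both values coincide.

  Levels \<open>m > r\<close> enter because a smooth functional is fixed only by some congruence
  subgroup. Sums over representatives modulo a power of \<open>\<pi>\<close> stand in for Haar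
  integrals.\<close>

definition msc :: "'a::comm_ring_1 \<Rightarrow> 'a ^ 'n ^ 'm \<Rightarrow> 'a ^ 'n ^ 'm" where
  "msc c A = (\<chi> i j. c * A $ i $ j)"

lemma msc_nth [simp]: "msc c A $ i $ j = c * A $ i $ j"
  by (simp add: msc_def)

lemma mat_eqI: "(\<And>i j. A $ i $ j = B $ i $ j) \<Longrightarrow> A = B"
  by (simp add: vec_eq_iff)

lemma matrix_mult_nth: "(A ** B) $ i $ j = (\<Sum>k\<in>UNIV. A $ i $ k * B $ k $ j)"
  by (simp add: matrix_matrix_mult_def)

lemma matrix_vector_nth: "(A *v x) $ i = (\<Sum>k\<in>UNIV. A $ i $ k * x $ k)"
  by (simp add: matrix_vector_mult_def)

lemma msc_mult_left: "msc c A ** B = msc c (A ** B)"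
  by (rule mat_eqI) (simp add: matrix_mult_nth sum_distrib_left mult.assoc)

lemma msc_mult_right: "A ** msc c B = msc c (A ** B)"
  by (rule mat_eqI) (simp add: matrix_mult_nth sum_distrib_left algebra_simps)

lemma msc_mult_vec: "msc c A *v x = c *s (A *v x)"
  by (simp add: vec_eq_iff matrix_vector_nth sum_distrib_left mult.assoc)

lemma mult_vec_scale: "A *v (c *s x) = c *s (A *v (x :: 'a::comm_ring_1 ^ 'n))"
  by (simp add: vec_eq_iff matrix_vector_nth sum_distrib_left algebra_simps)

lemma msc_msc [simp]: "msc c (msc d A) = msc (c * d) A"
  by (rule mat_eqI) (simp add: mult.assoc)

lemma msc_1 [simp]: "msc 1 A = A"
  by (rule mat_eqI) simp

lemma msc_add: "msc c (A + B) = msc c A + msc c B"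
  by (rule mat_eqI) (simp add: algebra_simps)

lemma msc_diff: "msc c (A - B) = msc c A - msc c B"
  by (rule mat_eqI) (simp add: algebra_simps)

lemma matrix_diff_ldistrib: "A ** (B - C) = A ** B - A ** (C :: 'a::ring_1 ^ 'n ^ 'm)"
  by (rule mat_eqI) (simp add: matrix_mult_nth sum_subtractf algebra_simps)

lemma matrix_diff_rdistrib: "(A - B) ** C = A ** C - B ** (C :: 'a::ring_1 ^ 'n ^ 'm)"
  by (rule mat_eqI) (simp add: matrix_mult_nth sum_subtractf algebra_simps)

lemma matrix_sum_ldistrib: "A ** (\<Sum>i\<in>I. f i) = (\<Sum>i\<in>I. A ** (f i :: 'a::ring_1 ^ 'n ^ 'm))"
  by (induction I rule: infinite_finite_induct)
    (simp_all add: matrix_add_ldistrib)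

lemma matrix_add_rdistrib: "(A + B) ** C = A ** C + B ** (C :: 'a::ring_1 ^ 'n ^ 'm)"
  by (rule mat_eqI) (simp add: matrix_mult_nth sum.distrib algebra_simps)

lemma matrix_sum_rdistrib: "(\<Sum>i\<in>I. f i) ** A = (\<Sum>i\<in>I. (f i :: 'a::ring_1 ^ 'n ^ 'm) ** A)"
  by (induction I rule: infinite_finite_induct)
    (simp_all add: matrix_add_rdistrib)

lemma matrix_vector_sum_rdistrib: "(\<Sum>i\<in>I. f i) *v x = (\<Sum>i\<in>I. (f i :: 'a::ring_1 ^ 'n ^ 'm) *v x)"
  by (induction I rule: infinite_finite_induct)
    (auto simp: matrix_vector_mult_add_rdistrib)

lemma det_msc: "det (msc c A) = c ^ CARD('n) * det (A :: 'a::comm_ring_1 ^ 'n ^ 'n)"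
proof -
  have "msc c A = (\<chi> i. c *s (A $ i))"
    by (simp add: vec_eq_iff)
  then show ?thesis
    using det_rows_mul[of "\<lambda>_. c" "\<lambda>i. A $ i"] by (simp add: prod_constant)
qed

section \<open>Powers and polynomials of a square matrix\<close>

primrec mpow :: "'a::comm_ring_1 ^ 'n ^ 'n \<Rightarrow> nat \<Rightarrow> 'a ^ 'n ^ 'n" where
  "mpow A 0 = mat 1"
| "mpow A (Suc k) = A ** mpow A k"

lemma mpow_add: "mpow A (i + j) = mpow A i ** mpow A j"
  by (induction i) (simp_all add: matrix_mul_assoc)

lemma mpow_commute: "A ** B = B ** A \<Longrightarrow> mpow A k ** B = B ** mpow A k"
  by (induction k) (simp_all, metis matrix_mul_assoc)

lemma mpow_intertwine: "A ** B = B ** C \<Longrightarrow> mpow A k ** B = B ** mpow C k"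
  by (induction k) (simp_all, metis matrix_mul_assoc)

lemma mpow_mult: "mpow A (i * j) = mpow (mpow A i) j"
  by (induction j) (simp_all add: mpow_add)

lemma mpow_msc: "mpow (msc c A) k = msc (c ^ k) (mpow A k)"
  by (induction k) (simp_all add: msc_mult_left msc_mult_right mult.commute)

lemma det_mpow: "det (mpow A k) = det A ^ k"
  by (induction k) (simp_all add: det_mul)

text \<open>A polynomial of degree below \<open>d\<close> is kept as a bare coefficient function, so
  that the same polynomial can be evaluated at the matrix of \<open>\<beta>\<close> and at a
  perturbation of it.\<close>

definition mpoly :: "nat \<Rightarrow> (nat \<Rightarrow> 'a::comm_ring_1) \<Rightarrow> 'a ^ 'n ^ 'n \<Rightarrow> 'a ^ 'n ^ 'n" where
  "mpoly d c A = (\<Sum>i<d. msc (c i) (mpow A i))"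

lemma mpoly_commute: "mpoly d c A ** A = A ** mpoly d c A"
  by (simp add: mpoly_def matrix_sum_ldistrib matrix_sum_rdistrib msc_mult_left msc_mult_right
      mpow_commute)

lemma mpoly_vec: "mpoly d c A *v x = (\<Sum>i<d. c i *s (mpow A i *v x))"
  by (simp add: mpoly_def matrix_vector_sum_rdistrib msc_mult_vec)

definition cols :: "('m \<Rightarrow> 'a ^ 'n) \<Rightarrow> 'a ^ 'm ^ 'n" where
  "cols f = (\<chi> i j. f j $ i)"

lemma cols_nth [simp]: "cols f $ i $ j = f j $ i"
  by (simp add: cols_def)

lemma mult_cols: "A ** cols f = cols (\<lambda>j. A *v f j)"
  by (rule mat_eqI) (simp add: matrix_mult_nth matrix_vector_nth)

lemma cols_column: "cols (\<lambda>j. column j A) = A"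
  by (rule mat_eqI) (simp add: column_def)

lemma cols_mult_vec: "cols f *v (x :: 'a::comm_ring_1 ^ 'm) = (\<Sum>j\<in>UNIV. x $ j *s f j)"
  by (simp add: vec_eq_iff matrix_vector_nth mult.commute)

lemma inverse_unique_matrix:
  "A ** B = mat 1 \<Longrightarrow> C ** A = mat 1 \<Longrightarrow> B = (C :: 'a::comm_ring_1 ^ 'n ^ 'n)"
  by (metis matrix_mul_assoc matrix_mul_lid matrix_mul_rid)

section \<open>Arithmetic of the absolute value\<close>

locale uniformized_field = nonarch_local_field nm for nm :: "'f::field \<Rightarrow> real" +
  fixes \<pi> :: 'f
  assumes unif: "is_uniformizer nm \<pi>"
begin

lemma nm_0 [simp]: "nm 0 = 0"
  by (simp add: nm_eq_0_iff)

lemma nm_1 [simp]: "nm 1 = 1"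
  using nm_mult[of 1 1] nm_eq_0_iff[of 1] by simp

lemma nm_uminus [simp]: "nm (- x) = nm x"
proof -
  have "nm (-1) * nm (-1) = 1"
    using nm_mult[of "-1" "-1"] by simp
  then have "nm (-1) = 1"
    using nm_nonneg[of "-1"] by (simp add: square_eq_1_iff)
  then show ?thesis
    using nm_mult[of "-1" x] by simp
qed

lemma nm_add_le: "nm x \<le> R \<Longrightarrow> nm y \<le> R \<Longrightarrow> nm (x + y) \<le> R"
  using nm_ultrametric[of x y] by simp

lemma nm_diff_le: "nm x \<le> R \<Longrightarrow> nm y \<le> R \<Longrightarrow> nm (x - y) \<le> R"
  using nm_add_le[of x R "- y"] by simp

lemma nm_minus_commute: "nm (x - y) = nm (y - x)"
  by (metis minus_diff_eq nm_uminus)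

lemma nm_power: "nm (x ^ k) = nm x ^ k"
  by (induction k) (simp_all add: nm_mult)

lemma nm_pos_iff: "0 < nm x \<longleftrightarrow> x \<noteq> 0"
  using nm_nonneg[of x] nm_eq_0_iff[of x] by linarith

lemma nm_inverse: "nm (inverse x) = inverse (nm x)"
proof (cases "x = 0")
  case False
  then have "nm x * nm (inverse x) = 1"
    by (simp flip: nm_mult)
  then show ?thesis
    by (simp add: inverse_unique)
qed simp

lemma nm_divide: "nm (x / y) = nm x / nm y"
  by (simp add: divide_inverse nm_mult nm_inverse)

lemma nm_sum_le: "(\<And>i. i \<in> I \<Longrightarrow> nm (f i) \<le> R) \<Longrightarrow> 0 \<le> R \<Longrightarrow> nm (sum f I) \<le> R"
  by (induction I rule: infinite_finite_induct) (auto intro: nm_add_le)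

lemma nm_prod: "nm (prod f I) = (\<Prod>i\<in>I. nm (f i))"
  by (induction I rule: infinite_finite_induct) (auto simp: nm_mult)

lemma nm_mult_le: "nm x \<le> R \<Longrightarrow> nm y \<le> S \<Longrightarrow> nm (x * y) \<le> R * S"
  using nm_nonneg[of x] nm_nonneg[of y] by (simp add: nm_mult mult_mono)

text \<open>Ultrametric triangles are isosceles: a perturbation smaller than \<open>y\<close> cannot
  change its absolute value.\<close>

lemma nm_eq_of_close: "nm (x - y) < nm y \<Longrightarrow> nm x = nm y"
  using nm_ultrametric[of "x - y" y] nm_ultrametric[of "y - x" x] nm_minus_commute[of x y] by simp

lemma pi_nz: "\<pi> \<noteq> 0" and q_less1: "nm \<pi> < 1"
proof -
  obtain w where w: "0 < nm w" "nm w < 1"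
    using nm_discrete by blast
  then have "w \<in> {\<pi> * x | x. x \<in> ring_of_integers nm}"
    using unif by (auto simp: is_uniformizer_def maximal_ideal_def)
  then show "\<pi> \<noteq> 0"
    using w by auto
  have "\<pi> * 1 \<in> maximal_ideal nm"
    using unif unfolding is_uniformizer_def by (auto simp: ring_of_integers_def)
  then show "nm \<pi> < 1"
    by (simp add: maximal_ideal_def)
qed

lemma q_pos: "0 < nm \<pi>"
  using pi_nz by (simp add: nm_pos_iff)

lemma nm_less1_le: "nm x < 1 \<Longrightarrow> nm x \<le> nm \<pi>"
proof -
  assume "nm x < 1"
  then have "x \<in> {\<pi> * x | x. x \<in> ring_of_integers nm}"
    using unif by (auto simp: is_uniformizer_def maximal_ideal_def)
  then show "nm x \<le> nm \<pi>"
    using mult_left_mono[OF _ nm_nonneg, of _ 1 \<pi>] by (auto simp: ring_of_integers_def nm_mult)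
qed

lemma q_power_le_1: "nm \<pi> ^ k \<le> 1"
  using q_less1 q_pos by (simp add: power_le_one)

lemma ideal_power_iff: "x \<in> ideal_power nm \<pi> k \<longleftrightarrow> nm x \<le> nm \<pi> ^ k"
proof
  assume "x \<in> ideal_power nm \<pi> k"
  then show "nm x \<le> nm \<pi> ^ k"
    using q_pos mult_left_mono[of _ 1 "nm \<pi> ^ k"]
    by (auto simp: ideal_power_def ring_of_integers_def nm_mult nm_power)
next
  assume "nm x \<le> nm \<pi> ^ k"
  then have "x = \<pi> ^ k * (x / \<pi> ^ k)" "nm (x / \<pi> ^ k) \<le> 1"
    using q_pos pi_nz by (simp_all add: nm_divide nm_power)
  then show "x \<in> ideal_power nm \<pi> k"
    unfolding ideal_power_def ring_of_integers_def by blast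
qed

text \<open>With \<open>R = nm \<pi> ^ k\<close> this is divisibility by \<open>\<pi> ^ k\<close>; a
  general real \<open>R\<close> also expresses boundedness. One predicate thus serves integrality,
  congruences and compactness.\<close>

definition mbd :: "real \<Rightarrow> 'f ^ 'n ^ 'm \<Rightarrow> bool" where
  "mbd R A \<longleftrightarrow> (\<forall>i j. nm (A $ i $ j) \<le> R)"

abbreviation "mint \<equiv> mbd 1"

definition vint :: "'f ^ 'n \<Rightarrow> bool" where
  "vint x \<longleftrightarrow> (\<forall>i. nm (x $ i) \<le> 1)"

lemma mbdD: "mbd R A \<Longrightarrow> nm (A $ i $ j) \<le> R"
  by (simp add: mbd_def)

lemma mbd_nonneg: "mbd R A \<Longrightarrow> 0 \<le> R"
  using mbdD[of R A undefined undefined] nm_nonneg order_trans by blast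

lemma mbd_mono: "mbd R A \<Longrightarrow> R \<le> S \<Longrightarrow> mbd S A"
  by (meson mbd_def order_trans)

lemma mbd_add: "mbd R A \<Longrightarrow> mbd R B \<Longrightarrow> mbd R (A + B)"
  by (simp add: mbd_def nm_add_le)

lemma mbd_diff: "mbd R A \<Longrightarrow> mbd R B \<Longrightarrow> mbd R (A - B)"
  by (simp add: mbd_def nm_diff_le)

lemma mbd_0: "0 \<le> R \<Longrightarrow> mbd R 0"
  by (simp add: mbd_def)

lemma mbd_mat_1: "mint (mat 1)"
  by (simp add: mbd_def mat_def)

lemma mbd_mult: "mbd R A \<Longrightarrow> mbd S B \<Longrightarrow> mbd (R * S) (A ** B)"
proof -
  assume *: "mbd R A" "mbd S B"
  then have "0 \<le> R * S"
    by (simp add: mbd_nonneg)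
  with * show ?thesis
    unfolding mbd_def by (auto simp: matrix_mult_nth intro!: nm_sum_le nm_mult_le)
qed

lemma mint_mult: "mint A \<Longrightarrow> mint B \<Longrightarrow> mint (A ** B)"
  using mbd_mult[of 1 A 1 B] by simp

lemma mbd_msc: "mbd R A \<Longrightarrow> mbd (nm c * R) (msc c A)"
  by (simp add: mbd_def nm_mult_le)

lemma mint_msc: "nm c \<le> 1 \<Longrightarrow> mint A \<Longrightarrow> mint (msc c A)"
  using mbd_msc[of 1 A c] mbd_mono by fastforce

lemma mint_mpow: "mint A \<Longrightarrow> mint (mpow A k)"
  by (induction k) (auto intro: mint_mult mbd_mat_1)

lemma mbd_sum: "(\<And>i. i \<in> I \<Longrightarrow> mbd R (f i)) \<Longrightarrow> 0 \<le> R \<Longrightarrow> mbd R (\<Sum>i\<in>I. f i)"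
  by (induction I rule: infinite_finite_induct) (auto intro: mbd_add mbd_0)

lemma mint_mpoly: "mint A \<Longrightarrow> (\<And>i. nm (c i) \<le> 1) \<Longrightarrow> mint (mpoly d c A)"
  by (auto simp: mpoly_def intro!: mbd_sum mint_msc mint_mpow)

text \<open>One factor is exchanged at a time, so \<open>A\<close> and \<open>B\<close> need not
  commute.\<close>

lemma mbd_mpow_diff: "mint A \<Longrightarrow> mint B \<Longrightarrow> mbd R (A - B) \<Longrightarrow> mbd R (mpow A k - mpow B k)"
proof (induction k)
  case (Suc k)
  have "mpow A (Suc k) - mpow B (Suc k) = A ** (mpow A k - mpow B k) + (A - B) ** mpow B k"
    by (simp add: matrix_diff_ldistrib matrix_diff_rdistrib)
  moreover have "mbd R (A ** (mpow A k - mpow B k))" "mbd R ((A - B) ** mpow B k)"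
    using mbd_mult[OF Suc.prems(1) Suc.IH[OF Suc.prems]]
      mbd_mult[OF Suc.prems(3) mint_mpow[OF Suc.prems(2)], of k] by simp_all
  ultimately show ?case
    by (simp add: mbd_add)
qed (simp add: mbd_0 mbd_nonneg)

lemma mbd_mpoly_diff:
  assumes "mint A" "mint B" "mbd R (A - B)" "\<And>i. nm (c i) \<le> 1"
  shows "mbd R (mpoly d c A - mpoly d c B)"
proof -
  have "mbd R (msc (c i) (mpow A i - mpow B i))" for i
    using mbd_msc[OF mbd_mpow_diff[OF assms(1-3), of i], of "c i"] assms(4)[of i]
      mbd_nonneg[OF assms(3)] mult_right_mono[of "nm (c i)" 1 R] by (auto elim: mbd_mono)
  then show ?thesis
    unfolding mpoly_def by (auto simp flip: sum_subtractf msc_diff intro!: mbd_sum mbd_nonneg[OF assms(3)])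
qed

lemma mbd_divide:
  assumes "mbd (nm \<pi> ^ k) A"
  obtains Y where "mint Y" "A = msc (\<pi> ^ k) Y"
proof
  show "mint (msc (1 / \<pi> ^ k) A)"
    using mbd_msc[OF assms, of "1 / \<pi> ^ k"] q_pos by (simp add: nm_divide nm_power)
  show "A = msc (\<pi> ^ k) (msc (1 / \<pi> ^ k) A)"
    using pi_nz by (simp)
qed

lemma vint_mult: "mint A \<Longrightarrow> vint x \<Longrightarrow> vint (A *v x)"
  unfolding mbd_def vint_def
  by (auto simp: matrix_vector_nth intro!: nm_sum_le nm_mult_le[of _ 1 _ 1, simplified])

lemma mint_cols: "mint (cols f) \<longleftrightarrow> (\<forall>j. vint (f j))"
  by (auto simp: mbd_def vint_def)

section \<open>Determinants and inverses of bounded matrices\<close>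

lemma nm_prod_diff_le:
  assumes "finite I" "\<And>i. i \<in> I \<Longrightarrow> nm (f i) \<le> 1" "\<And>i. i \<in> I \<Longrightarrow> nm (g i) \<le> 1"
    "\<And>i. i \<in> I \<Longrightarrow> nm (f i - g i) \<le> R" "0 \<le> R"
  shows "nm (prod f I - prod g I) \<le> R"
  using assms
proof (induction I rule: finite_induct)
  case (insert i I)
  have "prod f (insert i I) - prod g (insert i I) =
      f i * (prod f I - prod g I) + (f i - g i) * prod g I"
    using insert by (simp add: algebra_simps)
  moreover have "nm (prod g I) \<le> 1"
    using insert.prems by (auto simp: nm_prod nm_nonneg intro!: prod_le_1)
  ultimately show ?case
    using insert nm_mult_le[of "f i" 1 "prod f I - prod g I" R] nm_mult_le[of "f i - g i" R "prod g I" 1]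
    by (auto intro!: nm_add_le)
qed simp

lemma nm_sign: "nm (of_int (sign p)) = 1"
  by (simp add: sign_def)

lemma nm_det_le: "mbd R A \<Longrightarrow> nm (det A) \<le> R ^ CARD('n)" for A :: "'f ^ 'n ^ 'n"
proof -
  assume *: "mbd R A"
  have "nm (\<Prod>i\<in>UNIV. A $ i $ p i) \<le> R ^ CARD('n)" for p
    using prod_mono[of UNIV "\<lambda>i. nm (A $ i $ p i)" "\<lambda>_. R"] mbdD[OF *]
    by (simp add: nm_prod nm_nonneg)
  then show ?thesis
    using mbd_nonneg[OF *] unfolding det_def
    by (auto intro!: nm_sum_le simp: nm_mult nm_sign)
qed

lemma nm_det_diff_le: "mint A \<Longrightarrow> mint B \<Longrightarrow> mbd R (A - B) \<Longrightarrow> nm (det A - det B) \<le> R"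
  for A :: "'f ^ 'n ^ 'n"
proof -
  assume *: "mint A" "mint B" "mbd R (A - B)"
  have "nm ((\<Prod>i\<in>UNIV. A $ i $ p i) - (\<Prod>i\<in>UNIV. B $ i $ p i)) \<le> R" for p
    using * mbd_nonneg[OF *(3)] by (intro nm_prod_diff_le) (auto simp: mbd_def)
  then show ?thesis
    using mbd_nonneg[OF *(3)] unfolding det_def
    by (auto intro!: nm_sum_le simp: nm_mult nm_sign simp flip: sum_subtractf right_diff_distrib)
qed

text \<open>Together with \<open>inverse_mint\<close> this makes a small perturbation of the
  identity invertible over the integers.\<close>

lemma nm_det_near_1:
  assumes "mbd R (A - mat 1)" "R < 1"
  shows "nm (det A) = 1" "mint A"
proof -
  have "mint (A - mat 1 + mat 1)"
    using assms by (intro mbd_add mbd_mat_1) (auto elim: mbd_mono)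
  then show "mint A"
    by simp
  then have "nm (det A - det (mat 1 :: 'f ^ 'a ^ 'a)) \<le> R"
    using assms by (intro nm_det_diff_le mbd_mat_1)
  then show "nm (det A) = 1"
    using assms(2) nm_eq_of_close[of "det A" 1] by simp
qed

text \<open>Cramer's rule: an entry of the inverse is, up to \<open>det A\<close>, the determinant
  of \<open>A\<close> with one column replaced by a unit vector. \<open>1 \<le> R\<close> keeps that
  column within the bound.\<close>

lemma inverse_mbd:
  fixes A :: "'f ^ 'n ^ 'n"
  assumes "mbd R A" "1 \<le> R" "det A \<noteq> 0"
  obtains A' where "A ** A' = mat 1" "A' ** A = mat 1" "mbd (R ^ CARD('n) / nm (det A)) A'"
proof -
  define f where "f j = (\<chi> k. det (\<chi> i j'. if j' = k then (axis j 1 :: 'f ^ 'n) $ i else A $ i $ j') / det A)" for j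
  have "A *v f j = axis j 1" for j
    unfolding f_def using cramer[OF assms(3)] by blast
  then have 1: "A ** cols f = mat 1"
    by (auto simp: mult_cols vec_eq_iff mat_def axis_def)
  moreover have "mbd (R ^ CARD('n) / nm (det A)) (cols f)"
  proof -
    have "mbd R (\<chi> i j'. if j' = k then (axis j 1 :: 'f ^ 'n) $ i else A $ i $ j')" for k j
      using assms by (auto simp: mbd_def axis_def)
    from nm_det_le[OF this] show ?thesis
      using nm_nonneg[of "det A"] by (auto simp: mbd_def f_def nm_divide divide_right_mono)
  qed
  ultimately show ?thesis
    using that matrix_left_right_inverse by blast
qed

lemma inverse_mint:
  assumes "mint A" "nm (det A) = 1"
  obtains A' where "A ** A' = mat 1" "A' ** A = mat 1" "mint A'"
proof -
  have "det A \<noteq> 0"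
    using assms(2) by auto
  then show ?thesis
    using inverse_mbd[OF assms(1)] assms(2) that by auto
qed

lemma q_power_le_iff: "nm \<pi> ^ i \<le> nm \<pi> ^ j \<longleftrightarrow> j \<le> i"
  using power_decreasing_iff[OF q_pos q_less1] .

lemma ex_q_power_le: "0 < \<epsilon> \<Longrightarrow> \<exists>k\<ge>m. nm \<pi> ^ k < \<epsilon>"
proof -
  assume "0 < \<epsilon>"
  then obtain k where "nm \<pi> ^ k < \<epsilon>"
    using real_arch_pow_inv q_less1 by blast
  moreover have "nm \<pi> ^ (max k m) \<le> nm \<pi> ^ k"
    by (simp add: q_power_le_iff)
  ultimately show ?thesis
    by (metis max.cobounded2 order_le_less_trans)
qed

lemma ex_q_power_ge: "\<exists>k. R \<le> 1 / nm \<pi> ^ k"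
proof -
  obtain k where k: "nm \<pi> ^ k < 1 / (\<bar>R\<bar> + 1)"
    using ex_q_power_le[of "1 / (\<bar>R\<bar> + 1)" 0] by (auto simp: add_pos_nonneg add.commute)
  have "\<bar>R\<bar> + 1 < 1 / nm \<pi> ^ k"
    using k q_pos by (simp add: field_simps)
  then show ?thesis
    by (intro exI[of _ k]) linarith
qed

lemma mbd_exists: "\<exists>R\<ge>1. mbd R (A :: 'f ^ 'n ^ 'm)"
proof -
  let ?S = "range (\<lambda>(i, j). nm (A $ i $ j))"
  have "nm (A $ i $ j) \<le> Max ?S" for i j
    by (rule Max_ge) (auto intro: range_eqI[of _ _ "(i, j)"])
  then show ?thesis
    by (intro exI[of _ "max 1 (Max ?S)"]) (auto simp: mbd_def le_max_iff_disj)
qed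

end

section \<open>The Cartan decomposition\<close>

definition elem_mat :: "'n \<Rightarrow> 'n \<Rightarrow> 'a::comm_ring_1 \<Rightarrow> 'a ^ 'n ^ 'n" where
  "elem_mat i j c = (\<chi> a b. if a = i \<and> b = j then c else 0)"

lemma elem_mat_nth: "elem_mat i j c $ a $ b = (if a = i \<and> b = j then c else 0)"
  by (simp add: elem_mat_def)

lemma elem_mat_mult_left: "(elem_mat i j c ** A) $ a $ b = (if a = i then c * A $ j $ b else 0)"
  by (simp add: matrix_mult_nth elem_mat_nth if_distrib[of "\<lambda>x. x * _"] cong: if_cong)

lemma elem_mat_mult_right: "(A ** elem_mat i j c) $ a $ b = (if b = j then A $ a $ i * c else 0)"
  by (simp add: matrix_mult_nth elem_mat_nth if_distrib[of "\<lambda>x. _ * x"] cong: if_cong)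

lemma det_transvection:
  assumes "i \<noteq> j"
  shows "det (mat 1 + elem_mat i j c) = 1"
proof -
  have "mat 1 + elem_mat i j c = (\<chi> k. if k = i then row i (mat 1) + c *s row j (mat 1) else row k (mat 1))"
    by (auto simp: vec_eq_iff row_def elem_mat_nth mat_def)
  then show ?thesis
    using det_row_operation[OF assms, of "mat 1" c] by simp
qed

lemma trace_elem_mat: "trace (elem_mat i j c ** A) = c * A $ j $ i"
  by (simp add: trace_def elem_mat_mult_left)

context uniformized_field
begin

section \<open>Elementary operations of determinant 1 over the integers\<close>

definition slint :: "'f ^ 'n ^ 'n \<Rightarrow> bool" where
  "slint k \<longleftrightarrow> mint k \<and> det k = 1"

lemma slint_1: "slint (mat 1)"
  by (simp add: slint_def mbd_mat_1)

lemma slint_mult: "slint A \<Longrightarrow> slint B \<Longrightarrow> slint (A ** B)"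
  by (simp add: slint_def mint_mult det_mul)

lemma slint_transvection: "i \<noteq> j \<Longrightarrow> nm c \<le> 1 \<Longrightarrow> slint (mat 1 + elem_mat i j c)"
  unfolding slint_def by (auto simp: det_transvection intro!: mbd_add mbd_mat_1)
    (simp add: mbd_def elem_mat_nth)

lemma slint_transpose: "slint k \<Longrightarrow> slint (transpose k)"
  by (simp add: slint_def mbd_def transpose_def[of k] flip: det_transpose[of k])

lemma slint_inverse:
  assumes "slint k"
  obtains k' where "k ** k' = mat 1" "k' ** k = mat 1" "slint k'"
proof -
  obtain k' where k': "k ** k' = mat 1" "k' ** k = mat 1" "mint k'"
    using inverse_mint assms by (metis slint_def nm_1)
  then have "det k * det k' = 1"
    by (metis det_mul det_I)
  then show ?thesis
    using k' assms that by (simp add: slint_def)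
qed

text \<open>Row \<open>s\<close> is itself untouched since \<open>s \<notin> T\<close>, so the
  transvections for the different rows of \<open>T\<close> do not interfere. One \<open>k\<close>
  works for all \<open>A\<close>.\<close>

lemma ex_row_clear:
  assumes "finite T" "s \<notin> T" "\<And>i. i \<in> T \<Longrightarrow> nm (x i) \<le> 1"
  shows "\<exists>k. slint k \<and> (\<forall>A :: 'f ^ 'n ^ 'n. \<forall>a b.
           (k ** A) $ a $ b = A $ a $ b + (if a \<in> T then x a * A $ s $ b else 0))"
  using assms
proof (induction T rule: finite_induct)
  case empty
  then show ?case
    by (intro exI[of _ "mat 1"]) (simp add: slint_1)
next
  case (insert i T)
  then obtain k where k: "slint k" "\<And>A a b. (k ** (A :: 'f ^ 'n ^ 'n)) $ a $ b =
      A $ a $ b + (if a \<in> T then x a * A $ s $ b else 0)"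
    by auto
  show ?case
  proof (intro exI conjI allI)
    show "slint ((mat 1 + elem_mat i s (x i)) ** k)"
      using insert.prems k(1) by (intro slint_mult slint_transvection) auto
  next
    fix A :: "'f ^ 'n ^ 'n" and a b
    have "(((mat 1 + elem_mat i s (x i)) ** k) ** A) $ a $ b =
        (k ** A) $ a $ b + (elem_mat i s (x i) ** (k ** A)) $ a $ b"
      by (simp add: matrix_add_rdistrib flip: matrix_mul_assoc)
    then show "(((mat 1 + elem_mat i s (x i)) ** k) ** A) $ a $ b =
        A $ a $ b + (if a \<in> insert i T then x a * A $ s $ b else 0)"
      using insert.prems(1) insert.hyps(2) by (auto simp: k(2) elem_mat_mult_left)
  qed
qed

lemma ex_col_clear:
  assumes "finite T" "s \<notin> T" "\<And>i. i \<in> T \<Longrightarrow> nm (x i) \<le> 1"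
  shows "\<exists>k. slint k \<and> (\<forall>A :: 'f ^ 'n ^ 'n. \<forall>a b.
           (A ** k) $ a $ b = A $ a $ b + (if b \<in> T then A $ a $ s * x b else 0))"
proof -
  obtain k where k: "slint k" "\<And>A a b. (k ** (A :: 'f ^ 'n ^ 'n)) $ a $ b =
      A $ a $ b + (if a \<in> T then x a * A $ s $ b else 0)"
    using ex_row_clear[of T s x] assms by blast
  have "(A ** transpose k) $ a $ b = A $ a $ b + (if b \<in> T then A $ a $ s * x b else 0)"
    for A :: "'f ^ 'n ^ 'n" and a b
  proof -
    have "(A ** transpose k) $ a $ b = transpose (k ** transpose A) $ a $ b"
      by (simp add: matrix_transpose_mul)
    then show ?thesis
      by (simp add: transpose_def[of "k ** _"] k(2)) (simp add: transpose_def)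
  qed
  then show ?thesis
    using slint_transpose[OF k(1)] by blast
qed

text \<open>Block form: diagonal on \<open>S\<close>, arbitrary on the complement, zero in between.
  The elimination enlarges \<open>S\<close> one index at a time.\<close>

definition diag_on :: "'n set \<Rightarrow> 'f ^ 'n ^ 'n \<Rightarrow> bool" where
  "diag_on S A \<longleftrightarrow> (\<forall>i j. i \<noteq> j \<and> (i \<in> S \<or> j \<in> S) \<longrightarrow> A $ i $ j = 0)"

lemma diag_on_step:
  fixes A :: "'f ^ 'n ^ 'n"
  assumes S: "diag_on S A" and s: "s \<notin> S"
  shows "\<exists>k k'. slint k \<and> slint k' \<and> diag_on (insert s S) (k ** A ** k')"
proof (cases "\<forall>i j. i \<notin> S \<and> j \<notin> S \<longrightarrow> A $ i $ j = 0")
  case True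
  then have "diag_on (insert s S) (mat 1 ** A ** mat 1)"
    using S by (auto simp: diag_on_def)
  then show ?thesis
    using slint_1 by blast
next
  case False
  define N where "N = (\<lambda>(i, j). nm (A $ i $ j)) ` ((- S) \<times> (- S))"
  define M where "M = Max N"
  have N: "finite N" "N \<noteq> {}"
    using False by (auto simp: N_def)
  then have "M \<in> N"
    unfolding M_def by (rule Max_in)
  then obtain i0 j0 where ij: "i0 \<notin> S" "j0 \<notin> S" "nm (A $ i0 $ j0) = M"
    by (auto simp: N_def)
  have le: "nm (A $ i $ j) \<le> M" if "i \<notin> S" "j \<notin> S" for i j
    unfolding M_def using that N by (intro Max_ge) (auto simp: N_def)
  have M0: "M > 0"
  proof -
    obtain i j where "i \<notin> S" "j \<notin> S" "A $ i $ j \<noteq> 0"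
      using False by auto
    then show ?thesis
      using le[of i j] nm_pos_iff[of "A $ i $ j"] by simp
  qed
  \<comment> \<open>Adding at most one row and at most one column moves an entry of maximal norm to the pivot.\<close>
  obtain k1 where k1: "slint k1" "diag_on S (k1 ** A)" "nm ((k1 ** A) $ s $ j0) = M"
    "\<And>i j. i \<notin> S \<Longrightarrow> j \<notin> S \<Longrightarrow> nm ((k1 ** A) $ i $ j) \<le> M"
  proof (cases "nm (A $ s $ j0) = M")
    case True
    then show ?thesis
      using that[of "mat 1"] S le slint_1 by simp
  next
    case False
    have ne: "s \<noteq> i0"
      using False ij by auto
    have eq: "((mat 1 + elem_mat s i0 1) ** A) $ a $ b = A $ a $ b + (if a = s then A $ i0 $ b else 0)" for a b
      by (simp add: matrix_add_rdistrib elem_mat_mult_left)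
    have "nm (A $ s $ j0) < M"
      using le[of s j0] False s ij by simp
    then have M: "nm (A $ s $ j0 + A $ i0 $ j0) = M"
      using nm_eq_of_close[of "A $ s $ j0 + A $ i0 $ j0" "A $ i0 $ j0"] ij by simp
    show ?thesis
    proof (rule that)
      show "slint (mat 1 + elem_mat s i0 1)"
        using ne by (simp add: slint_transvection)
      show "diag_on S ((mat 1 + elem_mat s i0 1) ** A)"
        using S s ij by (auto simp: eq diag_on_def; metis)
      show "nm (((mat 1 + elem_mat s i0 1) ** A) $ s $ j0) = M"
        by (simp add: eq M)
      show "nm (((mat 1 + elem_mat s i0 1) ** A) $ i $ j) \<le> M" if "i \<notin> S" "j \<notin> S" for i j
        using le[of i j] le[of i0 j] that ij by (auto simp: eq intro: nm_add_le)
    qed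
  qed
  obtain k2 where k2: "slint k2" "diag_on S (k1 ** A ** k2)" "nm ((k1 ** A ** k2) $ s $ s) = M"
    "\<And>i j. i \<notin> S \<Longrightarrow> j \<notin> S \<Longrightarrow> nm ((k1 ** A ** k2) $ i $ j) \<le> M"
  proof (cases "nm ((k1 ** A) $ s $ s) = M")
    case True
    then show ?thesis
      using that[of "mat 1"] k1 slint_1 by simp
  next
    case False
    have ne: "j0 \<noteq> s"
      using False k1 by auto
    have eq: "(k1 ** A ** (mat 1 + elem_mat j0 s 1)) $ a $ b =
        (k1 ** A) $ a $ b + (if b = s then (k1 ** A) $ a $ j0 else 0)" for a b
      by (simp add: matrix_add_ldistrib elem_mat_mult_right)
    have "nm ((k1 ** A) $ s $ s) < M"
      using k1(4)[of s s] False s ij by simp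
    then have M: "nm ((k1 ** A) $ s $ s + (k1 ** A) $ s $ j0) = M"
      using nm_eq_of_close[of "(k1 ** A) $ s $ s + (k1 ** A) $ s $ j0" "(k1 ** A) $ s $ j0"] k1 by simp
    show ?thesis
    proof (rule that)
      show "slint (mat 1 + elem_mat j0 s 1)"
        using ne by (simp add: slint_transvection)
      show "diag_on S (k1 ** A ** (mat 1 + elem_mat j0 s 1))"
        using k1(2) s ij by (auto simp: eq diag_on_def; metis)
      show "nm ((k1 ** A ** (mat 1 + elem_mat j0 s 1)) $ s $ s) = M"
        by (simp add: eq M)
      show "nm ((k1 ** A ** (mat 1 + elem_mat j0 s 1)) $ i $ j) \<le> M" if "i \<notin> S" "j \<notin> S" for i j
        using k1(4)[of i j] k1(4)[of i j0] that ij by (auto simp: eq intro: nm_add_le)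
    qed
  qed
  define A2 where "A2 = k1 ** A ** k2"
  define T where "T = - insert s S"
  have A2: "A2 $ s $ s \<noteq> 0" "\<And>i. i \<in> T \<Longrightarrow> nm (A2 $ i $ s / A2 $ s $ s) \<le> 1"
    "\<And>i. i \<in> T \<Longrightarrow> nm (A2 $ s $ i / A2 $ s $ s) \<le> 1" "diag_on S A2"
    using k2(2-4) M0 s by (auto simp: A2_def T_def nm_divide simp flip: nm_pos_iff)
  obtain k3 where k3: "slint k3" "\<And>A a b. (k3 ** (A :: 'f ^ 'n ^ 'n)) $ a $ b =
      A $ a $ b + (if a \<in> T then - (A2 $ a $ s / A2 $ s $ s) * A $ s $ b else 0)"
    using ex_row_clear[of T s "\<lambda>i. - (A2 $ i $ s / A2 $ s $ s)"] A2 by (auto simp: T_def)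
  obtain k4 where k4: "slint k4" "\<And>A a b. ((A :: 'f ^ 'n ^ 'n) ** k4) $ a $ b =
      A $ a $ b + (if b \<in> T then A $ a $ s * - (A2 $ s $ b / A2 $ s $ s) else 0)"
    using ex_col_clear[of T s "\<lambda>i. - (A2 $ s $ i / A2 $ s $ s)"] A2 by (auto simp: T_def)
  have "diag_on (insert s S) (k3 ** A2 ** k4)"
    using A2(1,4) s unfolding diag_on_def k4(2) k3(2) by (auto simp: T_def; metis)
  moreover have "k3 ** A2 ** k4 = (k3 ** k1) ** A ** (k2 ** k4)"
    by (simp add: A2_def matrix_mul_assoc)
  ultimately show ?thesis
    using slint_mult k1 k2 k3 k4 by metis
qed

lemma cartan_decomposition:
  fixes g :: "'f ^ 'n ^ 'n"
  obtains k k' D where "slint k" "slint k'" "g = k ** D ** k'" "\<And>i j. i \<noteq> j \<Longrightarrow> D $ i $ j = 0"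
proof -
  have "\<exists>k k'. slint k \<and> slint k' \<and> diag_on S (k ** g ** k')" if "finite S" for S
    using that
  proof (induction S rule: finite_induct)
    case empty
    then show ?case
      using slint_1 by (auto simp: diag_on_def)
  next
    case (insert s S)
    then obtain k k' where k: "slint k" "slint k'" "diag_on S (k ** g ** k')"
      by blast
    obtain h h' where h: "slint h" "slint h'" "diag_on (insert s S) (h ** (k ** g ** k') ** h')"
      using diag_on_step[OF k(3) insert.hyps(2)] by blast
    moreover have "h ** (k ** g ** k') ** h' = (h ** k) ** g ** (k' ** h')"
      by (simp add: matrix_mul_assoc)
    ultimately show ?case
      using slint_mult k(1,2) by metis
  qed
  from this[of UNIV] obtain k k' where k: "slint k" "slint k'" "diag_on UNIV (k ** g ** k')"
    by auto
  obtain h where h: "k ** h = mat 1" "h ** k = mat 1" "slint h"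
    using slint_inverse[OF k(1)] by blast
  obtain h' where h': "k' ** h' = mat 1" "h' ** k' = mat 1" "slint h'"
    using slint_inverse[OF k(2)] by blast
  have "h ** (k ** g ** k') ** h' = (h ** k) ** g ** (k' ** h')"
    by (simp add: matrix_mul_assoc)
  then have "g = h ** (k ** g ** k') ** h'"
    by (simp add: h h')
  then show ?thesis
    using that[OF h(3) h'(3)] k(3) by (auto simp: diag_on_def)
qed

text \<open>Once \<open>g\<close> is diagonal, duality can be checked entry by entry. An entry of
  \<open>B\<close> in Cartan coordinates either stays integral under conjugation after scaling by
  \<open>\<pi> ^ (m - (l + L))\<close>, or the test with the matching elementary matrix shows that
  it is divisible by \<open>\<pi> ^ L\<close>; \<open>\<gamma>\<close> arises by deleting the
  entries of the second kind. The determinant condition for all \<open>x\<close> lets the user of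
  this lemma scale the test matrix.\<close>

lemma ex_integral_approximation:
  fixes g g' B :: "'f ^ 'n ^ 'n"
  assumes g: "g ** g' = mat 1" and B: "mint B" and m: "l + L \<le> m"
    and test: "\<And>X. mint X \<Longrightarrow> (\<And>x. det (mat 1 + msc x X) = 1) \<Longrightarrow>
      mbd (nm \<pi> ^ m) (g' ** msc (\<pi> ^ l) X ** g) \<Longrightarrow> nm (trace (X ** B)) \<le> nm \<pi> ^ L"
  shows "\<exists>\<gamma> \<gamma>'. mint \<gamma> \<and> mbd (nm \<pi> ^ L) (\<gamma> - B) \<and> mint \<gamma>' \<and>
           msc (\<pi> ^ (m - (l + L))) \<gamma> ** g = g ** \<gamma>'"
proof -
  obtain k k' D where k: "slint k" "slint k'" "g = k ** D ** k'" and
    D: "\<And>i j. i \<noteq> j \<Longrightarrow> D $ i $ j = 0"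
    using cartan_decomposition by blast
  obtain h where h: "k ** h = mat 1" "h ** k = mat 1" "slint h"
    using slint_inverse[OF k(1)] by blast
  obtain h' where h': "k' ** h' = mat 1" "h' ** k' = mat 1" "slint h'"
    using slint_inverse[OF k(2)] by blast
  have "det g * det g' = 1"
    using g by (metis det_mul det_I)
  then have "det D \<noteq> 0"
    using k by (auto simp: slint_def det_mul)
  then have D0: "D $ i $ i \<noteq> 0" for i
    by (auto simp: det_diagonal[OF D])
  define D' :: "'f ^ 'n ^ 'n" where "D' = (\<chi> i j. if i = j then 1 / D $ i $ i else 0)"
  have D_mult: "(D ** A) $ i $ j = D $ i $ i * A $ i $ j" for A :: "'f ^ 'n ^ 'n" and i j
  proof -
    have "(D ** A) $ i $ j = (\<Sum>t\<in>UNIV. if i = t then D $ i $ i * A $ i $ j else 0)"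
      unfolding matrix_mult_nth by (rule sum.cong) (auto simp: D)
    then show ?thesis by simp
  qed
  have mult_D: "(A ** D) $ i $ j = A $ i $ j * D $ j $ j" for A :: "'f ^ 'n ^ 'n" and i j
  proof -
    have "(A ** D) $ i $ j = (\<Sum>t\<in>UNIV. if t = j then A $ i $ j * D $ j $ j else 0)"
      unfolding matrix_mult_nth by (rule sum.cong) (auto simp: D)
    then show ?thesis by simp
  qed
  have D'_mult: "(D' ** A) $ i $ j = A $ i $ j / D $ i $ i" for A :: "'f ^ 'n ^ 'n" and i j
  proof -
    have "(D' ** A) $ i $ j = (\<Sum>t\<in>UNIV. if i = t then A $ i $ j / D $ i $ i else 0)"
      unfolding matrix_mult_nth by (rule sum.cong) (auto simp: D'_def)
    then show ?thesis by simp
  qed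
  have "D ** D' = mat 1"
    using D0 by (auto simp: vec_eq_iff D_mult) (auto simp: D'_def mat_def)
  then have "g ** (h' ** D' ** h) = mat 1"
    unfolding k(3) by (metis h(1) h'(1) matrix_mul_assoc matrix_mul_rid)
  then have g': "g' = h' ** D' ** h"
    using g by (metis inverse_unique_matrix matrix_left_right_inverse)
  \<comment> \<open>\<open>B\<close> in the coordinates in which \<open>g\<close> becomes
    \<open>D\<close>. The indices in \<open>good\<close> are swapped because the trace against
    \<open>elem_mat i j\<close> reads off the entry in row \<open>j\<close> and column
    \<open>i\<close>.\<close>
  define B' where "B' = h ** B ** k"
  define c where "c = m - (l + L)"
  define good where "good i j \<longleftrightarrow> nm (\<pi> ^ c * B' $ j $ i * D $ i $ i / D $ j $ j) \<le> 1" for i j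
  have B': "mint B'"
    using B h k by (simp add: B'_def mint_mult slint_def)
  have conj: "k ** (h ** A ** k) ** h = A" for A
    by (metis h(1) matrix_mul_assoc matrix_mul_lid matrix_mul_rid)
  have test': "nm (x * B' $ j $ i) \<le> nm \<pi> ^ L"
    if "i \<noteq> j" "nm x \<le> 1" "nm (\<pi> ^ l * x * D $ j $ j / D $ i $ i) \<le> nm \<pi> ^ m" for i j x
  proof -
    define X where "X = k ** elem_mat i j x ** h"
    have "mint (elem_mat i j x)"
      using that by (simp add: mbd_def elem_mat_nth)
    then have "mint X"
      using h k by (simp add: X_def mint_mult slint_def)
    moreover have "det (mat 1 + msc y X) = 1" for y
    proof -
      have "msc y X = k ** elem_mat i j (y * x) ** h"
        using arg_cong[of "msc y (elem_mat i j x)" "elem_mat i j (y * x)" "\<lambda>A. k ** A ** h"]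
        by (simp add: X_def vec_eq_iff elem_mat_nth msc_mult_left msc_mult_right)
      then have "mat 1 + msc y X = k ** (mat 1 + elem_mat i j (y * x)) ** h"
        by (simp add: matrix_add_ldistrib matrix_add_rdistrib h)
      then show ?thesis
        using h(3) k(1) that(1) by (simp add: det_mul det_transvection slint_def)
    qed
    moreover have "mbd (nm \<pi> ^ m) (g' ** msc (\<pi> ^ l) X ** g)"
    proof -
      have "g' ** msc (\<pi> ^ l) X ** g =
          h' ** (D' ** (h ** k) ** msc (\<pi> ^ l) (elem_mat i j x) ** (h ** k) ** D) ** k'"
        unfolding g' k(3) X_def
        by (simp only: msc_mult_left msc_mult_right matrix_mul_assoc)
      also have "\<dots> = h' ** (D' ** msc (\<pi> ^ l) (elem_mat i j x) ** D) ** k'"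
        by (simp add: h)
      finally have *: "g' ** msc (\<pi> ^ l) X ** g = h' ** (D' ** msc (\<pi> ^ l) (elem_mat i j x) ** D) ** k'" .
      have "mbd (nm \<pi> ^ m) (D' ** msc (\<pi> ^ l) (elem_mat i j x) ** D)"
        using that(3) q_pos by (auto simp: mbd_def mult_D D'_mult elem_mat_nth)
      from mbd_mult[OF mbd_mult[of 1 h', OF _ this], of 1 k'] show ?thesis
        unfolding * using h' k by (simp add: slint_def)
    qed
    ultimately have "nm (trace (X ** B)) \<le> nm \<pi> ^ L"
      by (rule test)
    moreover have "trace (X ** B) = trace (elem_mat i j x ** B')"
    proof -
      have "trace (X ** B) = trace (k ** (elem_mat i j x ** h ** B))"
        by (simp add: X_def matrix_mul_assoc)
      also have "\<dots> = trace ((elem_mat i j x ** h ** B) ** k)"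
        by (rule trace_mul_sym)
      finally show ?thesis
        by (simp add: B'_def matrix_mul_assoc)
    qed
    ultimately show ?thesis
      by (simp add: trace_elem_mat)
  qed
  have bad: "nm (B' $ j $ i) \<le> nm \<pi> ^ L" if "\<not> good i j" for i j
  proof -
    \<comment> \<open>Conjugation by \<open>D\<close> fixes the diagonal entries, so these are
      always good.\<close>
    have ij: "i \<noteq> j"
    proof
      assume "i = j"
      then have "nm (\<pi> ^ c * B' $ j $ i * D $ i $ i / D $ j $ j) = nm (\<pi> ^ c * B' $ j $ i)"
        using D0 by simp
      moreover have "nm (\<pi> ^ c * B' $ j $ i) \<le> 1 * 1"
        using B' by (intro nm_mult_le) (auto simp: nm_power q_power_le_1 mbd_def)
      ultimately show False
        using that by (simp add: good_def)
    qed
    \<comment> \<open>The scalar for which the conjugated test matrix lies exactly at level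
      \<open>m\<close>. If it is not integral, the scalar 1 already passes.\<close>
    define x where "x = \<pi> ^ (m - l) * D $ i $ i / D $ j $ j"
    have ml: "\<pi> ^ l * \<pi> ^ (m - l) = \<pi> ^ m" "\<pi> ^ (m - l) = \<pi> ^ c * \<pi> ^ L"
      using m by (simp_all add: c_def flip: power_add)
    show ?thesis
    proof (cases "nm x \<le> 1")
      case True
      have "\<pi> ^ l * x * D $ j $ j / D $ i $ i = \<pi> ^ m"
        using D0 by (simp add: x_def flip: ml(1))
      then have "nm (x * B' $ j $ i) \<le> nm \<pi> ^ L"
        using test'[OF ij True] by (simp add: nm_power)
      moreover have "x * B' $ j $ i = \<pi> ^ L * (\<pi> ^ c * B' $ j $ i * D $ i $ i / D $ j $ j)"
        by (simp add: x_def ml(2))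
      ultimately have "nm \<pi> ^ L * nm (\<pi> ^ c * B' $ j $ i * D $ i $ i / D $ j $ j) \<le> nm \<pi> ^ L * 1"
        by (simp only: nm_mult nm_power mult_1_right)
      then have "good i j"
        using q_pos by (simp add: good_def)
      then show ?thesis
        using that by simp
    next
      case False
      have "\<pi> ^ l * 1 * D $ j $ j / D $ i $ i = \<pi> ^ m / x"
        using D0 pi_nz by (simp add: x_def flip: ml(1))
      moreover have "nm (\<pi> ^ m / x) \<le> nm \<pi> ^ m"
        using False q_pos by (simp add: nm_divide nm_power divide_le_eq)
      ultimately show ?thesis
        using test'[OF ij, of 1] by simp
    qed
  qed
  define \<gamma>0 :: "'f ^ 'n ^ 'n" where "\<gamma>0 = (\<chi> j i. if good i j then B' $ j $ i else 0)"
  define \<nu> :: "'f ^ 'n ^ 'n" where "\<nu> = D' ** msc (\<pi> ^ c) \<gamma>0 ** D"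
  have \<gamma>0: "mint \<gamma>0" "mbd (nm \<pi> ^ L) (\<gamma>0 - B')" "mint \<nu>" "msc (\<pi> ^ c) \<gamma>0 ** D = D ** \<nu>"
  proof -
    show "mint \<gamma>0" "mbd (nm \<pi> ^ L) (\<gamma>0 - B')"
      using B' bad q_pos by (auto simp: mbd_def \<gamma>0_def)
    show "mint \<nu>"
      by (auto simp: mbd_def \<nu>_def \<gamma>0_def mult_D D'_mult good_def algebra_simps)
    show "msc (\<pi> ^ c) \<gamma>0 ** D = D ** \<nu>"
      unfolding \<nu>_def matrix_mul_assoc using \<open>D ** D' = mat 1\<close> by simp
  qed
  show ?thesis
  proof (intro exI conjI)
    show "mint (k ** \<gamma>0 ** h)"
      using \<gamma>0 h k by (simp add: mint_mult slint_def)
    have "k ** \<gamma>0 ** h - B = k ** (\<gamma>0 - B') ** h"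
      by (simp add: matrix_diff_ldistrib matrix_diff_rdistrib B'_def conj)
    then show "mbd (nm \<pi> ^ L) (k ** \<gamma>0 ** h - B)"
      using mbd_mult[OF mbd_mult[of 1 k, OF _ \<gamma>0(2)], of 1 h] h k by (simp add: slint_def)
    show "mint (h' ** \<nu> ** k')"
      using \<gamma>0 h' k by (simp add: mint_mult slint_def)
    have "msc (\<pi> ^ c) (k ** \<gamma>0 ** h) ** g = k ** (msc (\<pi> ^ c) \<gamma>0 ** (h ** k) ** D) ** k'"
      by (simp only: k(3) matrix_mul_assoc msc_mult_left msc_mult_right)
    also have "\<dots> = k ** D ** (k' ** h') ** \<nu> ** k'"
      by (simp add: h h' \<gamma>0(4) matrix_mul_assoc)
    also have "\<dots> = g ** (h' ** \<nu> ** k')"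
      by (simp only: k(3) matrix_mul_assoc)
    finally show "msc (\<pi> ^ (m - (l + L))) (k ** \<gamma>0 ** h) ** g = g ** (h' ** \<nu> ** k')"
      by (simp add: c_def)
  qed
qed

end

section \<open>Lattices stable under a perturbed generator\<close>

lemma matrix_vector_sum_ldistrib: "A *v (\<Sum>i\<in>I. f i) = (\<Sum>i\<in>I. (A :: 'a::comm_ring_1 ^ 'n ^ 'm) *v f i)"
  by (induction I rule: infinite_finite_induct) (simp_all add: matrix_vector_right_distrib)

text \<open>
  \<open>B\<close> stands for the matrix of a generator \<open>\<beta>\<close> of the integer ring of \<open>K\<close>, \<open>mpoly d p B\<close> for that of
  a uniformizer. The integer ring modulo the uniformizer is a field generated by \<open>\<beta>\<close>, hence the
  alternative in \<open>generates\<close>.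
\<close>

locale ramified_matrix = uniformized_field nm \<pi> for nm :: "'f::field \<Rightarrow> real" and \<pi> +
  fixes B :: "'f ^ 'n ^ 'n" and d :: nat and p :: "nat \<Rightarrow> 'f" and e :: nat
    and Q u :: "'f ^ 'n ^ 'n"
  assumes B: "mint B" and p: "nm (p i) \<le> 1" and e: "e \<noteq> 0"
    and Q: "mint Q" "mpoly d p B ** Q = msc \<pi> (mat 1)"
    and u: "mint u" "nm (det u) = 1" "mpow (mpoly d p B) e = msc \<pi> u"
    and generates: "vint w \<Longrightarrow> (\<exists>x. vint x \<and> w = mpoly d p B *v x) \<or>
      (\<forall>z. vint z \<longrightarrow> (\<exists>c. (\<forall>i. nm (c i) \<le> 1) \<and> mpoly d c B *v w = z))"
    and unramified: "e = 1 \<Longrightarrow> \<exists>a. \<forall>A :: 'f ^ 'n ^ 'n. mpoly d p A = msc a (mat 1)"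
begin

text \<open>The lattice of \<open>g\<close> is scaled into the standard one by
  \<open>\<pi> ^ s\<close>, and the largest possible power \<open>\<Theta> ^ j\<close> is divided
  out, leaving \<open>h\<close>. A column of \<open>h\<close> outside the image of
  \<open>\<Theta>\<close> yields every integral vector under polynomials of degree below
  \<open>d\<close> in \<open>\<gamma>\<close>. Only \<open>\<pi> ^ c\<close> times
  \<open>\<gamma>\<close> preserves the lattice of \<open>h\<close>, so such a polynomial costs at
  most \<open>\<pi> ^ (c * d)\<close>, which bounds \<open>det h\<close> from below. As
  \<open>det g = 1\<close>, this forces \<open>j\<close> to be at least \<open>e\<close> times
  \<open>s - c * d\<close>, so that \<open>\<Theta> ^ j\<close> is divisible by
  \<open>\<pi> ^ (s - c * d)\<close>.\<close>

lemma lattice_rigidity: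
  fixes \<gamma> \<gamma>' g :: "'f ^ 'n ^ 'n"
  assumes \<gamma>: "mint \<gamma>" "mbd (nm \<pi> ^ L) (\<gamma> - B)" and L: "1 \<le> L" "e = 1 \<or> 2 \<le> L"
    and \<gamma>': "mint \<gamma>'" "msc (\<pi> ^ c) \<gamma> ** g = g ** \<gamma>'" and g: "det g = 1"
  shows "mbd (1 / nm \<pi> ^ (c * d)) g"
proof -
  define \<Theta> where "\<Theta> = mpoly d p \<gamma>"
  define P where "P = mpoly d p B"
  have ints: "mint \<Theta>" "mint P"
    by (auto simp: \<Theta>_def P_def intro!: mint_mpoly \<gamma> B p)
  have qL: "nm \<pi> ^ L \<le> nm \<pi> ^ 1"
    using L by (subst q_power_le_iff)
  \<comment> \<open>The second power is what makes \<open>P\<close> times a unit out of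
    \<open>\<Theta>\<close>: \<open>Q\<close> inverts \<open>P\<close> only up to one factor
    \<open>\<pi>\<close>, and one more must remain.\<close>
  have "mbd (nm \<pi> ^ 2) (\<Theta> - P)"
  proof (cases "e = 1")
    case True
    then obtain a where "\<And>A :: 'f ^ 'n ^ 'n. mpoly d p A = msc a (mat 1)"
      using unramified by blast
    then show ?thesis
      using q_pos by (simp add: \<Theta>_def P_def mbd_0)
  next
    case False
    then have "nm \<pi> ^ L \<le> nm \<pi> ^ 2"
      using L by (subst q_power_le_iff) auto
    then show ?thesis
      unfolding \<Theta>_def P_def using mbd_mono[OF mbd_mpoly_diff[OF \<gamma>(1) B \<gamma>(2), of p d]] p by blast
  qed
  then obtain Y where Y: "mint Y" "\<Theta> - P = msc (\<pi> ^ 2) Y"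
    using mbd_divide by blast
  define U where "U = mat 1 + msc \<pi> (Q ** Y)"
  have "\<Theta> = P + msc (\<pi> ^ 2) Y"
    using Y(2) by (simp add: algebra_simps)
  also have "msc (\<pi> ^ 2) Y = msc \<pi> (mpoly d p B ** Q ** Y)"
    by (simp add: Q(2) msc_mult_left power2_eq_square)
  finally have \<Theta>_U: "\<Theta> = P ** U"
    by (simp add: U_def P_def matrix_add_ldistrib msc_mult_right matrix_mul_assoc)
  have "mbd (nm \<pi>) (U - mat 1)"
    using mbd_msc[OF mint_mult[OF Q(1) Y(1)], of \<pi>] by (simp add: U_def)
  note U = nm_det_near_1[OF this q_less1]
  obtain U' where U': "U ** U' = mat 1" "mint U'"
    using inverse_mint[OF U(2,1)] by blast
  \<comment> \<open>Like \<open>P\<close>, also \<open>\<Theta>\<close> has an \<open>e\<close>-th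
    power of the form \<open>\<pi>\<close> times a unit, since the error only perturbs
    \<open>u\<close> modulo \<open>\<pi>\<close>.\<close>
  obtain Y' where Y': "mint Y'" "mpow \<Theta> e - mpow P e = msc (\<pi> ^ 2) Y'"
    using mbd_mpow_diff[OF ints(1,2) \<open>mbd (nm \<pi> ^ 2) (\<Theta> - P)\<close>] mbd_divide by blast
  define u' where "u' = u + msc \<pi> Y'"
  have "mpow \<Theta> e = mpow P e + msc (\<pi> ^ 2) Y'"
    using Y'(2) by (simp add: algebra_simps)
  then have \<Theta>_e: "mpow \<Theta> e = msc \<pi> u'"
    using u(3) by (simp add: P_def u'_def msc_add power2_eq_square)
  have u'_int: "mint u'"
    unfolding u'_def using u Y' q_less1 by (intro mbd_add mint_msc) auto
  have "nm (det u' - det u) \<le> nm \<pi>"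
    using mbd_msc[OF Y'(1), of \<pi>] by (intro nm_det_diff_le u'_int u) (simp add: u'_def)
  then have det_u': "nm (det u') = 1"
    using nm_eq_of_close[of "det u'" "det u"] u(2) q_less1 by simp
  have det_\<Theta>: "nm (det \<Theta>) ^ e = nm \<pi> ^ CARD('n)"
    using arg_cong[OF \<Theta>_e, of "\<lambda>A. nm (det A)"] by (simp add: det_mpow det_msc nm_power nm_mult det_u')
  have "nm \<pi> ^ CARD('n) < 1"
    using q_pos q_less1 by (intro power_Suc_less_one[of "nm \<pi>" "CARD('n) - 1", simplified])
  then have det_\<Theta>_less: "nm (det \<Theta>) < 1"
    using det_\<Theta> one_le_power[of "nm (det \<Theta>)" e] by linarith
  have det_\<Theta>_nz: "det \<Theta> \<noteq> 0"
    using det_\<Theta> q_pos e by (auto simp: power_0_left)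
  have generates': "(\<exists>x. vint x \<and> w = \<Theta> *v x) \<or>
      (\<forall>z. vint z \<longrightarrow> (\<exists>c. (\<forall>i. nm (c i) \<le> 1) \<and> mpoly d c \<gamma> *v w = z))" if w: "vint w" for w
    using generates[OF w]
  proof
    assume "\<exists>x. vint x \<and> w = mpoly d p B *v x"
    then obtain x where x: "vint x" "w = P *v x"
      by (auto simp: P_def)
    then have "w = \<Theta> *v (U' *v x)" "vint (U' *v x)"
      using U' by (simp_all add: \<Theta>_U matrix_vector_mul_assoc vint_mult flip: matrix_mul_assoc)
    then show ?thesis
      by blast
  next
    assume *: "\<forall>z. vint z \<longrightarrow> (\<exists>c. (\<forall>i. nm (c i) \<le> 1) \<and> mpoly d c B *v w = z)"
    have "vint (axis j 1)" for j :: 'n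
      by (simp add: vint_def axis_def)
    with * have "\<forall>j. \<exists>c. (\<forall>i. nm (c i) \<le> 1) \<and> mpoly d c B *v w = axis j 1"
      by blast
    then obtain C where C: "\<And>j i. nm (C j i) \<le> 1" "\<And>j. mpoly d (C j) B *v w = axis j 1"
      by metis
    \<comment> \<open>With \<open>B\<close> these polynomials give the standard basis. Replacing
      \<open>B\<close> by \<open>\<gamma>\<close> changes it modulo \<open>\<pi>\<close> only, so
      the new columns are still a basis over the integers.\<close>
    define Z where "Z = cols (\<lambda>j. mpoly d (C j) \<gamma> *v w)"
    have "Z - mat 1 = cols (\<lambda>j. (mpoly d (C j) \<gamma> - mpoly d (C j) B) *v w)"
      by (simp add: Z_def vec_eq_iff matrix_vector_mult_diff_rdistrib C) (simp add: axis_def mat_def)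
    moreover have "nm (((mpoly d (C j) \<gamma> - mpoly d (C j) B) *v w) $ i) \<le> nm \<pi>" for i j
    proof -
      have "mbd (nm \<pi>) (mpoly d (C j) \<gamma> - mpoly d (C j) B)"
        using mbd_mono[OF mbd_mpoly_diff[OF \<gamma>(1) B \<gamma>(2), of "C j" d] qL] C(1) by simp
      then show ?thesis
        using w q_pos unfolding matrix_vector_nth vint_def mbd_def
        by (intro nm_sum_le nm_mult_le[of _ "nm \<pi>" _ 1, simplified]) auto
    qed
    ultimately have "mbd (nm \<pi>) (Z - mat 1)"
      by (simp add: mbd_def)
    note Z = nm_det_near_1[OF this q_less1]
    obtain Z' where Z': "Z ** Z' = mat 1" "mint Z'"
      using inverse_mint[OF Z(2,1)] by blast
    have "\<exists>c. (\<forall>i. nm (c i) \<le> 1) \<and> mpoly d c \<gamma> *v w = z" if z: "vint z" for z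
    proof (intro exI conjI allI)
      define y where "y = Z' *v z"
      have y: "vint y"
        using Z' z by (simp add: y_def vint_mult)
      show "nm (\<Sum>j\<in>UNIV. y $ j * C j i) \<le> 1" for i
        using y C by (intro nm_sum_le nm_mult_le[of _ 1 _ 1, simplified]) (auto simp: vint_def)
      have "z = Z *v y"
        by (simp add: y_def matrix_vector_mul_assoc Z')
      also have "\<dots> = (\<Sum>j\<in>UNIV. y $ j *s (mpoly d (C j) \<gamma> *v w))"
        by (simp add: Z_def cols_mult_vec)
      also have "\<dots> = (\<Sum>j\<in>UNIV. \<Sum>i<d. (y $ j * C j i) *s (mpow \<gamma> i *v w))"
        by (simp add: mpoly_vec vec.scale_sum_right)
      also have "\<dots> = (\<Sum>i<d. (\<Sum>j\<in>UNIV. y $ j * C j i) *s (mpow \<gamma> i *v w))"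
        by (subst sum.swap) (simp add: vec.scale_sum_left)
      finally show "mpoly d (\<lambda>i. \<Sum>j\<in>UNIV. y $ j * C j i) \<gamma> *v w = z"
        by (simp add: mpoly_vec)
    qed
    then show ?thesis
      by blast
  qed
  define C where "C = c * d"
  obtain R where R: "mbd R g"
    using mbd_exists by blast
  obtain s0 where s0: "R \<le> 1 / nm \<pi> ^ s0"
    using ex_q_power_ge by blast
  \<comment> \<open>\<open>s0\<close> makes the scaled matrix integral; \<open>s \<ge> C\<close>
    keeps the natural number difference \<open>s - C\<close> exact.\<close>
  define s where "s = max s0 C"
  have "mint (msc (\<pi> ^ s) g)"
  proof -
    have "nm \<pi> ^ s * R \<le> nm \<pi> ^ s0 * (1 / nm \<pi> ^ s0)"
      using s0 q_pos mbd_nonneg[OF R] by (intro mult_mono) (auto simp: q_power_le_iff s_def)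
    then have "nm \<pi> ^ s * R \<le> 1"
      using q_pos by simp
    then show ?thesis
      using mbd_mono[OF mbd_msc[OF R, of "\<pi> ^ s"]] by (simp add: nm_power)
  qed
  define J where "J j \<longleftrightarrow> (\<exists>h. mint h \<and> msc (\<pi> ^ s) g = mpow \<Theta> j ** h)" for j
  have det_s: "nm (det (msc (\<pi> ^ s) g)) = nm \<pi> ^ (s * CARD('n))"
    by (simp add: det_msc g nm_power power_mult)
  \<comment> \<open>Each factor \<open>\<Theta>\<close> strictly shrinks the determinant, so only
    finitely many can be split off.\<close>
  obtain N where N: "nm (det \<Theta>) ^ N < nm \<pi> ^ (s * CARD('n))"
    using real_arch_pow_inv[OF _ det_\<Theta>_less] q_pos by (meson zero_less_power)
  have "J 0"
    using \<open>mint (msc (\<pi> ^ s) g)\<close> by (simp add: J_def)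
  moreover have "j \<le> N" if "J j" for j
  proof (rule ccontr)
    assume "\<not> j \<le> N"
    obtain h where h: "mint h" "msc (\<pi> ^ s) g = mpow \<Theta> j ** h"
      using \<open>J j\<close> by (auto simp: J_def)
    have "nm \<pi> ^ (s * CARD('n)) = nm (det \<Theta>) ^ j * nm (det h)"
      using det_s by (simp add: h(2) det_mul det_mpow nm_mult nm_power)
    also have "\<dots> \<le> nm (det \<Theta>) ^ j * 1"
      using nm_det_le[OF h(1)] by (intro mult_left_mono) (auto simp: nm_nonneg)
    also have "\<dots> \<le> nm (det \<Theta>) ^ N"
      using \<open>\<not> j \<le> N\<close> det_\<Theta>_less nm_nonneg by (simp add: power_decreasing)
    finally show False
      using N by simp
  qed
  ultimately have "J (Greatest J)" "\<And>i. J i \<Longrightarrow> i \<le> Greatest J"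
    using GreatestI_nat[of J 0 N] Greatest_le_nat[of J _ N] by auto
  then obtain j where j: "J j" "\<And>i. J i \<Longrightarrow> i \<le> j"
    by blast
  obtain h where h: "mint h" "msc (\<pi> ^ s) g = mpow \<Theta> j ** h"
    using j(1) by (auto simp: J_def)
  \<comment> \<open>By maximality of \<open>j\<close> some column of \<open>h\<close> lies outside the image of \<open>\<Theta>\<close>.\<close>
  have "\<exists>k. \<nexists>x. vint x \<and> column k h = \<Theta> *v x"
  proof (rule ccontr)
    assume "\<not> ?thesis"
    then have "\<forall>k. \<exists>x. vint x \<and> column k h = \<Theta> *v x"
      by simp
    then obtain f where f: "\<And>k. vint (f k)" "\<And>k. column k h = \<Theta> *v f k"
      by metis
    then have "h = \<Theta> ** cols f"
      using cols_column[of h] by (simp add: mult_cols)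
    then have "msc (\<pi> ^ s) g = mpow \<Theta> (Suc j) ** cols f"
      by (simp add: h(2) matrix_mul_assoc mpow_commute)
    then have "J (Suc j)"
      using f(1) unfolding J_def by (intro exI[of _ "cols f"]) (simp add: mint_cols)
    then show False
      using j(2) by fastforce
  qed
  then obtain k where k: "\<nexists>x. vint x \<and> column k h = \<Theta> *v x"
    by blast
  have "vint (column k h)"
    using h(1) by (simp add: mbd_def vint_def column_def)
  then have span: "\<And>z. vint z \<Longrightarrow> \<exists>c. (\<forall>i. nm (c i) \<le> 1) \<and> mpoly d c \<gamma> *v column k h = z"
    using generates' k by blast
  \<comment> \<open>\<open>\<gamma>\<close> commutes with \<open>\<Theta>\<close>, a polynomial in
    it, and \<open>\<Theta> ^ j\<close> can be cancelled; so stability passes from \<open>g\<close>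
    to \<open>h\<close>.\<close>
  have comm: "msc (\<pi> ^ c) \<gamma> ** h = h ** \<gamma>'"
  proof -
    have "det (mpow \<Theta> j) \<noteq> 0"
      using det_\<Theta>_nz by (simp add: det_mpow)
    moreover obtain S where "1 \<le> S" "mbd S (mpow \<Theta> j)"
      using mbd_exists by blast
    ultimately obtain T where T: "T ** mpow \<Theta> j = mat 1"
      using inverse_mbd by blast
    have "mpow \<Theta> j ** \<gamma> = \<gamma> ** mpow \<Theta> j"
      by (simp add: mpow_commute \<Theta>_def mpoly_commute)
    then have "mpow \<Theta> j ** (msc (\<pi> ^ c) \<gamma> ** h) = msc (\<pi> ^ c) \<gamma> ** (mpow \<Theta> j ** h)"
      by (simp add: msc_mult_left msc_mult_right matrix_mul_assoc)
    also have "\<dots> = msc (\<pi> ^ s) (g ** \<gamma>')"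
      by (simp flip: h(2) add: msc_mult_right \<gamma>'(2))
    also have "\<dots> = mpow \<Theta> j ** (h ** \<gamma>')"
      by (simp add: matrix_mul_assoc flip: h(2) msc_mult_left)
    finally have "(T ** mpow \<Theta> j) ** (msc (\<pi> ^ c) \<gamma> ** h) = (T ** mpow \<Theta> j) ** (h ** \<gamma>')"
      by (simp only: flip: matrix_mul_assoc)
    then show ?thesis
      by (simp add: T)
  qed
  have "\<exists>x. vint x \<and> \<pi> ^ C *s z = h *v x" if z: "vint z" for z
  proof -
    obtain a where a: "\<And>i. nm (a i) \<le> 1" "mpoly d a \<gamma> *v column k h = z"
      using span[OF z] by blast
    have col: "column k h = h *v axis k 1"
      by (simp add: vec_eq_iff matrix_vector_nth column_def axis_def if_distrib[of "\<lambda>x. _ * x"] cong: if_cong)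
    \<comment> \<open>Of the factor \<open>\<pi> ^ C\<close>, the term of degree \<open>i\<close>
      spends \<open>\<pi> ^ (c * i)\<close> on replacing \<open>\<gamma>\<close> by its stable
      multiple; \<open>i < d\<close> guarantees that this is available, and the rest goes into the
      coefficient.\<close>
    define x where "x = (\<Sum>i<d. (a i * \<pi> ^ (C - c * i)) *s (mpow \<gamma>' i *v axis k 1))"
    have "vint (mpow \<gamma>' i *v axis k 1)" for i
      by (intro vint_mult mint_mpow \<gamma>'(1)) (simp add: vint_def axis_def)
    moreover have "nm (a i * \<pi> ^ (C - c * i)) \<le> 1" for i
      using nm_mult_le[OF a(1)[of i], of "\<pi> ^ (C - c * i)" 1] by (simp add: nm_power q_power_le_1)
    ultimately have "vint x"
      unfolding x_def vint_def sum_component vector_smult_component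
      by (intro allI nm_sum_le nm_mult_le[of "a _ * _" 1 _ 1, simplified]) auto
    moreover have "\<pi> ^ C *s z = h *v x"
    proof -
      have "\<pi> ^ C *s z = (\<Sum>i<d. (\<pi> ^ C * a i) *s (mpow \<gamma> i *v column k h))"
        by (simp add: a(2)[symmetric] mpoly_vec vec.scale_sum_right)
      also have "\<dots> = (\<Sum>i<d. (a i * \<pi> ^ (C - c * i)) *s (mpow (msc (\<pi> ^ c) \<gamma>) i *v column k h))"
      proof (rule sum.cong)
        fix i assume "i \<in> {..<d}"
        then have "\<pi> ^ C = \<pi> ^ (C - c * i) * (\<pi> ^ c) ^ i"
          by (simp add: C_def flip: power_mult power_add)
        then show "(\<pi> ^ C * a i) *s (mpow \<gamma> i *v column k h) =
            (a i * \<pi> ^ (C - c * i)) *s (mpow (msc (\<pi> ^ c) \<gamma>) i *v column k h)"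
          by (simp add: mpow_msc msc_mult_vec mult_ac)
      qed simp
      also have "\<dots> = (\<Sum>i<d. (a i * \<pi> ^ (C - c * i)) *s (h *v (mpow \<gamma>' i *v axis k 1)))"
        by (simp add: col matrix_vector_mul_assoc mpow_intertwine[OF comm])
      also have "\<dots> = h *v x"
        by (simp add: x_def matrix_vector_sum_ldistrib mult_vec_scale)
      finally show ?thesis .
    qed
    ultimately show ?thesis
      by blast
  qed
  moreover have "vint (axis t 1)" for t :: 'n
    by (simp add: vint_def axis_def)
  ultimately have "\<forall>t. \<exists>x. vint x \<and> \<pi> ^ C *s axis t 1 = h *v x"
    by blast
  then obtain f where f: "\<And>t. vint (f t)" "\<And>t. \<pi> ^ C *s axis t 1 = h *v f t"
    by metis
  have "h ** cols f = cols (\<lambda>t. \<pi> ^ C *s axis t 1)"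
    by (simp add: mult_cols f(2))
  also have "\<dots> = msc (\<pi> ^ C) (mat 1)"
    by (simp add: vec_eq_iff axis_def mat_def)
  finally have "det (h ** cols f) = det (msc (\<pi> ^ C) (mat 1 :: 'f ^ 'n ^ 'n))"
    by simp
  then have "nm (det h * det (cols f)) = nm ((\<pi> ^ C) ^ CARD('n))"
    by (simp add: det_mul det_msc)
  then have "nm \<pi> ^ (C * CARD('n)) = nm (det h) * nm (det (cols f))"
    by (simp add: nm_mult nm_power power_mult)
  also have "\<dots> \<le> nm (det h) * 1"
    using nm_det_le[of 1 "cols f"] f(1) by (intro mult_left_mono) (auto simp: mint_cols nm_nonneg)
  finally have det_h: "nm \<pi> ^ (C * CARD('n)) \<le> nm (det h)"
    by simp
  have "nm \<pi> ^ (s * CARD('n)) = nm (det \<Theta>) ^ j * nm (det h)"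
    using det_s by (simp add: h(2) det_mul det_mpow nm_mult nm_power)
  \<comment> \<open>The norm of \<open>det \<Theta>\<close> is known through its \<open>e\<close>-th
    power, so exponents are compared after raising to \<open>e\<close>.\<close>
  then have "(nm \<pi> ^ (s * CARD('n))) ^ e = (nm (det \<Theta>) ^ e) ^ j * nm (det h) ^ e"
    by (simp add: power_mult_distrib mult.commute flip: power_mult)
  also have "\<dots> \<ge> (nm \<pi> ^ CARD('n)) ^ j * (nm \<pi> ^ (C * CARD('n))) ^ e"
    using det_h q_pos by (auto simp: det_\<Theta> intro!: mult_left_mono power_mono)
  finally have "nm \<pi> ^ (CARD('n) * j + C * CARD('n) * e) \<le> nm \<pi> ^ (s * CARD('n) * e)"
    by (simp add: power_add power_mult)
  then have "CARD('n) * (s * e) \<le> CARD('n) * (j + C * e)"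
    by (simp add: q_power_le_iff algebra_simps)
  then have "s * e \<le> j + C * e"
    by simp
  moreover have "s * e = (s - C) * e + C * e"
    by (simp add: s_def diff_mult_distrib mult_le_mono1)
  ultimately obtain t where t: "j = e * (s - C) + t"
    using le_Suc_ex[of "(s - C) * e" j] by (auto simp: mult.commute)
  have "mpow \<Theta> j = msc (\<pi> ^ (s - C)) (mpow u' (s - C) ** mpow \<Theta> t)"
    by (simp add: t mpow_add mpow_mult \<Theta>_e mpow_msc msc_mult_left)
  then have "msc (\<pi> ^ s) g = msc (\<pi> ^ (s - C)) (mpow u' (s - C) ** mpow \<Theta> t ** h)"
    by (simp add: h(2) msc_mult_left)
  moreover have "mint (mpow u' (s - C) ** mpow \<Theta> t ** h)"
    by (intro mint_mult mint_mpow u'_int ints h)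
  ultimately have "mbd (nm \<pi> ^ (s - C)) (msc (\<pi> ^ s) g)"
    using mbd_msc[of 1 _ "\<pi> ^ (s - C)"] by (simp add: nm_power)
  then have "nm \<pi> ^ s * nm (g $ i $ k) \<le> nm \<pi> ^ (s - C)" for i k
    by (auto simp: mbd_def nm_mult nm_power)
  moreover have "nm \<pi> ^ s = nm \<pi> ^ (s - C) * nm \<pi> ^ C"
    by (simp add: s_def flip: power_add)
  ultimately have "nm \<pi> ^ (s - C) * (nm \<pi> ^ C * nm (g $ i $ k)) \<le> nm \<pi> ^ (s - C) * 1" for i k
    by (simp add: mult.assoc)
  then have "nm \<pi> ^ C * nm (g $ i $ k) \<le> 1" for i k
    using q_pos by (subst (asm) mult_le_cancel_left_pos) auto
  then show ?thesis
    using q_pos by (simp add: mbd_def C_def field_simps)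
qed

end

section \<open>The regular representation of a monogenic extension\<close>

locale monogenic_extension = uniformized_field nm \<pi>
  for nm :: "'f::field \<Rightarrow> real" and \<pi> +
  fixes \<iota> :: "'f \<Rightarrow> 'k::field" and b :: "'n::finite \<Rightarrow> 'k" and \<beta> :: 'k and e :: nat
  assumes embedding: "is_field_embedding \<iota>"
    and ramification: "is_ramification_index nm \<pi> \<iota> e"
    and basis: "is_integral_basis nm \<iota> b"
    and \<beta>_integral: "\<beta> \<in> extension_integers nm \<iota>"
    and monogenic: "extension_integers nm \<iota> = adjoin_integral nm \<iota> \<beta>"
begin

lemma \<iota>_add [simp]: "\<iota> (x + y) = \<iota> x + \<iota> y"
  and \<iota>_mult [simp]: "\<iota> (x * y) = \<iota> x * \<iota> y"
  and \<iota>_1 [simp]: "\<iota> 1 = 1"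
  using embedding by (auto simp: is_field_embedding_def)

lemma \<iota>_0 [simp]: "\<iota> 0 = 0"
  by (metis \<iota>_add add_0_left add_cancel_left_right)

lemma \<iota>_uminus [simp]: "\<iota> (- x) = - \<iota> x"
  using \<iota>_add[of x "- x"] by (simp add: eq_neg_iff_add_eq_0 add.commute)

lemma \<iota>_sum: "\<iota> (sum f I) = (\<Sum>i\<in>I. \<iota> (f i))"
  by (induction I rule: infinite_finite_induct) auto

lemma \<iota>_eq_0_iff [simp]: "\<iota> x = 0 \<longleftrightarrow> x = 0"
proof
  assume "\<iota> x = 0"
  then have "\<iota> (x * inverse x) = 0"
    by simp
  then show "x = 0"
    by (cases "x = 0") (simp_all del: \<iota>_mult)
qed simp

abbreviation "OK \<equiv> extension_integers nm \<iota>"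

section \<open>The integer ring as a module generated by finitely many powers\<close>

definition span_powers :: "nat \<Rightarrow> 'k set" where
  "span_powers d = {\<Sum>i<d. \<iota> (c i) * \<beta> ^ i | c. \<forall>i. nm (c i) \<le> 1}"

lemma span_powersI: "(\<And>i. nm (c i) \<le> 1) \<Longrightarrow> x = (\<Sum>i<d. \<iota> (c i) * \<beta> ^ i) \<Longrightarrow> x \<in> span_powers d"
  by (auto simp: span_powers_def)

lemma span_powersE:
  assumes "x \<in> span_powers d"
  obtains c where "\<And>i. nm (c i) \<le> 1" "x = (\<Sum>i<d. \<iota> (c i) * \<beta> ^ i)"
  using assms by (auto simp: span_powers_def)

lemma span_powers_add: "x \<in> span_powers d \<Longrightarrow> y \<in> span_powers d \<Longrightarrow> x + y \<in> span_powers d"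
proof (elim span_powersE)
  fix a c assume "\<And>i. nm (a i) \<le> 1" "\<And>i. nm (c i) \<le> 1"
    "x = (\<Sum>i<d. \<iota> (a i) * \<beta> ^ i)" "y = (\<Sum>i<d. \<iota> (c i) * \<beta> ^ i)"
  then show ?thesis
    by (intro span_powersI[of "\<lambda>i. a i + c i"]) (auto simp: nm_add_le algebra_simps sum.distrib)
qed

lemma span_powers_scale: "nm a \<le> 1 \<Longrightarrow> x \<in> span_powers d \<Longrightarrow> \<iota> a * x \<in> span_powers d"
proof (elim span_powersE)
  fix c assume "nm a \<le> 1" "\<And>i. nm (c i) \<le> 1" "x = (\<Sum>i<d. \<iota> (c i) * \<beta> ^ i)"
  then show ?thesis
    by (intro span_powersI[of "\<lambda>i. a * c i"])
      (auto simp: nm_mult_le[of _ 1 _ 1, simplified] sum_distrib_left mult_ac)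
qed

lemma span_powers_sum:
  "(\<And>i. i \<in> I \<Longrightarrow> f i \<in> span_powers d) \<Longrightarrow> (\<Sum>i\<in>I. f i) \<in> span_powers d"
proof (induction I rule: infinite_finite_induct)
  case empty
  show ?case
    by (auto intro: span_powersI[of "\<lambda>_. 0"])
next
  case infinite
  then show ?case
    by (auto intro: span_powersI[of "\<lambda>_. 0"])
qed (auto intro: span_powers_add)

text \<open>A monic integral equation of \<open>\<beta>\<close> reduces the power
  \<open>\<beta> ^ d\<close>, hence every polynomial, one multiplication by \<open>\<beta>\<close>
  at a time. \<open>d\<close> is the degree of some such equation; independence of the powers is not
  claimed.\<close>

lemma ex_span_powers: "\<exists>d>0. OK = span_powers d"
proof -
  obtain f where f: "lead_coeff f = 1" "\<And>i. nm (coeff f i) \<le> 1" "poly (map_poly \<iota> f) \<beta> = 0"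
    using \<beta>_integral by (auto simp: extension_integers_def ring_of_integers_def)
  define d where "d = degree f"
  have poly_f: "(\<Sum>i<d. \<iota> (coeff f i) * \<beta> ^ i) + \<beta> ^ d = 0"
  proof -
    have "degree (map_poly \<iota> f) = d"
      unfolding d_def by (rule degree_map_poly) simp
    then have "0 = (\<Sum>i\<le>d. \<iota> (coeff f i) * \<beta> ^ i)"
      using f(3) by (simp add: poly_altdef coeff_map_poly)
    also have "\<dots> = (\<Sum>i<d. \<iota> (coeff f i) * \<beta> ^ i) + \<beta> ^ d"
      using f(1) by (simp add: d_def flip: lessThan_Suc_atMost)
    finally show ?thesis
      by simp
  qed
  have d: "d > 0"
    using poly_f by (cases d) auto
  have one: "1 \<in> span_powers d"
    using d by (intro span_powersI[of "\<lambda>i. if i = 0 then 1 else 0"])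
      (auto simp: if_distrib[of "\<lambda>x. \<iota> x * _"] cong: if_cong)
  have power: "\<beta> ^ i \<in> span_powers d" if "i \<le> d" for i
  proof (cases "i = d")
    case True
    then have "\<beta> ^ i = (\<Sum>j<d. \<iota> (- coeff f j) * \<beta> ^ j)"
      using poly_f by (simp add: sum_negf eq_neg_iff_add_eq_0 add.commute)
    then show ?thesis
      using f(2) by (intro span_powersI[of "\<lambda>j. - coeff f j"]) auto
  next
    case False
    then show ?thesis
      using that by (intro span_powersI[of "\<lambda>j. if j = i then 1 else 0"])
        (auto simp: if_distrib[of "\<lambda>x. \<iota> x * _"] cong: if_cong)
  qed
  have mult_\<beta>: "\<beta> * x \<in> span_powers d" if x: "x \<in> span_powers d" for x
  proof -
    obtain c where c: "\<And>i. nm (c i) \<le> 1" "x = (\<Sum>i<d. \<iota> (c i) * \<beta> ^ i)"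
      using x by (rule span_powersE) blast
    have "\<beta> * x = (\<Sum>i<d. \<iota> (c i) * \<beta> ^ Suc i)"
      by (simp add: c sum_distrib_left mult_ac)
    also have "\<dots> \<in> span_powers d"
      by (intro span_powers_sum span_powers_scale power c) auto
    finally show ?thesis .
  qed
  have map_pCons: "poly (map_poly \<iota> (pCons a p)) \<beta> = \<iota> a + \<beta> * poly (map_poly \<iota> p) \<beta>" for a p
    by (cases "a = 0 \<and> p = 0") (auto simp: map_poly_pCons)
  have "poly (map_poly \<iota> p) \<beta> \<in> span_powers d" if "\<forall>i. nm (coeff p i) \<le> 1" for p
    using that
  proof (induction p)
    case 0
    show ?case
      by (auto intro: span_powersI[of "\<lambda>_. 0"])
  next
    case (pCons a p)
    have "nm a \<le> 1" "\<forall>i. nm (coeff p i) \<le> 1"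
      using pCons.prems spec[of _ 0] spec[of _ "Suc _"] by (auto simp: coeff_pCons split: nat.splits)
    then show ?case
      using pCons.IH span_powers_scale[OF _ one, of a]
      by (auto simp: map_pCons intro!: span_powers_add mult_\<beta>)
  qed
  moreover have "(\<Sum>i<k. \<iota> (c i) * \<beta> ^ i) \<in> adjoin_integral nm \<iota> \<beta>" if "\<And>i. nm (c i) \<le> 1" for k c
    using that
  proof (induction k arbitrary: c)
    case 0
    show ?case
      by (auto simp: adjoin_integral_def ring_of_integers_def intro!: exI[of _ 0])
  next
    case (Suc k)
    obtain p where p: "\<forall>i. nm (coeff p i) \<le> 1"
      "(\<Sum>i<k. \<iota> (c (Suc i)) * \<beta> ^ i) = poly (map_poly \<iota> p) \<beta>"
      using Suc.IH[of "\<lambda>i. c (Suc i)", OF Suc.prems]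
      by (auto simp: adjoin_integral_def ring_of_integers_def)
    have "(\<Sum>i<Suc k. \<iota> (c i) * \<beta> ^ i) = \<iota> (c 0) + \<beta> * (\<Sum>i<k. \<iota> (c (Suc i)) * \<beta> ^ i)"
      by (simp add: sum.lessThan_Suc_shift sum_distrib_left mult_ac del: sum.lessThan_Suc)
    also have "\<dots> = poly (map_poly \<iota> (pCons (c 0) p)) \<beta>"
      by (simp add: map_pCons p)
    finally show ?case
      using Suc.prems p(1) unfolding adjoin_integral_def ring_of_integers_def
      by (auto simp: coeff_pCons split: nat.splits intro!: exI[of _ "pCons (c 0) p"])
  qed
  ultimately have "OK = span_powers d"
    by (auto simp: monogenic adjoin_integral_def ring_of_integers_def elim!: span_powersE)
  then show ?thesis
    using d by blast
qed

lemma OK_scale: "nm a \<le> 1 \<Longrightarrow> x \<in> OK \<Longrightarrow> \<iota> a * x \<in> OK"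
  using ex_span_powers span_powers_scale by metis

lemma OK_sum: "(\<And>i. i \<in> I \<Longrightarrow> f i \<in> OK) \<Longrightarrow> (\<Sum>i\<in>I. f i) \<in> OK"
  using ex_span_powers span_powers_sum by metis

lemma OK_1: "1 \<in> OK"
  by (auto simp: monogenic adjoin_integral_def ring_of_integers_def intro!: exI[of _ 1])

lemma OK_mult_\<beta>: "x \<in> OK \<Longrightarrow> \<beta> * x \<in> OK"
proof -
  assume "x \<in> OK"
  then obtain p where p: "\<forall>i. nm (coeff p i) \<le> 1" "x = poly (map_poly \<iota> p) \<beta>"
    by (auto simp: monogenic adjoin_integral_def ring_of_integers_def)
  have "\<beta> * x = poly (map_poly \<iota> (pCons 0 p)) \<beta>"
    by (cases "p = 0") (auto simp: p map_poly_pCons)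
  then show ?thesis
    using p(1) unfolding monogenic adjoin_integral_def ring_of_integers_def
    by (auto simp: coeff_pCons split: nat.splits intro!: exI[of _ "pCons 0 p"])
qed

text \<open>Monogenicity replaces the general theory of integral closures: a product is an integral
  combination of the elements \<open>\<beta> ^ i * y\<close>.\<close>

lemma OK_mult: "x \<in> OK \<Longrightarrow> y \<in> OK \<Longrightarrow> x * y \<in> OK"
proof -
  assume x: "x \<in> OK" and y: "y \<in> OK"
  obtain d where "OK = span_powers d"
    using ex_span_powers by blast
  with x obtain c where c: "\<And>i. nm (c i) \<le> 1" "x = (\<Sum>i<d. \<iota> (c i) * \<beta> ^ i)"
    by (metis span_powersE)
  have "\<beta> ^ i * y \<in> OK" for i
    by (induction i) (auto simp: y OK_mult_\<beta> mult.assoc)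
  then have "(\<Sum>i<d. \<iota> (c i) * (\<beta> ^ i * y)) \<in> OK"
    by (intro OK_sum OK_scale c)
  then show ?thesis
    by (simp add: c sum_distrib_right mult.assoc)
qed

lemma OK_power: "x \<in> OK \<Longrightarrow> x ^ i \<in> OK"
  by (induction i) (auto simp: OK_1 OK_mult)

section \<open>Coordinates with respect to the integral basis and the regular representation\<close>

definition emb :: "'f ^ 'n \<Rightarrow> 'k" where
  "emb w = (\<Sum>i\<in>UNIV. \<iota> (w $ i) * b i)"

lemma emb_add: "emb (v + w) = emb v + emb w"
  by (simp add: emb_def algebra_simps sum.distrib)

lemma emb_scale: "emb (c *s w) = \<iota> c * emb w"
  by (simp add: emb_def sum_distrib_left mult.assoc)

lemma emb_axis: "emb (axis j 1) = b j"
  by (simp add: emb_def axis_def if_distrib[of "\<lambda>x. \<iota> x * _"] cong: if_cong)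

lemma emb_mult_vec: "emb (A *v w) = (\<Sum>j\<in>UNIV. \<iota> (w $ j) * emb (column j A))"
proof -
  have "emb (A *v w) = (\<Sum>i\<in>UNIV. \<Sum>j\<in>UNIV. \<iota> (w $ j) * (\<iota> (A $ i $ j) * b i))"
    by (simp add: emb_def matrix_vector_nth \<iota>_sum sum_distrib_right sum_distrib_left mult_ac)
  also have "\<dots> = (\<Sum>j\<in>UNIV. \<iota> (w $ j) * emb (column j A))"
    by (subst sum.swap) (simp add: emb_def column_def sum_distrib_left)
  finally show ?thesis .
qed

lemma OK_emb: "x \<in> OK \<longleftrightarrow> (\<exists>w. vint w \<and> x = emb w)"
proof
  assume "x \<in> OK"
  then obtain c where "\<forall>i. c i \<in> ring_of_integers nm" "x = (\<Sum>i\<in>UNIV. \<iota> (c i) * b i)"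
    using basis unfolding is_integral_basis_def by metis
  then show "\<exists>w. vint w \<and> x = emb w"
    by (intro exI[of _ "vec_lambda c"]) (auto simp: vint_def emb_def ring_of_integers_def)
next
  assume "\<exists>w. vint w \<and> x = emb w"
  then show "x \<in> OK"
    using basis by (auto simp: vint_def emb_def is_integral_basis_def intro!: OK_sum OK_scale)
qed

text \<open>Uniqueness of coefficients is part of \<open>is_integral_basis\<close> for integral ones
  only, so \<open>w\<close> is first scaled by a power of \<open>\<pi>\<close> and the expansion of
  0 is compared with the trivial one.\<close>

lemma emb_eq_0: "emb w = 0 \<Longrightarrow> w = 0"
proof -
  assume w: "emb w = 0"
  obtain R where R: "mbd R (cols (\<lambda>_::'n. w))"
    using mbd_exists by blast
  obtain k where k: "R \<le> 1 / nm \<pi> ^ k"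
    using ex_q_power_ge by blast
  have "nm (w $ i) \<le> 1 / nm \<pi> ^ k" for i
    using mbdD[OF R, of i undefined] k by simp
  then have int: "nm (\<pi> ^ k * w $ i) \<le> 1" for i
    using q_pos by (simp add: nm_mult nm_power field_simps)
  have zero: "0 = (\<Sum>i\<in>UNIV. \<iota> (\<pi> ^ k * w $ i) * b i)"
    using arg_cong[OF w, of "\<lambda>x. \<iota> (\<pi> ^ k) * x"] by (simp add: emb_def sum_distrib_left mult.assoc)
  have "\<exists>!c. (\<forall>i. c i \<in> ring_of_integers nm) \<and> 0 = (\<Sum>i\<in>UNIV. \<iota> (c i) * b i)"
    by (rule bspec[OF conjunct2[OF basis[unfolded is_integral_basis_def]]]) (use OK_sum[of "{}"] in simp)
  then have unique: "c = c'" if "\<forall>i. nm (c i) \<le> 1" "0 = (\<Sum>i\<in>UNIV. \<iota> (c i) * b i)"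
    "\<forall>i. nm (c' i) \<le> 1" "0 = (\<Sum>i\<in>UNIV. \<iota> (c' i) * b i)" for c c'
    using that by (auto simp: ring_of_integers_def)
  have "(\<lambda>i. \<pi> ^ k * w $ i) = (\<lambda>_. 0)"
    using int zero by (intro unique) auto
  then show "w = 0"
    using pi_nz by (auto simp: fun_eq_iff vec_eq_iff)
qed

lemma emb_inj: "emb v = emb w \<longleftrightarrow> v = w"
  using emb_eq_0[of "v - w"] emb_add[of "v - w" w] by auto

text \<open>The regular representation as a relation: by \<open>represents_unique\<close>,
  identities in \<open>K\<close> become matrix identities, and the description operator in
  \<open>regular_matrix\<close> has to be evaluated only once.\<close>

definition represents :: "'k \<Rightarrow> 'f ^ 'n ^ 'n \<Rightarrow> bool" where
  "represents x A \<longleftrightarrow> (\<forall>w. x * emb w = emb (A *v w))"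

lemma represents_unique: "represents x A \<Longrightarrow> represents x C \<Longrightarrow> A = C"
  by (simp add: represents_def emb_inj matrix_eq)

lemma represents_iff_columns: "represents x A \<longleftrightarrow> (\<forall>j. x * b j = emb (column j A))"
proof
  assume A: "represents x A"
  have "A *v axis j 1 = column j A" for j
    by (simp add: vec_eq_iff matrix_vector_nth column_def axis_def if_distrib[of "\<lambda>x. _ * x"] cong: if_cong)
  then show "\<forall>j. x * b j = emb (column j A)"
    using A by (metis emb_axis represents_def)
next
  assume A: "\<forall>j. x * b j = emb (column j A)"
  have "x * emb w = (\<Sum>j\<in>UNIV. \<iota> (w $ j) * (x * b j))" for w
    by (simp add: emb_def sum_distrib_left mult_ac)
  then show "represents x A"
    by (simp add: represents_def emb_mult_vec A)
qed

lemma represents_mult: "represents x A \<Longrightarrow> represents y C \<Longrightarrow> represents (x * y) (A ** C)"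
  by (simp add: represents_def mult.assoc flip: matrix_vector_mul_assoc)

lemma represents_add: "represents x A \<Longrightarrow> represents y C \<Longrightarrow> represents (x + y) (A + C)"
  by (simp add: represents_def matrix_vector_mult_add_rdistrib emb_add distrib_right)

lemma represents_scale: "represents x A \<Longrightarrow> represents (\<iota> c * x) (msc c A)"
  by (simp add: represents_def msc_mult_vec emb_scale mult.assoc)

lemma represents_1: "represents 1 (mat 1)"
  by (simp add: represents_def)

lemma represents_power: "represents x A \<Longrightarrow> represents (x ^ k) (mpow A k)"
  by (induction k) (auto simp: represents_1 represents_mult)

lemma represents_mpoly: "represents x A \<Longrightarrow> represents (\<Sum>i<d. \<iota> (c i) * x ^ i) (mpoly d c A)"
proof (induction d)
  case 0
  then show ?case
    by (simp add: represents_def mpoly_def emb_def)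
next
  case (Suc d)
  then show ?case
    by (simp add: mpoly_def represents_add represents_scale represents_power)
qed

lemma ex_represents: "x \<in> OK \<Longrightarrow> \<exists>A. mint A \<and> represents x A"
proof -
  assume "x \<in> OK"
  then have "\<forall>j. \<exists>w. vint w \<and> x * b j = emb w"
    using basis OK_emb OK_mult by (metis is_integral_basis_def)
  then obtain f where "\<And>j. vint (f j)" "\<And>j. x * b j = emb (f j)"
    by metis
  moreover have "column j (cols f) = f j" for j
    by (simp add: column_def vec_eq_iff)
  ultimately show ?thesis
    by (intro exI[of _ "cols f"]) (simp add: mint_cols represents_iff_columns)
qed

lemma regular_matrix: "mint (regular_matrix \<iota> b \<beta>)" "represents \<beta> (regular_matrix \<iota> b \<beta>)"
proof -
  obtain A where A: "mint A" "represents \<beta> A"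
    using ex_represents \<beta>_integral by blast
  have "regular_matrix \<iota> b \<beta> = (THE A. represents \<beta> A)"
    by (simp add: regular_matrix_def represents_iff_columns emb_def column_def)
  also have "\<dots> = A"
    using A represents_unique by blast
  finally show "mint (regular_matrix \<iota> b \<beta>)" "represents \<beta> (regular_matrix \<iota> b \<beta>)"
    using A by simp_all
qed

text \<open>The matrix of an integral inverse would be integral, while \<open>\<pi>\<close> times it
  would be the identity. This excludes ramification index 0.\<close>

lemma \<iota>\<pi>_not_unit: "y \<in> OK \<Longrightarrow> \<iota> \<pi> * y \<noteq> 1"
proof
  assume y: "y \<in> OK" "\<iota> \<pi> * y = 1"
  obtain A where A: "mint A" "represents y A"
    using ex_represents y by blast
  have "represents (\<iota> \<pi> * y) (msc \<pi> A)"
    using A by (simp add: represents_scale)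
  then have "mat 1 = msc \<pi> A"
    using y(2) represents_1 represents_unique by metis
  then have "(mat 1 :: 'f ^ 'n ^ 'n) $ undefined $ undefined = \<pi> * A $ undefined $ undefined"
    by simp
  then have "1 = nm \<pi> * nm (A $ undefined $ undefined)"
    by (simp add: mat_def flip: nm_mult)
  also have "\<dots> \<le> nm \<pi> * 1"
    using A by (intro mult_left_mono) (auto simp: mbd_def nm_nonneg)
  finally show False
    using q_less1 by simp
qed

text \<open>In \<open>K\<close>, the element \<open>\<pi>\<close> is \<open>P ^ e\<close> times a
  unit \<open>y\<close> with inverse \<open>v\<close>. So \<open>Q\<close> is the matrix of
  \<open>P ^ (e - 1) * y\<close>, the cofactor of \<open>P\<close> in \<open>\<pi>\<close>, and
  \<open>u\<close> is the matrix of \<open>v\<close>.\<close>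

lemma regular_matrix_ramified: "\<exists>d p Q u. ramified_matrix nm \<pi> (regular_matrix \<iota> b \<beta>) d p e Q u"
proof -
  define B where "B = regular_matrix \<iota> b \<beta>"
  have B: "mint B" "represents \<beta> B"
    using regular_matrix by (simp_all add: B_def)
  obtain d where d: "d > 0" "OK = span_powers d"
    using ex_span_powers by blast
  obtain P0 where P0: "{x \<in> OK. \<not> (\<exists>y\<in>OK. x * y = 1)} = {P0 * y | y. y \<in> OK}"
    "{\<iota> \<pi> * y | y. y \<in> OK} = {P0 ^ e * y | y. y \<in> OK}"
    using ramification by (auto simp: is_ramification_index_def Let_def)
  have e: "e \<noteq> 0"
  proof
    assume "e = 0"
    then have "1 \<in> {P0 ^ e * y | y. y \<in> OK}"
      using OK_1 by auto
    then have "1 \<in> {\<iota> \<pi> * y | y. y \<in> OK}"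
      by (simp only: P0(2))
    then show False
      using \<iota>\<pi>_not_unit by (smt (verit) mem_Collect_eq)
  qed
  have "P0 * 1 \<in> {x \<in> OK. \<not> (\<exists>y\<in>OK. x * y = 1)}"
    unfolding P0(1) using OK_1 by blast
  then have "P0 \<in> OK"
    by simp
  \<comment> \<open>In the unramified case the uniformizer is taken in \<open>F\<close>, so that it is a constant polynomial.\<close>
  obtain P p where P: "{x \<in> OK. \<not> (\<exists>y\<in>OK. x * y = 1)} = {P * y | y. y \<in> OK}"
      "{\<iota> \<pi> * y | y. y \<in> OK} = {P ^ e * y | y. y \<in> OK}" "P \<in> OK"
    and p: "\<And>i. nm (p i) \<le> 1" "P = (\<Sum>i<d. \<iota> (p i) * \<beta> ^ i)"
      "e = 1 \<Longrightarrow> p = (\<lambda>i. if i = 0 then \<pi> else 0)"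
  proof (cases "e = 1")
    case True
    have "\<iota> \<pi> \<in> OK"
      using OK_scale[OF _ OK_1, of \<pi>] q_less1 by simp
    moreover have "\<iota> \<pi> = (\<Sum>i<d. \<iota> (if i = 0 then \<pi> else 0) * \<beta> ^ i)"
      using d(1) by (auto simp: if_distrib[of "\<lambda>x. \<iota> x * _"] cong: if_cong)
    ultimately show ?thesis
      using that[of "\<iota> \<pi>" "\<lambda>i. if i = 0 then \<pi> else 0"] True P0 q_less1 by simp
  next
    case False
    then show ?thesis
      using \<open>P0 \<in> OK\<close> that[of P0] P0 d(2) by (metis span_powersE)
  qed
  define PB where "PB = mpoly d p B"
  have PB: "represents P PB"
    using B(2) by (simp add: PB_def p(2) represents_mpoly)
  have "\<iota> \<pi> * 1 \<in> {P ^ e * y | y. y \<in> OK}"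
    unfolding P(2)[symmetric] using OK_1 by blast
  then obtain y where y: "y \<in> OK" "\<iota> \<pi> = P ^ e * y"
    by auto
  have "P ^ e * 1 \<in> {\<iota> \<pi> * y | y. y \<in> OK}"
    unfolding P(2) using OK_1 by blast
  then obtain v where v: "v \<in> OK" "P ^ e = \<iota> \<pi> * v"
    by auto
  have "\<iota> \<pi> * (v * y) = \<iota> \<pi> * 1"
    using v(2) y(2) by (simp add: mult_ac)
  then have vy: "v * y = 1"
    using pi_nz by simp
  obtain Q where Q: "mint Q" "represents (P ^ (e - 1) * y) Q"
    using ex_represents OK_mult OK_power P(3) y(1) by blast
  obtain u where u: "mint u" "represents v u"
    using ex_represents v(1) by blast
  obtain u' where u': "mint u'" "represents y u'"
    using ex_represents y(1) by blast
  have \<iota>\<pi>: "represents (\<iota> \<pi>) (msc \<pi> (mat 1))"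
    using represents_scale[OF represents_1, of \<pi>] by simp
  have "ramified_matrix nm \<pi> B d p e Q u"
  proof unfold_locales
    show "mint B" "mint Q" "mint u" "e \<noteq> 0" "nm (p i) \<le> 1" for i
      by fact+
    have "P * (P ^ (e - 1) * y) = \<iota> \<pi>"
      using e y(2) by (cases e) auto
    then show "mpoly d p B ** Q = msc \<pi> (mat 1)"
      using represents_mult[OF PB Q(2)] \<iota>\<pi> represents_unique unfolding PB_def by metis
    show "mpow (mpoly d p B) e = msc \<pi> u"
      using represents_power[OF PB, of e] represents_scale[OF u(2), of \<pi>] v(2) represents_unique
      unfolding PB_def by metis
    have "u ** u' = mat 1"
      using represents_mult[OF u(2) u'(2)] vy represents_1 represents_unique by metis
    then have "det u * det u' = 1"
      by (metis det_mul det_I)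
    then have "nm (det u) * nm (det u') = 1"
      by (metis nm_1 nm_mult)
    moreover have "nm (det u) \<le> 1" "nm (det u') \<le> 1"
      using nm_det_le[OF u(1)] nm_det_le[OF u'(1)] by simp_all
    moreover have "nm (det u) * nm (det u') \<le> nm (det u) * 1"
      using \<open>nm (det u') \<le> 1\<close> nm_nonneg by (intro mult_left_mono)
    ultimately show "nm (det u) = 1"
      by simp
  next
    \<comment> \<open>Locality of the integer ring of \<open>K\<close>: a non-unit is a multiple of
      \<open>P\<close>, while for a unit \<open>w\<close> the quotient of \<open>z\<close> by
      \<open>w\<close> is integral, hence a polynomial in \<open>\<beta>\<close>.\<close>
    fix w :: "'f ^ 'n" assume "vint w"
    then have w: "emb w \<in> OK"
      using OK_emb by blast
    show "(\<exists>x. vint x \<and> w = mpoly d p B *v x) \<or>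
      (\<forall>z. vint z \<longrightarrow> (\<exists>c. (\<forall>i. nm (c i) \<le> 1) \<and> mpoly d c B *v w = z))"
    proof (cases "\<exists>y\<in>OK. emb w * y = 1")
      case False
      then have "emb w \<in> {P * y | y. y \<in> OK}"
        unfolding P(1)[symmetric] using w by simp
      then obtain x where "vint x" "emb w = P * emb x"
        using OK_emb by auto
      then have "vint x \<and> w = mpoly d p B *v x"
        using PB by (simp add: PB_def represents_def emb_inj)
      then show ?thesis
        by blast
    next
      case True
      then obtain y where y: "y \<in> OK" "emb w * y = 1"
        by blast
      have "\<exists>c. (\<forall>i. nm (c i) \<le> 1) \<and> mpoly d c B *v w = z" if "vint z" for z
      proof -
        have "emb z * y \<in> span_powers d"
          unfolding d(2)[symmetric] using that y(1) OK_emb OK_mult by blast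
        then obtain c where c: "\<And>i. nm (c i) \<le> 1" "emb z * y = (\<Sum>i<d. \<iota> (c i) * \<beta> ^ i)"
          by (rule span_powersE) blast
        have "emb (mpoly d c B *v w) = emb z * y * emb w"
          using represents_mpoly[OF B(2), where d = d and c = c] by (simp add: c(2) represents_def)
        also have "\<dots> = emb z"
          using y(2) by (metis mult.assoc mult.commute mult.right_neutral)
        finally show ?thesis
          using c(1) emb_inj by blast
      qed
      then show ?thesis
        by blast
    qed
  next
    assume "e = 1"
    have "mpoly d p A = msc \<pi> (mat 1)" for A :: "'f ^ 'n ^ 'n"
    proof -
      have "mpoly d p A = (\<Sum>i<d. if i = 0 then msc \<pi> (mat 1) else 0)"
        unfolding mpoly_def p(3)[OF \<open>e = 1\<close>] by (rule sum.cong) (auto simp: vec_eq_iff)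
      then show ?thesis
        using d(1) by simp
    qed
    then show "\<exists>a. \<forall>A :: 'f ^ 'n ^ 'n. mpoly d p A = msc a (mat 1)"
      by blast
  qed
  then show ?thesis
    unfolding B_def by blast
qed

end

section \<open>Topology of the special linear group\<close>

lemma carrier_SL_UNIV [simp]: "carrier (SL UNIV) = {A :: 'a::comm_ring_1 ^ 'n ^ 'n. det A = 1}"
  and mult_SL [simp]: "mult (SL R) = (**)"
  and one_SL [simp]: "one (SL R) = mat 1"
  by (simp_all add: SL_def)

lemma det_1_inverse:
  fixes A :: "'a::field ^ 'n ^ 'n"
  assumes "det A = 1"
  obtains A' where "A ** A' = mat 1" "A' ** A = mat 1" "det A' = 1"
proof -
  have "invertible A"
    using assms by (simp add: invertible_det_nz)
  then obtain A' where A': "A ** A' = mat 1" "A' ** A = mat 1"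
    by (auto simp: invertible_def)
  then have "det A * det A' = 1"
    by (metis det_I det_mul)
  then show ?thesis
    using assms A' that by simp
qed

lemma group_SL: "group (SL UNIV :: ('a::field ^ 'n ^ 'n) monoid)"
proof (rule groupI)
  fix A :: "'a ^ 'n ^ 'n" assume "A \<in> carrier (SL UNIV)"
  then show "\<exists>A'\<in>carrier (SL UNIV). A' \<otimes>\<^bsub>SL UNIV\<^esub> A = \<one>\<^bsub>SL UNIV\<^esub>"
    using det_1_inverse[of A] by auto
qed (auto simp: det_mul matrix_mul_assoc)

lemma inv_SL:
  fixes A A' :: "'a::field ^ 'n ^ 'n"
  assumes "A ** A' = mat 1" "det A = 1"
  shows "inv\<^bsub>SL UNIV\<^esub> A = A'"
proof -
  interpret group "SL UNIV :: ('a ^ 'n ^ 'n) monoid"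
    by (rule group_SL)
  have "det A * det A' = 1"
    using assms(1) by (metis det_I det_mul)
  then show ?thesis
    using assms by (intro inv_equality) (auto simp: matrix_left_right_inverse)
qed

lemma finite_matrices_over: "finite F \<Longrightarrow> finite {A :: 'a ^ 'n ^ 'm. \<forall>i j. A $ i $ j \<in> F}"
proof -
  assume "finite F"
  have "A \<in> (\<lambda>h. \<chi> i j. h (i, j)) ` (UNIV \<rightarrow>\<^sub>E F)" if "\<forall>i j. A $ i $ j \<in> F" for A :: "'a ^ 'n ^ 'm"
    using that by (intro image_eqI[of _ _ "\<lambda>(i, j). A $ i $ j"]) (auto simp: vec_eq_iff)
  moreover have "finite ((\<lambda>h. (\<chi> i j. h (i, j)) :: 'a ^ 'n ^ 'm) ` (UNIV \<rightarrow>\<^sub>E F))"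
    using \<open>finite F\<close> by (intro finite_imageI finite_PiE) auto
  ultimately show ?thesis
    by (elim finite_subset[rotated]) blast
qed

context uniformized_field
begin

section \<open>Congruence subgroups\<close>

definition cong_sub :: "nat \<Rightarrow> ('f ^ 'n ^ 'n) set" where
  "cong_sub m = {A. det A = 1 \<and> mbd (nm \<pi> ^ m) (A - mat 1)}"

lemma cong_sub_det: "A \<in> cong_sub m \<Longrightarrow> det A = 1"
  by (simp add: cong_sub_def)

lemma cong_sub_0_iff: "A \<in> cong_sub 0 \<longleftrightarrow> slint A"
proof
  assume "slint A"
  then show "A \<in> cong_sub 0"
    by (simp add: cong_sub_def slint_def mbd_diff mbd_mat_1)
next
  assume "A \<in> cong_sub 0"
  then show "slint A"
    using mbd_add[OF _ mbd_mat_1, of "A - mat 1"] by (simp add: cong_sub_def slint_def)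
qed

lemma cong_sub_antimono: "k \<le> m \<Longrightarrow> cong_sub m \<subseteq> cong_sub k"
  by (auto simp: cong_sub_def q_power_le_iff elim!: mbd_mono)

lemma cong_sub_mint: "A \<in> cong_sub m \<Longrightarrow> mint A"
  using cong_sub_antimono[of 0 m] cong_sub_0_iff by (auto simp: slint_def)

lemma cong_sub_1: "mat 1 \<in> cong_sub m"
  using q_pos by (simp add: cong_sub_def mbd_0)

lemma cong_sub_mult: "A \<in> cong_sub m \<Longrightarrow> B \<in> cong_sub m \<Longrightarrow> A ** B \<in> cong_sub m"
proof -
  assume A: "A \<in> cong_sub m" and B: "B \<in> cong_sub m"
  have eq: "A ** B - mat 1 = A ** (B - mat 1) + (A - mat 1)"
    by (simp add: matrix_diff_ldistrib)
  have "mbd (nm \<pi> ^ m) (A ** (B - mat 1))"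
    using mbd_mult[OF cong_sub_mint[OF A], of "nm \<pi> ^ m" "B - mat 1"] B by (simp add: cong_sub_def)
  then have "mbd (nm \<pi> ^ m) (A ** B - mat 1)"
    unfolding eq using A by (intro mbd_add) (auto simp: cong_sub_def)
  then show ?thesis
    using A B by (simp add: cong_sub_def det_mul)
qed

lemma cong_sub_inverse:
  assumes "A \<in> cong_sub m" "A ** A' = mat 1"
  shows "A' \<in> cong_sub m"
proof -
  have "slint A"
    using assms cong_sub_antimono[of 0 m] by (auto simp: cong_sub_0_iff)
  then obtain A'' where "A ** A'' = mat 1" "A'' ** A = mat 1" "slint A''"
    using slint_inverse by blast
  then have A': "slint A'" "A' ** A = mat 1"
    using assms(2) inverse_unique_matrix by metis+
  have "A' - mat 1 = A' ** (mat 1 - A)"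
    by (simp add: matrix_diff_ldistrib A')
  moreover have "mbd (nm \<pi> ^ m) (mat 1 - A)"
    using assms(1) by (simp add: cong_sub_def mbd_def nm_minus_commute)
  ultimately have "mbd (nm \<pi> ^ m) (A' - mat 1)"
    using mbd_mult[of 1 A' "nm \<pi> ^ m" "mat 1 - A"] A' by (simp add: slint_def)
  then show ?thesis
    using A' by (simp add: cong_sub_def slint_def)
qed

lemma cong_sub_conj_general:
  fixes g g' A :: "'f ^ 'n ^ 'n"
  assumes "g ** g' = mat 1" "mbd R g" "mbd R' g'" "R * nm \<pi> ^ M * R' \<le> nm \<pi> ^ m" "A \<in> cong_sub M"
  shows "g ** A ** g' \<in> cong_sub m"
proof -
  have "g ** A ** g' - mat 1 = g ** (A - mat 1) ** g'"
    by (simp add: matrix_diff_ldistrib matrix_diff_rdistrib assms(1))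
  moreover have "mbd (R * nm \<pi> ^ M * R') (g ** (A - mat 1) ** g')"
    using assms by (intro mbd_mult) (auto simp: cong_sub_def)
  moreover have "det g * det A * det g' = 1"
    using assms cong_sub_det[OF assms(5)] by (metis det_I det_mul mult.right_neutral)
  ultimately show ?thesis
    using assms(4) by (auto simp: cong_sub_def det_mul elim: mbd_mono)
qed

lemma cong_sub_conj:
  fixes g g' A :: "'f ^ 'n ^ 'n"
  shows "g ** g' = mat 1 \<Longrightarrow> mint g \<Longrightarrow> mint g' \<Longrightarrow> A \<in> cong_sub m \<Longrightarrow> g ** A ** g' \<in> cong_sub m"
  by (rule cong_sub_conj_general[where R = 1 and R' = 1 and M = m]) auto

lemma ex_cong_sub_conj:
  fixes g g' :: "'f ^ 'n ^ 'n"
  assumes "g ** g' = mat 1"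
  shows "\<exists>M. \<forall>A\<in>cong_sub M. g ** A ** g' \<in> cong_sub m"
proof -
  obtain R where "1 \<le> R" "mbd R g"
    using mbd_exists by blast
  moreover obtain R' where "1 \<le> R'" "mbd R' g'"
    using mbd_exists by blast
  ultimately have R: "1 \<le> R" "mbd R g" "1 \<le> R'" "mbd R' g'"
    by simp_all
  then have "0 < nm \<pi> ^ m / (R * R')"
    using q_pos by simp
  then obtain M where M: "nm \<pi> ^ M < nm \<pi> ^ m / (R * R')"
    using ex_q_power_le by blast
  then have "R * nm \<pi> ^ M * R' \<le> nm \<pi> ^ m"
    using R by (simp add: field_simps)
  then show ?thesis
    using cong_sub_conj_general[OF assms R(2,4)] by blast
qed

lemma subgroup_cong_sub: "subgroup (cong_sub m) (SL UNIV :: ('f ^ 'n ^ 'n) monoid)"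
proof
  fix A :: "'f ^ 'n ^ 'n" assume A: "A \<in> cong_sub m"
  then obtain A' where "A ** A' = mat 1"
    using det_1_inverse cong_sub_det by blast
  then show "inv\<^bsub>SL UNIV\<^esub> A \<in> cong_sub m"
    using A inv_SL cong_sub_det cong_sub_inverse by metis
qed (auto simp: cong_sub_det cong_sub_mult cong_sub_1)

section \<open>The matrix metric and open subgroups\<close>

definition mdist :: "'f ^ 'n ^ 'n \<Rightarrow> 'f ^ 'n ^ 'n \<Rightarrow> real" where
  "mdist A B = Max (range (\<lambda>(i, j). nm (A $ i $ j - B $ i $ j)))"

lemma mdist_le_iff: "mdist A B \<le> R \<longleftrightarrow> mbd R (A - B)"
  by (auto simp: mdist_def mbd_def)

lemma mdist_less_iff: "mdist A B < R \<longleftrightarrow> (\<forall>i j. nm (A $ i $ j - B $ i $ j) < R)"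
  by (auto simp: mdist_def)

lemma Metric_space_mdist: "Metric_space UNIV mdist"
proof
  fix A B C :: "'f ^ 'n ^ 'n"
  have "mbd (mdist A B) (A - B)"
    using mdist_le_iff by blast
  then show "0 \<le> mdist A B"
    by (rule mbd_nonneg)
  show "mdist A B = mdist B A"
    by (simp add: mdist_def nm_minus_commute)
  have "mdist A B = 0 \<longleftrightarrow> mdist A B \<le> 0"
    using \<open>0 \<le> mdist A B\<close> by auto
  also have "\<dots> \<longleftrightarrow> A = B"
    using nm_nonneg nm_eq_0_iff by (auto simp: mdist_le_iff mbd_def vec_eq_iff order_antisym_conv)
  finally show "mdist A B = 0 \<longleftrightarrow> A = B" .
  have "mbd (mdist A B) (A - B)" "mbd (mdist B C) (B - C)"
    using mdist_le_iff by blast+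
  then have "mbd (mdist A B + mdist B C) (A - B)" "mbd (mdist A B + mdist B C) (B - C)"
    using mbd_nonneg by (auto elim!: mbd_mono)
  then have "mbd (mdist A B + mdist B C) ((A - B) + (B - C))"
    by (rule mbd_add)
  then show "mdist A C \<le> mdist A B + mdist B C"
    by (simp add: mdist_le_iff)
qed

sublocale mat: Metric_space UNIV mdist
  by (rule Metric_space_mdist)

lemma SL_topology_eq: "SL_topology nm = subtopology mat.mtopology {A :: 'f ^ 'n ^ 'n. det A = 1}"
  by (simp add: SL_topology_def matrix_topology_def mdist_def[abs_def])

text \<open>Around \<open>u\<close>, the coset of \<open>cong_sub m\<close> contains a ball of
  \<open>SL\<close>: if \<open>R\<close> bounds the inverse of \<open>u\<close>, then radius
  \<open>nm \<pi> ^ m / R\<close> suffices.\<close>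

lemma open_subgroupI:
  assumes "subgroup U (SL UNIV :: ('f ^ 'n ^ 'n) monoid)" "cong_sub m \<subseteq> U"
  shows "open_subgroup (SL UNIV) (SL_topology nm) U"
proof -
  have "\<exists>\<epsilon>>0. \<forall>A. det A = 1 \<and> A \<in> mat.mball u \<epsilon> \<longrightarrow> A \<in> U" if "u \<in> U" for u
  proof -
    have u: "det u = 1"
      using that subgroup.subset[OF assms(1)] by auto
    obtain u' where u': "u ** u' = mat 1" "u' ** u = mat 1" "det u' = 1"
      using det_1_inverse[OF u] by blast
    obtain R where R: "1 \<le> R" "mbd R u'"
      using mbd_exists by blast
    have "A \<in> U" if A: "det A = 1" "A \<in> mat.mball u (nm \<pi> ^ m / R)" for A
    proof -
      have "mbd (nm \<pi> ^ m / R) (A - u)"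
        using A by (auto simp: mdist_less_iff mbd_def nm_minus_commute less_imp_le)
      from mbd_mult[OF R(2) this] have "mbd (nm \<pi> ^ m) (u' ** A - mat 1)"
        using R(1) by (simp add: matrix_diff_ldistrib u')
      then have "u' ** A \<in> U"
        using assms(2) A u' by (auto simp: cong_sub_def det_mul)
      then have "u ** (u' ** A) \<in> U"
        using subgroup.m_closed[OF assms(1) \<open>u \<in> U\<close>] by simp
      then show "A \<in> U"
        by (simp add: matrix_mul_assoc u')
    qed
    then show ?thesis
      using R(1) q_pos by (intro exI[of _ "nm \<pi> ^ m / R"]) auto
  qed
  then obtain \<epsilon> where \<epsilon>: "\<And>u. u \<in> U \<Longrightarrow> \<epsilon> u > 0"
    "\<And>u A. u \<in> U \<Longrightarrow> det A = 1 \<Longrightarrow> A \<in> mat.mball u (\<epsilon> u) \<Longrightarrow> A \<in> U"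
    by metis
  have "U = (\<Union>u\<in>U. mat.mball u (\<epsilon> u)) \<inter> {A. det A = 1}"
  proof (intro equalityI subsetI)
    fix u assume "u \<in> U"
    moreover have "det u = 1"
      using \<open>u \<in> U\<close> subgroup.subset[OF assms(1)] by auto
    moreover have "u \<in> mat.mball u (\<epsilon> u)"
      using \<epsilon>(1)[OF \<open>u \<in> U\<close>] by simp
    ultimately show "u \<in> (\<Union>u\<in>U. mat.mball u (\<epsilon> u)) \<inter> {A. det A = 1}"
      by blast
  qed (use \<epsilon>(2) in blast)
  moreover have "openin mat.mtopology (\<Union>u\<in>U. mat.mball u (\<epsilon> u))"
    by auto
  ultimately have "openin (SL_topology nm) U"
    unfolding SL_topology_eq openin_subtopology by blast
  then show ?thesis
    using assms(1) by (simp add: open_subgroup_def)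
qed

lemma open_subgroup_cong_sub: "open_subgroup (SL UNIV) (SL_topology nm) (cong_sub m)"
  by (rule open_subgroupI[OF subgroup_cong_sub order_refl])

lemma open_subgroupE:
  assumes "open_subgroup (SL UNIV) (SL_topology nm) (U :: ('f ^ 'n ^ 'n) set)"
  obtains m where "k \<le> m" "cong_sub m \<subseteq> U"
proof -
  have "mat 1 \<in> U"
    using assms subgroup.one_closed by (fastforce simp: open_subgroup_def)
  moreover obtain W where W: "openin mat.mtopology W" "U = W \<inter> {A. det A = 1}"
    using assms by (auto simp: open_subgroup_def SL_topology_eq openin_subtopology)
  ultimately obtain \<epsilon> where \<epsilon>: "0 < \<epsilon>" "mat.mball (mat 1) \<epsilon> \<subseteq> W"
    by (auto simp: mat.openin_mtopology)
  obtain m where m: "k \<le> m" "nm \<pi> ^ m < \<epsilon>"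
    using ex_q_power_le[OF \<epsilon>(1)] by blast
  have "A \<in> U" if "A \<in> cong_sub m" for A
  proof -
    have "mdist A (mat 1) \<le> nm \<pi> ^ m"
      using that by (simp add: mdist_le_iff cong_sub_def)
    then have "A \<in> mat.mball (mat 1) \<epsilon>"
      using m(2) by (simp add: mat.commute)
    then show ?thesis
      using \<epsilon>(2) W(2) cong_sub_det[OF that] by blast
  qed
  then show ?thesis
    using that m(1) by blast
qed

section \<open>Bounded sets, finite nets and compactness\<close>

lemma compactin_bounded:
  assumes "compactin (SL_topology nm) (C :: ('f ^ 'n ^ 'n) set)"
  shows "\<exists>R. \<forall>A\<in>C. mbd R A"
proof -
  have C: "compactin mat.mtopology C"
    using assms by (auto simp: SL_topology_eq compactin_subtopology)
  obtain c S where S: "C \<subseteq> mat.mcball c S"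
    using mat.compactin_imp_mbounded[OF C] by (auto simp: mat.mbounded_def)
  obtain R where R: "1 \<le> R" "mbd R c"
    using mbd_exists by blast
  have "mbd (max R S) A" if "A \<in> C" for A
  proof -
    have "mbd S (c - A)"
      using S that by (auto simp flip: mdist_le_iff)
    then have "mbd (max R S) (c - (c - A))"
      using R(2) by (intro mbd_diff[of _ c "c - A"]) (auto elim: mbd_mono)
    then show ?thesis
      by simp
  qed
  then show ?thesis
    by blast
qed

text \<open>Each induction step adds one \<open>\<pi>\<close>-adic digit, taken from representatives
  of the finite residue field.\<close>

lemma ex_finite_net_integers: "\<exists>F. finite F \<and> (\<forall>x. nm x \<le> 1 \<longrightarrow> (\<exists>s\<in>F. nm (x - s) \<le> nm \<pi> ^ k))"
proof (induction k)
  case 0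
  show ?case
    by (intro exI[of _ "{0}"]) simp
next
  case (Suc k)
  then obtain F where F: "finite F" "\<And>x. nm x \<le> 1 \<Longrightarrow> \<exists>s\<in>F. nm (x - s) \<le> nm \<pi> ^ k"
    by blast
  obtain E where E: "finite E" "\<And>x. nm x \<le> 1 \<Longrightarrow> \<exists>s\<in>E. nm (x - s) < 1"
    using finite_residue_field by blast
  let ?F = "(\<lambda>(s, t). s + \<pi> ^ k * t) ` (F \<times> E)"
  have "\<exists>s\<in>?F. nm (x - s) \<le> nm \<pi> ^ Suc k" if x: "nm x \<le> 1" for x
  proof -
    obtain s where s: "s \<in> F" "nm (x - s) \<le> nm \<pi> ^ k"
      using F(2)[OF x] by blast
    then have "nm ((x - s) / \<pi> ^ k) \<le> 1"
      using q_pos by (simp add: nm_divide nm_power)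
    then obtain t where t: "t \<in> E" "nm ((x - s) / \<pi> ^ k - t) < 1"
      using E(2) by blast
    have "x - (s + \<pi> ^ k * t) = \<pi> ^ k * ((x - s) / \<pi> ^ k - t)"
      using pi_nz by (simp add: field_simps)
    then have "nm (x - (s + \<pi> ^ k * t)) \<le> nm \<pi> ^ k * nm \<pi>"
      using nm_less1_le[OF t(2)] q_pos by (simp add: nm_mult nm_power)
    then show ?thesis
      using s(1) t(1) by (auto simp: mult.commute)
  qed
  then show ?case
    using F(1) E(1) by (intro exI[of _ ?F]) auto
qed

lemma ex_finite_net:
  assumes "0 < \<epsilon>"
  shows "\<exists>N. finite N \<and> (\<forall>A :: 'f ^ 'n ^ 'm. mbd R A \<longrightarrow> (\<exists>B\<in>N. mbd \<epsilon> (A - B)))"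
proof -
  obtain a where a: "R \<le> 1 / nm \<pi> ^ a"
    using ex_q_power_ge by blast
  obtain k where k: "nm \<pi> ^ k < \<epsilon> * nm \<pi> ^ a"
    using ex_q_power_le[of "\<epsilon> * nm \<pi> ^ a"] assms q_pos by auto
  obtain F where F: "finite F" "\<And>x. nm x \<le> 1 \<Longrightarrow> \<exists>s\<in>F. nm (x - s) \<le> nm \<pi> ^ k"
    using ex_finite_net_integers by blast
  let ?F = "(\<lambda>s. s / \<pi> ^ a) ` F"
  have "\<exists>s\<in>?F. nm (x - s) \<le> \<epsilon>" if x: "nm x \<le> R" for x
  proof -
    have "nm x \<le> 1 / nm \<pi> ^ a"
      using x a by simp
    then have "nm (\<pi> ^ a * x) \<le> 1"
      using q_pos by (simp add: nm_mult nm_power field_simps)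
    then obtain s where s: "s \<in> F" "nm (\<pi> ^ a * x - s) \<le> nm \<pi> ^ k"
      using F(2) by blast
    have "\<pi> ^ a * x - s = \<pi> ^ a * (x - s / \<pi> ^ a)"
      using pi_nz by (simp add: field_simps)
    then have "nm \<pi> ^ a * nm (x - s / \<pi> ^ a) \<le> nm \<pi> ^ a * \<epsilon>"
      using s(2) k by (simp add: nm_mult nm_power mult.commute)
    then show ?thesis
      using s(1) q_pos by auto
  qed
  then obtain f where f: "\<And>x. nm x \<le> R \<Longrightarrow> f x \<in> ?F" "\<And>x. nm x \<le> R \<Longrightarrow> nm (x - f x) \<le> \<epsilon>"
    by metis
  show ?thesis
  proof (intro exI conjI allI impI)
    show "finite {A :: 'f ^ 'n ^ 'm. \<forall>i j. A $ i $ j \<in> ?F}"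
      using F(1) by (intro finite_matrices_over) simp
    fix A :: "'f ^ 'n ^ 'm" assume "mbd R A"
    then show "\<exists>B\<in>{A. \<forall>i j. A $ i $ j \<in> ?F}. mbd \<epsilon> (A - B)"
      using f by (intro bexI[of _ "\<chi> i j. f (A $ i $ j)"]) (auto simp: mbd_def)
  qed
qed

lemma equivp_mbd: "0 \<le> \<epsilon> \<Longrightarrow> equivp (\<lambda>A B :: 'f ^ 'n ^ 'm. mbd \<epsilon> (A - B))"
proof (rule equivpI)
  show "symp (\<lambda>A B :: 'f ^ 'n ^ 'm. mbd \<epsilon> (A - B))"
    by (rule sympI) (simp add: mbd_def nm_minus_commute)
  show "transp (\<lambda>A B :: 'f ^ 'n ^ 'm. mbd \<epsilon> (A - B))"
  proof (rule transpI)
    fix A B C :: "'f ^ 'n ^ 'm"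
    assume "mbd \<epsilon> (A - B)" "mbd \<epsilon> (B - C)"
    then have "mbd \<epsilon> ((A - B) + (B - C))"
      by (rule mbd_add)
    then show "mbd \<epsilon> (A - C)"
      by simp
  qed
qed (simp add: reflp_def mbd_0)

text \<open>One element of \<open>S\<close> is chosen for each class. If two of them had the same
  nearest net point, they would be \<open>\<epsilon>\<close>-close by the ultrametric inequality,
  hence equivalent, hence equal; so there are at most as many as net points. This finiteness
  principle serves for compactness, for cosets in a support and for averaging over a congruence
  subgroup.\<close>

lemma ex_finite_transversal:
  fixes S :: "('f ^ 'n ^ 'm) set"
  assumes S: "\<And>A. A \<in> S \<Longrightarrow> mbd R A" and "0 < \<epsilon>" and E: "equivp E"
    and close: "\<And>A B. A \<in> S \<Longrightarrow> B \<in> S \<Longrightarrow> mbd \<epsilon> (A - B) \<Longrightarrow> E A B"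
  shows "\<exists>T. finite T \<and> T \<subseteq> S \<and> (\<forall>A\<in>S. \<exists>B\<in>T. E A B) \<and> (\<forall>A\<in>T. \<forall>B\<in>T. E A B \<longrightarrow> A = B)"
proof -
  define rep where "rep A = (SOME B. B \<in> S \<and> E A B)" for A
  have rep: "rep A \<in> S" "E A (rep A)" if "A \<in> S" for A
    using someI[of "\<lambda>B. B \<in> S \<and> E A B" A] that equivp_reflp[OF E] by (auto simp: rep_def)
  have rep_eq: "rep A = rep B" if "E A B" for A B
    using that E unfolding rep_def equivp_def by metis
  obtain N where N: "finite N" "\<And>A :: 'f ^ 'n ^ 'm. mbd R A \<Longrightarrow> \<exists>B\<in>N. mbd \<epsilon> (A - B)"
    using ex_finite_net[OF assms(2)] by blast
  then obtain f where f: "\<And>A. A \<in> S \<Longrightarrow> f A \<in> N" "\<And>A. A \<in> S \<Longrightarrow> mbd \<epsilon> (A - f A)"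
    using S by metis
  have "inj_on f (rep ` S)"
  proof (rule inj_onI)
    fix A B assume AB: "A \<in> rep ` S" "B \<in> rep ` S" "f A = f B"
    then have "A \<in> S" "B \<in> S"
      using rep by auto
    then have "mbd \<epsilon> ((A - f A) - (B - f A))"
      using f(2)[OF \<open>A \<in> S\<close>] f(2)[OF \<open>B \<in> S\<close>] AB(3)
      by (intro mbd_diff[of _ "A - f A" "B - f A"]) simp_all
    then have "E A B"
      using close \<open>A \<in> S\<close> \<open>B \<in> S\<close> by simp
    then show "A = B"
      using AB(1,2) rep rep_eq by (metis imageE)
  qed
  moreover have "f ` rep ` S \<subseteq> N"
    using f rep by auto
  ultimately have "finite (rep ` S)"
    using N(1) finite_imageD finite_subset by metis
  moreover have "\<forall>A\<in>rep ` S. \<forall>B\<in>rep ` S. E A B \<longrightarrow> A = B"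
    using rep rep_eq by (metis imageE)
  moreover have "\<forall>A\<in>S. \<exists>B\<in>rep ` S. E A B"
    using rep by blast
  moreover have "rep ` S \<subseteq> S"
    using rep by blast
  ultimately show ?thesis
    by (intro exI[of _ "rep ` S"] conjI)
qed

text \<open>Scaling by \<open>\<pi> ^ a\<close> reduces to integral matrices and multiplies
  determinants by \<open>\<pi> ^ (a * CARD('n))\<close>.\<close>

lemma nm_det_diff_bounded:
  fixes A B :: "'f ^ 'n ^ 'n"
  assumes "mbd (1 / nm \<pi> ^ a) A" "mbd (1 / nm \<pi> ^ a) B" "mbd \<epsilon> (A - B)"
  shows "nm (det A - det B) \<le> \<epsilon> / nm \<pi> ^ (a * CARD('n))"
proof -
  have "mint (msc (\<pi> ^ a) A)" "mint (msc (\<pi> ^ a) B)"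
    using mbd_msc[OF assms(1), of "\<pi> ^ a"] mbd_msc[OF assms(2), of "\<pi> ^ a"] q_pos
    by (simp_all add: nm_power)
  moreover have "mbd \<epsilon> (msc (\<pi> ^ a) A - msc (\<pi> ^ a) B)"
    using mbd_msc[OF assms(3), of "\<pi> ^ a"] q_power_le_1[of a] mbd_nonneg[OF assms(3)]
    by (auto simp: nm_power mult_left_le_one_le q_pos less_imp_le simp flip: msc_diff elim!: mbd_mono)
  ultimately have "nm (det (msc (\<pi> ^ a) A) - det (msc (\<pi> ^ a) B)) \<le> \<epsilon>"
    by (rule nm_det_diff_le)
  then have "nm \<pi> ^ (a * CARD('n)) * nm (det A - det B) \<le> \<epsilon>"
    by (simp add: det_msc nm_mult nm_power power_mult flip: right_diff_distrib)
  then show ?thesis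
    using q_pos by (simp add: field_simps)
qed

lemma ex_limit:
  fixes \<sigma> :: "nat \<Rightarrow> 'f ^ 'n ^ 'n"
  assumes "mat.MCauchy \<sigma>"
  obtains A where "\<And>\<epsilon>. 0 < \<epsilon> \<Longrightarrow> \<exists>N. \<forall>n\<ge>N. mdist (\<sigma> n) A < \<epsilon>"
proof -
  interpret F: Metric_space UNIV "\<lambda>x y. nm (x - y)"
  proof
    fix x y z :: 'f
    show "nm (x - y) = nm (y - x)" "0 \<le> nm (x - y)" "nm (x - y) = 0 \<longleftrightarrow> x = y"
      by (simp_all add: nm_minus_commute nm_nonneg nm_eq_0_iff)
    show "nm (x - z) \<le> nm (x - y) + nm (y - z)"
      using nm_ultrametric[of "x - y" "y - z"] nm_nonneg[of "x - y"] nm_nonneg[of "y - z"] by simp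
  qed
  have "F.MCauchy (\<lambda>n. \<sigma> n $ i $ j)" for i j
    using assms by (auto simp: F.MCauchy_def mat.MCauchy_def mdist_less_iff) meson
  then have "\<exists>x. limitin F.mtopology (\<lambda>n. \<sigma> n $ i $ j) x sequentially" for i j
    using nm_complete by (simp add: F.mcomplete_def)
  then obtain f where f: "\<And>i j. limitin F.mtopology (\<lambda>n. \<sigma> n $ i $ j) (f i j) sequentially"
    by metis
  have "\<exists>N. \<forall>n\<ge>N. mdist (\<sigma> n) (\<chi> i j. f i j) < \<epsilon>" if "0 < \<epsilon>" for \<epsilon>
  proof -
    have "\<forall>\<^sub>F n in sequentially. nm (\<sigma> n $ i $ j - f i j) < \<epsilon>" for i j
      using f[of i j] that by (simp add: F.limitin_metric)
    then have "\<forall>\<^sub>F n in sequentially. \<forall>i j. nm (\<sigma> n $ i $ j - f i j) < \<epsilon>"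
      by (intro eventually_all_finite)
    then show ?thesis
      by (simp add: mdist_less_iff eventually_sequentially)
  qed
  then show ?thesis
    using that by blast
qed

text \<open>Finite nets give total boundedness, completeness of the field gives limits entry by
  entry, and both defining conditions survive the limit.\<close>

lemma compactin_ball: "compactin (SL_topology nm) {A :: 'f ^ 'n ^ 'n. det A = 1 \<and> mbd R A}"
proof -
  define S where "S = {A :: 'f ^ 'n ^ 'n. det A = 1 \<and> mbd R A}"
  have "mat.mtotally_bounded S"
    unfolding mat.mtotally_bounded_def
  proof (intro allI impI)
    fix \<epsilon> :: real assume "0 < \<epsilon>"
    then have "\<exists>K. finite K \<and> K \<subseteq> S \<and> (\<forall>A\<in>S. \<exists>B\<in>K. mbd (\<epsilon> / 2) (A - B)) \<and>
        (\<forall>A\<in>K. \<forall>B\<in>K. mbd (\<epsilon> / 2) (A - B) \<longrightarrow> A = B)"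
      by (intro ex_finite_transversal[where R = R] equivp_mbd) (simp_all add: S_def)
    then obtain K where K: "finite K" "K \<subseteq> S" "\<And>A. A \<in> S \<Longrightarrow> \<exists>B\<in>K. mbd (\<epsilon> / 2) (A - B)"
      by blast
    have "A \<in> (\<Union>x\<in>K. mat.mball x \<epsilon>)" if "A \<in> S" for A
    proof -
      obtain B where B: "B \<in> K" "mbd (\<epsilon> / 2) (A - B)"
        using K(3)[OF \<open>A \<in> S\<close>] by blast
      then have "mdist A B \<le> \<epsilon> / 2"
        by (simp only: mdist_le_iff)
      with B(1) show ?thesis
        using \<open>0 < \<epsilon>\<close> by (auto simp: mat.commute intro!: bexI[of _ B])
    qed
    then show "\<exists>K. finite K \<and> K \<subseteq> S \<and> S \<subseteq> (\<Union>x\<in>K. mat.mball x \<epsilon>)"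
      using K(1,2) by blast
  qed
  then have cauchy: "\<exists>r. strict_mono r \<and> mat.MCauchy (\<sigma> \<circ> r)" if "range \<sigma> \<subseteq> S" for \<sigma> :: "nat \<Rightarrow> _"
    using that by (simp add: mat.mtotally_bounded_sequentially)
  have "\<exists>l r. l \<in> S \<and> strict_mono r \<and> limitin mat.mtopology (\<sigma> \<circ> r) l sequentially"
    if \<sigma>: "range \<sigma> \<subseteq> S" for \<sigma> :: "nat \<Rightarrow> _"
  proof -
    obtain r where r: "strict_mono r" "mat.MCauchy (\<sigma> \<circ> r)"
      using cauchy[OF \<sigma>] by blast
    obtain A where A: "\<And>\<epsilon>. 0 < \<epsilon> \<Longrightarrow> \<exists>N. \<forall>n\<ge>N. mdist ((\<sigma> \<circ> r) n) A < \<epsilon>"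
      using ex_limit[OF r(2)] by blast
    have approx: "\<exists>B\<in>S. mdist B A < \<epsilon>" if "0 < \<epsilon>" for \<epsilon>
      using A[OF that] \<sigma> by auto
    have "mbd R A"
      unfolding mbd_def
    proof (intro allI, rule ccontr)
      fix i j assume "\<not> nm (A $ i $ j) \<le> R"
      \<comment> \<open>A member of \<open>S\<close> shows \<open>0 \<le> R\<close>, so the
        offending entry has positive norm and may serve as a radius.\<close>
      obtain B0 where "B0 \<in> S"
        using \<sigma> by auto
      then have "0 \<le> R"
        using mbd_nonneg by (auto simp: S_def)
      with \<open>\<not> nm (A $ i $ j) \<le> R\<close> obtain B where "B \<in> S" "mdist B A < nm (A $ i $ j)"
        using approx[of "nm (A $ i $ j)"] by auto
      then have "nm (B $ i $ j) = nm (A $ i $ j)" "nm (B $ i $ j) \<le> R"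
        by (auto simp: mdist_less_iff S_def mbd_def intro: nm_eq_of_close)
      then show False
        using \<open>\<not> nm (A $ i $ j) \<le> R\<close> by simp
    qed
    moreover have "det A = 1"
    proof (rule ccontr)
      assume "det A \<noteq> 1"
      obtain a where a: "R \<le> 1 / nm \<pi> ^ a"
        using ex_q_power_ge by blast
      \<comment> \<open>Chosen so that the determinant of a \<open>\<delta>\<close>-close member of
        \<open>S\<close>, which is 1, lies within half of \<open>nm (1 - det A)\<close> of
        \<open>det A\<close>.\<close>
      define \<delta> where "\<delta> = nm (1 - det A) * nm \<pi> ^ (a * CARD('n)) / 2"
      have "0 < nm (1 - det A)"
        using \<open>det A \<noteq> 1\<close> by (simp add: nm_pos_iff)
      then have "0 < \<delta>"
        using q_pos by (simp add: \<delta>_def)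
      then obtain B where B: "B \<in> S" "mdist B A < \<delta>"
        using approx by blast
      then have "nm (det B - det A) \<le> \<delta> / nm \<pi> ^ (a * CARD('n))"
        using a \<open>mbd R A\<close> by (intro nm_det_diff_bounded) (auto simp: S_def elim: mbd_mono simp flip: mdist_le_iff)
      then show False
        using B(1) \<open>0 < nm (1 - det A)\<close> q_pos by (simp add: \<delta>_def S_def)
    qed
    ultimately have "A \<in> S"
      by (simp add: S_def)
    moreover have "limitin mat.mtopology (\<sigma> \<circ> r) A sequentially"
      using A by (simp add: mat.limitin_metric eventually_sequentially)
    ultimately show ?thesis
      using r(1) by blast
  qed
  then have "compactin mat.mtopology S"
    by (simp add: mat.compactin_sequentially)
  then show ?thesis
    by (auto simp: SL_topology_eq compactin_subtopology S_def)
qed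

end

section \<open>Compactly induced representations\<close>

lemma right_translation_SL:
  "right_translation (SL UNIV) g f = (\<lambda>x. if det x = 1 then f (x ** g) else 0)"
  by (simp add: right_translation_def fun_eq_iff)

lemma right_translation_mult:
  "det g = 1 \<Longrightarrow> right_translation (SL UNIV) (g ** h) f =
     right_translation (SL UNIV) g (right_translation (SL UNIV) h f)"
  by (auto simp: right_translation_SL fun_eq_iff det_mul matrix_mul_assoc)

lemma sum_fun_apply: "(\<Sum>i\<in>I. f i) x = (\<Sum>i\<in>I. f i x)"
  by (induction I rule: infinite_finite_induct) auto

text \<open>
  \<open>cong_sub 0\<close> is \<open>SL(O)\<close>, and \<open>\<theta>\<close> plays the role of \<open>\<psi>\<close>. The assumptions \<open>bounded\<close> and \<open>rigid\<close> say
  which \<open>g\<close> intertwine \<open>\<theta>\<close> with the trivial character of \<open>cong_sub m\<close>.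
\<close>

locale induction_data = uniformized_field nm \<pi> + vector_space sc
  for nm :: "'f::field \<Rightarrow> real" and \<pi> and sc :: "complex \<Rightarrow> 'v::ab_group_add \<Rightarrow> 'v" +
  fixes V :: "'v set" and \<sigma> :: "'f ^ 'n ^ 'n \<Rightarrow> 'v \<Rightarrow> 'v" and l r :: nat
    and \<theta> :: "'f ^ 'n ^ 'n \<Rightarrow> complex" and v0 :: 'v
  assumes V: "subspace V"
    and \<sigma>_closed: "k \<in> cong_sub 0 \<Longrightarrow> v \<in> V \<Longrightarrow> \<sigma> k v \<in> V"
    and \<sigma>_add: "k \<in> cong_sub 0 \<Longrightarrow> v \<in> V \<Longrightarrow> w \<in> V \<Longrightarrow> \<sigma> k (v + w) = \<sigma> k v + \<sigma> k w"
    and \<sigma>_scale: "k \<in> cong_sub 0 \<Longrightarrow> v \<in> V \<Longrightarrow> \<sigma> k (sc c v) = sc c (\<sigma> k v)"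
    and \<sigma>_mult: "k \<in> cong_sub 0 \<Longrightarrow> k' \<in> cong_sub 0 \<Longrightarrow> v \<in> V \<Longrightarrow> \<sigma> (k ** k') v = \<sigma> k (\<sigma> k' v)"
    and \<sigma>_trivial: "k \<in> cong_sub r \<Longrightarrow> v \<in> V \<Longrightarrow> \<sigma> k v = v"
    and \<sigma>_irreducible: "subspace W \<Longrightarrow> W \<subseteq> V \<Longrightarrow> (\<And>k w. k \<in> cong_sub 0 \<Longrightarrow> w \<in> W \<Longrightarrow> \<sigma> k w \<in> W) \<Longrightarrow>
      W = {0} \<or> W = V"
    and v0: "v0 \<in> V" "v0 \<noteq> 0" "k \<in> cong_sub l \<Longrightarrow> \<sigma> k v0 = sc (\<theta> k) v0"
    and bounded: "r \<le> m \<Longrightarrow> \<exists>R. \<forall>g g'. det g = 1 \<longrightarrow> g ** g' = mat 1 \<longrightarrow>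
      (\<forall>h\<in>cong_sub l. g' ** h ** g \<in> cong_sub m \<longrightarrow> \<theta> h = 1) \<longrightarrow> mbd R g"
    and rigid: "det g = 1 \<Longrightarrow> g ** g' = mat 1 \<Longrightarrow>
      (\<And>h. h \<in> cong_sub l \<Longrightarrow> g' ** h ** g \<in> cong_sub r \<Longrightarrow> \<theta> h = 1) \<Longrightarrow> g \<in> cong_sub 0"
begin

section \<open>The induced space under right translation\<close>

abbreviation RT :: "'f ^ 'n ^ 'n \<Rightarrow> ('f ^ 'n ^ 'n \<Rightarrow> 'v) \<Rightarrow> 'f ^ 'n ^ 'n \<Rightarrow> 'v" where
  "RT \<equiv> right_translation (SL UNIV)"

abbreviation E :: "('f ^ 'n ^ 'n \<Rightarrow> 'v) set" where
  "E \<equiv> compact_ind_space (SL UNIV) (SL_topology nm) (cong_sub 0) V \<sigma>"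

lemma cong_sub_imp_cong_sub_0: "k \<in> cong_sub m \<Longrightarrow> k \<in> cong_sub 0"
  using cong_sub_antimono[of 0 m] by auto

lemma \<sigma>_0: "k \<in> cong_sub 0 \<Longrightarrow> \<sigma> k 0 = 0"
  using \<sigma>_scale[of k 0 0] subspace_0[OF V] by simp

lemma \<sigma>_1: "v \<in> V \<Longrightarrow> \<sigma> (mat 1) v = v"
  by (rule \<sigma>_trivial[OF cong_sub_1])

text \<open>Removes the topology: open subgroups contain congruence subgroups, and compact support
  modulo \<open>cong_sub 0\<close> is bounded support, because integral matrices do not enlarge a
  bound.\<close>

lemma E_iff: "f \<in> E \<longleftrightarrow>
    (\<forall>x. det x \<noteq> 1 \<longrightarrow> f x = 0) \<and> (\<forall>x. det x = 1 \<longrightarrow> f x \<in> V) \<and>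
    (\<forall>k\<in>cong_sub 0. \<forall>x. det x = 1 \<longrightarrow> f (k ** x) = \<sigma> k (f x)) \<and>
    (\<exists>m. \<forall>u\<in>cong_sub m. \<forall>x. det x = 1 \<longrightarrow> f (x ** u) = f x) \<and>
    (\<exists>R. \<forall>x. det x = 1 \<longrightarrow> f x \<noteq> 0 \<longrightarrow> mbd R x)"
proof -
  have "(\<exists>U. open_subgroup (SL UNIV) (SL_topology nm) U \<and> (\<forall>u\<in>U. \<forall>x. det x = 1 \<longrightarrow> f (x ** u) = f x)) \<longleftrightarrow>
      (\<exists>m. \<forall>u\<in>cong_sub m. \<forall>x. det x = 1 \<longrightarrow> f (x ** u) = f x)"
  proof
    assume "\<exists>U. open_subgroup (SL UNIV) (SL_topology nm) U \<and> (\<forall>u\<in>U. \<forall>x. det x = 1 \<longrightarrow> f (x ** u) = f x)"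
    then obtain U where U: "open_subgroup (SL UNIV) (SL_topology nm) U"
      "\<forall>u\<in>U. \<forall>x. det x = 1 \<longrightarrow> f (x ** u) = f x"
      by blast
    obtain m where "cong_sub m \<subseteq> U"
      using open_subgroupE[OF U(1)] by blast
    then show "\<exists>m. \<forall>u\<in>cong_sub m. \<forall>x. det x = 1 \<longrightarrow> f (x ** u) = f x"
      using U(2) by blast
  qed (use open_subgroup_cong_sub in blast)
  moreover have "(\<exists>C. compactin (SL_topology nm) C \<and> {x. det x = 1 \<and> f x \<noteq> 0} \<subseteq> cong_sub 0 <#>\<^bsub>SL UNIV\<^esub> C) \<longleftrightarrow>
      (\<exists>R. \<forall>x. det x = 1 \<longrightarrow> f x \<noteq> 0 \<longrightarrow> mbd R x)"
  proof
    assume "\<exists>C. compactin (SL_topology nm) C \<and> {x. det x = 1 \<and> f x \<noteq> 0} \<subseteq> cong_sub 0 <#>\<^bsub>SL UNIV\<^esub> C"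
    then obtain C where C: "compactin (SL_topology nm) C"
      "{x. det x = 1 \<and> f x \<noteq> 0} \<subseteq> cong_sub 0 <#>\<^bsub>SL UNIV\<^esub> C"
      by blast
    obtain R where R: "\<forall>A\<in>C. mbd R A"
      using compactin_bounded[OF C(1)] by blast
    have "mbd R (k ** c)" if "k \<in> cong_sub 0" "c \<in> C" for k c
      using mbd_mult[OF cong_sub_mint[OF that(1)] bspec[OF R that(2)]] by simp
    then show "\<exists>R. \<forall>x. det x = 1 \<longrightarrow> f x \<noteq> 0 \<longrightarrow> mbd R x"
      using C(2) by (intro exI[of _ R]) (auto simp: set_mult_def)
  next
    assume "\<exists>R. \<forall>x. det x = 1 \<longrightarrow> f x \<noteq> 0 \<longrightarrow> mbd R x"
    then obtain R where R: "\<And>x. det x = 1 \<Longrightarrow> f x \<noteq> 0 \<Longrightarrow> mbd R x"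
      by blast
    have "x \<in> cong_sub 0 <#>\<^bsub>SL UNIV\<^esub> {A. det A = 1 \<and> mbd R A}" if "det x = 1" "f x \<noteq> 0" for x
      unfolding set_mult_def using that R cong_sub_1[of 0]
      by (intro UN_I[of "mat 1"] UN_I[of x]) auto
    then show "\<exists>C. compactin (SL_topology nm) C \<and> {x. det x = 1 \<and> f x \<noteq> 0} \<subseteq> cong_sub 0 <#>\<^bsub>SL UNIV\<^esub> C"
      using compactin_ball by (intro exI[of _ "{A. det A = 1 \<and> mbd R A}"]) auto
  qed
  ultimately show ?thesis
    by (simp add: compact_ind_space_def)
qed

lemma E_outside: "f \<in> E \<Longrightarrow> det x \<noteq> 1 \<Longrightarrow> f x = 0"
  and E_V: "f \<in> E \<Longrightarrow> det x = 1 \<Longrightarrow> f x \<in> V"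
  and E_left: "f \<in> E \<Longrightarrow> k \<in> cong_sub 0 \<Longrightarrow> det x = 1 \<Longrightarrow> f (k ** x) = \<sigma> k (f x)"
  by (auto simp: E_iff)

lemma E_right:
  assumes "f \<in> E"
  obtains m where "k \<le> m" "\<And>u x. u \<in> cong_sub m \<Longrightarrow> det x = 1 \<Longrightarrow> f (x ** u) = f x"
proof -
  obtain m where "\<forall>u\<in>cong_sub m. \<forall>x. det x = 1 \<longrightarrow> f (x ** u) = f x"
    using assms by (auto simp: E_iff)
  then show ?thesis
    using that[of "max k m"] cong_sub_antimono[of m "max k m"] by auto
qed

lemma E_support:
  assumes "f \<in> E"
  obtains R where "1 \<le> R" "\<And>x. det x = 1 \<Longrightarrow> f x \<noteq> 0 \<Longrightarrow> mbd R x"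
proof -
  obtain R where R: "\<And>x. det x = 1 \<Longrightarrow> f x \<noteq> 0 \<Longrightarrow> mbd R x"
    using assms by (auto simp: E_iff)
  have "mbd (max 1 R) x" if "det x = 1" "f x \<noteq> 0" for x
    using R[OF that] by (rule mbd_mono) simp
  then show ?thesis
    using that[of "max 1 R"] by simp
qed

sublocale fun_space: vector_space "pointwise_scale sc :: complex \<Rightarrow> ('f ^ 'n ^ 'n \<Rightarrow> 'v) \<Rightarrow> _"
  by unfold_locales (auto simp: pointwise_scale_def fun_eq_iff scale_right_distrib scale_left_distrib)

lemma E_subspace: "fun_space.subspace E"
proof (rule fun_space.subspaceI)
  show "0 \<in> E"
    by (auto simp: E_iff \<sigma>_0 subspace_0[OF V])
next
  fix f g assume f: "f \<in> E" and g: "g \<in> E"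
  obtain m where m: "\<And>u x. u \<in> cong_sub m \<Longrightarrow> det x = 1 \<Longrightarrow> f (x ** u) = f x"
    using E_right[OF f] by blast
  obtain m' where m': "m \<le> m'" "\<And>u x. u \<in> cong_sub m' \<Longrightarrow> det x = 1 \<Longrightarrow> g (x ** u) = g x"
    using E_right[OF g] by blast
  have 1: "\<forall>u\<in>cong_sub m'. \<forall>x. det x = 1 \<longrightarrow> (f + g) (x ** u) = (f + g) x"
    using m m' cong_sub_antimono[OF m'(1)] by auto
  obtain R where R: "\<And>x. det x = 1 \<Longrightarrow> f x \<noteq> 0 \<Longrightarrow> mbd R x"
    using E_support[OF f] by blast
  obtain S where S: "\<And>x. det x = 1 \<Longrightarrow> g x \<noteq> 0 \<Longrightarrow> mbd S x"
    using E_support[OF g] by blast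
  have 2: "mbd (max R S) x" if "det x = 1" "(f + g) x \<noteq> 0" for x
  proof (cases "f x = 0")
    case True
    then show ?thesis
      using that by (intro mbd_mono[OF S]) auto
  next
    case False
    then show ?thesis
      using that by (intro mbd_mono[OF R]) auto
  qed
  have 3: "(f + g) (k ** x) = \<sigma> k ((f + g) x)" if "k \<in> cong_sub 0" "det x = 1" for k x
    using f g that by (simp add: E_left \<sigma>_add E_V)
  have 4: "\<forall>x. det x = 1 \<longrightarrow> (f + g) x \<in> V"
    using f g by (auto intro: subspace_add[OF V] E_V)
  show "f + g \<in> E"
    unfolding E_iff using 1 2 3 4 f g by (auto simp: E_outside)
next
  fix c f assume f: "f \<in> E"
  obtain m where m: "\<And>u x. u \<in> cong_sub m \<Longrightarrow> det x = 1 \<Longrightarrow> f (x ** u) = f x"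
    using E_right[OF f] by blast
  obtain R where R: "\<And>x. det x = 1 \<Longrightarrow> f x \<noteq> 0 \<Longrightarrow> mbd R x"
    using E_support[OF f] by blast
  have "\<forall>u\<in>cong_sub m. \<forall>x. det x = 1 \<longrightarrow> pointwise_scale sc c f (x ** u) = pointwise_scale sc c f x"
    using m by (simp add: pointwise_scale_def)
  moreover have "\<forall>x. det x = 1 \<longrightarrow> pointwise_scale sc c f x \<noteq> 0 \<longrightarrow> mbd R x"
    using R by (auto simp: pointwise_scale_def)
  moreover have "pointwise_scale sc c f (k ** x) = \<sigma> k (pointwise_scale sc c f x)"
    if "k \<in> cong_sub 0" "det x = 1" for k x
    using f that by (simp add: pointwise_scale_def E_left \<sigma>_scale E_V)
  moreover have "\<forall>x. det x = 1 \<longrightarrow> pointwise_scale sc c f x \<in> V"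
    using f by (auto simp: pointwise_scale_def intro: subspace_scale[OF V] E_V)
  moreover have "\<forall>x. det x \<noteq> 1 \<longrightarrow> pointwise_scale sc c f x = 0"
    using f by (simp add: pointwise_scale_def E_outside)
  ultimately show "pointwise_scale sc c f \<in> E"
    unfolding E_iff by blast
qed

lemma E_RT:
  assumes f: "f \<in> E" and g: "det g = 1"
  shows "RT g f \<in> E"
proof -
  obtain g' where g': "g ** g' = mat 1" "g' ** g = mat 1"
    using det_1_inverse[OF g] by blast
  obtain m where m: "\<And>u x. u \<in> cong_sub m \<Longrightarrow> det x = 1 \<Longrightarrow> f (x ** u) = f x"
    using E_right[OF f] by blast
  obtain M where M: "\<And>u. u \<in> cong_sub M \<Longrightarrow> g' ** u ** g \<in> cong_sub m"
    using ex_cong_sub_conj[OF g'(2)] by blast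
  have "RT g f (x ** u) = RT g f x" if "u \<in> cong_sub M" "det x = 1" for u x
  proof -
    have "x ** u ** g = (x ** g) ** (g' ** u ** g)"
      by (metis g'(1) matrix_mul_assoc matrix_mul_rid)
    then have "f (x ** u ** g) = f (x ** g)"
      using m[OF M[OF that(1)], of "x ** g"] that(2) g by (simp add: det_mul)
    then show ?thesis
      using that cong_sub_det[OF that(1)] by (simp add: right_translation_SL det_mul)
  qed
  moreover obtain R where R: "\<And>x. det x = 1 \<Longrightarrow> f x \<noteq> 0 \<Longrightarrow> mbd R x"
    using E_support[OF f] by blast
  moreover obtain S where S: "mbd S g'"
    using mbd_exists by blast
  have "mbd (R * S) x" if "det x = 1" "RT g f x \<noteq> 0" for x
  proof -
    have "mbd R (x ** g)"
      using that g by (intro R) (auto simp: right_translation_SL det_mul)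
    then have "mbd (R * S) (x ** g ** g')"
      using S by (rule mbd_mult)
    then show ?thesis
      by (simp add: g' flip: matrix_mul_assoc)
  qed
  moreover have "RT g f (k ** x) = \<sigma> k (RT g f x)" if "k \<in> cong_sub 0" "det x = 1" for k x
    using that g E_left[OF f that(1), of "x ** g"] cong_sub_det[OF that(1)]
    by (simp add: right_translation_SL det_mul matrix_mul_assoc)
  moreover have "\<forall>x. det x = 1 \<longrightarrow> RT g f x \<in> V"
    using f g by (auto simp: right_translation_SL det_mul intro: E_V)
  moreover have "\<forall>x. det x \<noteq> 1 \<longrightarrow> RT g f x = 0"
    by (simp add: right_translation_SL)
  ultimately show ?thesis
    unfolding E_iff by blast
qed

lemma RT_add: "RT g (f + h) = RT g f + RT g h"
  by (simp add: right_translation_SL fun_eq_iff)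

lemma RT_scale: "RT g (pointwise_scale sc c f) = pointwise_scale sc c (RT g f)"
  by (simp add: right_translation_SL fun_eq_iff pointwise_scale_def)

lemma RT_1: "f \<in> E \<Longrightarrow> RT (mat 1) f = f"
  by (auto simp: right_translation_SL fun_eq_iff E_outside)

lemma complex_rep_E: "complex_rep (SL UNIV) (pointwise_scale sc) E RT"
proof (intro complex_rep.intro complex_rep_axioms.intro)
  show "vector_space (pointwise_scale sc :: complex \<Rightarrow> ('f ^ 'n ^ 'n \<Rightarrow> 'v) \<Rightarrow> _)"
    by unfold_locales
qed (auto simp: group_SL E_subspace E_RT RT_add RT_scale RT_1 right_translation_mult)

lemma smooth_rep_E: "smooth_rep (SL UNIV) (SL_topology nm) (pointwise_scale sc) E RT"
proof -
  have "\<exists>U. open_subgroup (SL UNIV) (SL_topology nm) U \<and> (\<forall>u\<in>U. RT u f = f)" if f: "f \<in> E" for f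
  proof -
    obtain m where "\<And>u x. u \<in> cong_sub m \<Longrightarrow> det x = 1 \<Longrightarrow> f (x ** u) = f x"
      using E_right[OF f] by blast
    then have "\<forall>u\<in>cong_sub m. RT u f = f"
      using f by (auto simp: right_translation_SL fun_eq_iff E_outside)
    then show ?thesis
      using open_subgroup_cong_sub by blast
  qed
  then show ?thesis
    by (simp add: smooth_rep_def complex_rep_E)
qed

text \<open>The canonical embedding of \<open>V\<close> into the induced space.\<close>

definition ind_fun :: "'v \<Rightarrow> 'f ^ 'n ^ 'n \<Rightarrow> 'v" where
  "ind_fun v = (\<lambda>x. if x \<in> cong_sub 0 then \<sigma> x v else 0)"

lemma cong_sub_0_mult_iff:
  assumes "k \<in> cong_sub 0"
  shows "k ** x \<in> cong_sub 0 \<longleftrightarrow> x \<in> cong_sub 0" "x ** k \<in> cong_sub 0 \<longleftrightarrow> x \<in> cong_sub 0"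
proof -
  obtain k' where k': "k ** k' = mat 1" "k' ** k = mat 1" "k' \<in> cong_sub 0"
    using assms by (auto simp: cong_sub_0_iff elim: slint_inverse)
  have "x = k' ** (k ** x)" "x = (x ** k) ** k'"
    by (simp_all add: matrix_mul_assoc k') (simp add: k' flip: matrix_mul_assoc)
  then show "k ** x \<in> cong_sub 0 \<longleftrightarrow> x \<in> cong_sub 0" "x ** k \<in> cong_sub 0 \<longleftrightarrow> x \<in> cong_sub 0"
    using assms k'(3) cong_sub_mult by metis+
qed

lemma ind_fun_E: "v \<in> V \<Longrightarrow> ind_fun v \<in> E"
proof -
  assume v: "v \<in> V"
  have "\<forall>x. det x \<noteq> 1 \<longrightarrow> ind_fun v x = 0"
    using cong_sub_det by (auto simp: ind_fun_def)
  moreover have "\<forall>x. det x = 1 \<longrightarrow> ind_fun v x \<in> V"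
    using v by (auto simp: ind_fun_def \<sigma>_closed subspace_0[OF V])
  moreover have "\<forall>k\<in>cong_sub 0. \<forall>x. det x = 1 \<longrightarrow> ind_fun v (k ** x) = \<sigma> k (ind_fun v x)"
    using v by (auto simp: ind_fun_def cong_sub_0_mult_iff \<sigma>_mult \<sigma>_0)
  moreover have "\<forall>u\<in>cong_sub r. \<forall>x. det x = 1 \<longrightarrow> ind_fun v (x ** u) = ind_fun v x"
    using v cong_sub_imp_cong_sub_0[of _ r] by (auto simp: ind_fun_def cong_sub_0_mult_iff \<sigma>_mult \<sigma>_trivial)
  moreover have "\<forall>x. det x = 1 \<longrightarrow> ind_fun v x \<noteq> 0 \<longrightarrow> mint x"
    using cong_sub_mint by (auto simp: ind_fun_def)
  ultimately show ?thesis
    unfolding E_iff by blast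
qed

lemma ind_fun_1: "v \<in> V \<Longrightarrow> ind_fun v (mat 1) = v"
  by (simp add: ind_fun_def cong_sub_1 \<sigma>_1)

lemma RT_ind_fun: "k \<in> cong_sub 0 \<Longrightarrow> v \<in> V \<Longrightarrow> RT k (ind_fun v) = ind_fun (\<sigma> k v)"
  using cong_sub_det[of _ 0] by (auto simp: fun_eq_iff right_translation_SL ind_fun_def cong_sub_0_mult_iff \<sigma>_mult)

lemma ind_fun_add: "v \<in> V \<Longrightarrow> w \<in> V \<Longrightarrow> ind_fun (v + w) = ind_fun v + ind_fun w"
  by (auto simp: fun_eq_iff ind_fun_def \<sigma>_add)

lemma ind_fun_scale: "v \<in> V \<Longrightarrow> ind_fun (sc c v) = pointwise_scale sc c (ind_fun v)"
  by (auto simp: fun_eq_iff ind_fun_def \<sigma>_scale pointwise_scale_def)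

lemma ind_fun_0: "ind_fun 0 = 0"
  by (auto simp: fun_eq_iff ind_fun_def \<sigma>_0)

lemma supported_on_cong_sub_0:
  assumes f: "f \<in> E" and supp: "\<And>x. det x = 1 \<Longrightarrow> f x \<noteq> 0 \<Longrightarrow> x \<in> cong_sub 0"
  shows "f = ind_fun (f (mat 1))"
proof
  fix x
  show "f x = ind_fun (f (mat 1)) x"
  proof (cases "x \<in> cong_sub 0")
    case True
    then show ?thesis
      using E_left[OF f True, of "mat 1"] by (simp add: ind_fun_def)
  next
    case False
    then show ?thesis
      using supp[of x] E_outside[OF f, of x] by (auto simp: ind_fun_def)
  qed
qed

text \<open>In determinant 1, Cramer's rule turns a bound for an element into one for its inverse;
  support conditions can therefore be stated for either.\<close>

lemma inverse_bounded:
  assumes "det (A :: 'f ^ 'n ^ 'n) = 1" "mbd R A" "1 \<le> R" "A ** A' = mat 1 \<or> A' ** A = mat 1"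
  shows "mbd (R ^ CARD('n)) A'"
proof -
  obtain A'' where "A ** A'' = mat 1" "A'' ** A = mat 1" "mbd (R ^ CARD('n) / nm (det A)) A''"
    using inverse_mbd[OF assms(2,3)] assms(1) by (metis one_neq_zero)
  then show ?thesis
    using assms(1,4) inverse_unique_matrix by (metis div_by_1 nm_1)
qed

text \<open>A function is the sum of its restrictions to the cosets of \<open>cong_sub 0\<close> in
  its support, and each restriction is a translate of some \<open>ind_fun\<close>. Only finitely
  many cosets occur, since close points of a bounded set share a coset.\<close>

lemma E_generated:
  assumes W: "fun_space.subspace W" and stable: "\<And>g f. det g = 1 \<Longrightarrow> f \<in> W \<Longrightarrow> RT g f \<in> W"
    and ind: "\<And>v. v \<in> V \<Longrightarrow> ind_fun v \<in> W"
  shows "E \<subseteq> W"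
proof
  fix f assume f: "f \<in> E"
  obtain R where R: "1 \<le> R" "\<And>x. det x = 1 \<Longrightarrow> f x \<noteq> 0 \<Longrightarrow> mbd R x"
    using E_support[OF f] by blast
  define S where "S = {x. det x = 1 \<and> f x \<noteq> 0}"
  define iv :: "'f ^ 'n ^ 'n \<Rightarrow> 'f ^ 'n ^ 'n" where "iv x = (SOME y. x ** y = mat 1 \<and> y ** x = mat 1 \<and> det y = 1)" for x
  have iv: "x ** iv x = mat 1" "iv x ** x = mat 1" "det (iv x) = 1" if "det x = 1" for x
    using someI_ex[of "\<lambda>y. x ** y = mat 1 \<and> y ** x = mat 1 \<and> det y = 1"] det_1_inverse[OF that]
    unfolding iv_def by blast+
  define coset where "coset x y \<longleftrightarrow> (\<exists>k\<in>cong_sub 0. x = k ** y)" for x y :: "'f ^ 'n ^ 'n"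
  have inv: "\<exists>k'\<in>cong_sub 0. k' ** k = mat 1" if "k \<in> cong_sub 0" for k :: "'f ^ 'n ^ 'n"
    using that slint_inverse[of k] unfolding cong_sub_0_iff Bex_def by metis
  have "equivp coset"
  proof (rule equivpI)
    show "reflp coset"
      using cong_sub_1 by (auto simp: reflp_def coset_def intro!: bexI[of _ "mat 1"])
    show "symp coset"
    proof (rule sympI)
      fix x y assume "coset x y"
      then obtain k where k: "k \<in> cong_sub 0" "x = k ** y"
        by (auto simp: coset_def)
      obtain k' where "k' \<in> cong_sub 0" "k' ** k = mat 1"
        using inv k(1) by blast
      then have "y = k' ** x"
        by (simp add: k(2) matrix_mul_assoc)
      then show "coset y x"
        using \<open>k' \<in> cong_sub 0\<close> by (auto simp: coset_def)
    qed
    show "transp coset"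
      unfolding transp_def coset_def using cong_sub_mult by (metis matrix_mul_assoc)
  qed
  have coset_iff: "coset x y \<longleftrightarrow> x ** iv y \<in> cong_sub 0" if "det y = 1" for x y
  proof
    assume "coset x y"
    then show "x ** iv y \<in> cong_sub 0"
      using iv(1)[OF that] by (auto simp: coset_def simp flip: matrix_mul_assoc)
  next
    assume *: "x ** iv y \<in> cong_sub 0"
    have "x = (x ** iv y) ** y"
      by (simp add: iv(2)[OF that] flip: matrix_mul_assoc)
    then show "coset x y"
      using * by (auto simp: coset_def)
  qed
  \<comment> \<open>Here \<open>x ** iv y - mat 1 = (x - y) ** iv y\<close>, so the radius
    compensates the Cramer bound for \<open>iv y\<close>.\<close>
  have "coset x y" if "x \<in> S" "y \<in> S" "mbd (1 / R ^ CARD('n)) (x - y)" for x y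
  proof -
    have y: "det y = 1" "det x = 1"
      using that by (auto simp: S_def)
    have "mbd (R ^ CARD('n)) (iv y)"
      using y(1) that(2) R iv(1) by (intro inverse_bounded[of y]) (auto simp: S_def)
    from mbd_mult[OF that(3) this] have "mint (x ** iv y - mat 1)"
      using R(1) by (simp add: matrix_diff_rdistrib iv(1)[OF y(1)])
    then show ?thesis
      using y iv(3) by (simp add: coset_iff cong_sub_def det_mul)
  qed
  moreover have "0 < 1 / R ^ CARD('n)"
    using R(1) by simp
  ultimately have "\<exists>T. finite T \<and> T \<subseteq> S \<and> (\<forall>A\<in>S. \<exists>B\<in>T. coset A B) \<and>
      (\<forall>A\<in>T. \<forall>B\<in>T. coset A B \<longrightarrow> A = B)"
    using R(2) by (intro ex_finite_transversal[of S R "1 / R ^ CARD('n)" coset] \<open>equivp coset\<close>) (auto simp: S_def)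
  then obtain T where T: "finite T" "T \<subseteq> S" "\<forall>x\<in>S. \<exists>y\<in>T. coset x y"
    "\<forall>x\<in>T. \<forall>y\<in>T. coset x y \<longrightarrow> x = y"
    by (elim exE conjE) (rule that)
  have det_T: "det y = 1" if "y \<in> T" for y
    using that T(2) by (auto simp: S_def)
  \<comment> \<open>The translate by the inverse of \<open>y\<close> is exactly \<open>f\<close> cut
    down to the coset of \<open>y\<close>.\<close>
  have summand: "RT (iv y) (ind_fun (f y)) x = (if coset x y then f x else 0)"
    if "y \<in> T" "det x = 1" for x y
  proof -
    have "\<sigma> (x ** iv y) (f y) = f x" if "x ** iv y \<in> cong_sub 0"
      using E_left[OF f that det_T[OF \<open>y \<in> T\<close>]] iv(2)[OF det_T[OF \<open>y \<in> T\<close>]]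
      by (simp flip: matrix_mul_assoc)
    then show ?thesis
      using that det_T by (auto simp: right_translation_SL ind_fun_def coset_iff)
  qed
  have "f x = (\<Sum>y\<in>T. RT (iv y) (ind_fun (f y))) x" for x
  proof (cases "x \<in> S")
    case True
    then obtain y where y: "y \<in> T" "coset x y"
      using T(3) by blast
    have "coset x z \<longleftrightarrow> z = y" if "z \<in> T" for z
      using y that T(4) \<open>equivp coset\<close> unfolding equivp_def by metis
    then have "(\<Sum>z\<in>T. RT (iv z) (ind_fun (f z)) x) = (\<Sum>z\<in>T. if z = y then f x else 0)"
      using True by (intro sum.cong) (auto simp: summand S_def)
    then show ?thesis
      using y(1) T(1) by (simp add: sum_fun_apply)
  next
    case False
    then have f0: "f x = 0"
      using E_outside[OF f, of x] by (auto simp: S_def)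
    have "RT (iv y) (ind_fun (f y)) x = 0" if "y \<in> T" for y
      using summand[OF that, of x] f0 by (cases "det x = 1") (simp_all add: right_translation_SL)
    then show ?thesis
      by (simp add: f0 sum_fun_apply)
  qed
  then have "f = (\<Sum>y\<in>T. RT (iv y) (ind_fun (f y)))"
    by blast
  also have "\<dots> \<in> W"
    by (intro fun_space.subspace_sum[OF W] stable ind E_V[OF f] iv(3) det_T)
  finally show "f \<in> W" .
qed

text \<open>Nothing is assumed of \<open>\<theta>\<close> itself as a function; that it is a
  character is read off from its action on the nonzero vector \<open>v0\<close>, here and in the
  next two lemmas.\<close>

lemma \<theta>_nz: "k \<in> cong_sub l \<Longrightarrow> \<theta> k \<noteq> 0"
proof
  assume k: "k \<in> cong_sub l" "\<theta> k = 0"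
  then have "slint k"
    using cong_sub_imp_cong_sub_0 cong_sub_0_iff by blast
  then obtain k' where k': "k' ** k = mat 1" "k' \<in> cong_sub 0"
    by (auto simp: cong_sub_0_iff elim: slint_inverse)
  have "v0 = \<sigma> k' (\<sigma> k v0)"
    using \<sigma>_mult[OF k'(2) cong_sub_imp_cong_sub_0[OF k(1)] v0(1)] by (simp add: k' \<sigma>_1 v0)
  then show False
    using k v0 k' by (simp add: \<sigma>_0)
qed

lemma \<theta>_mult: "k \<in> cong_sub l \<Longrightarrow> k' \<in> cong_sub l \<Longrightarrow> \<theta> (k ** k') = \<theta> k * \<theta> k'"
proof -
  assume k: "k \<in> cong_sub l" "k' \<in> cong_sub l"
  have "sc (\<theta> (k ** k')) v0 = \<sigma> k (\<sigma> k' v0)"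
    using k by (simp add: \<sigma>_mult cong_sub_imp_cong_sub_0 v0 cong_sub_mult flip: v0(3))
  also have "\<dots> = sc (\<theta> k * \<theta> k') v0"
    using k by (simp add: v0 \<sigma>_scale cong_sub_imp_cong_sub_0 mult.commute)
  finally show ?thesis
    using v0(2) by simp
qed

lemma \<theta>_trivial: "k \<in> cong_sub l \<Longrightarrow> k \<in> cong_sub r \<Longrightarrow> \<theta> k = 1"
  using v0(3)[of k] \<sigma>_trivial[of k v0] v0 scale_cancel_right[of "\<theta> k" v0 1] by simp

text \<open>The projection to the eigenspace is a finite sum: the function is fixed by some
  \<open>cong_sub M\<close>, so only classes of \<open>cong_sub l\<close> modulo
  \<open>\<pi> ^ M\<close> count. Once the projected function is supported on
  \<open>cong_sub 0\<close>, irreducibility of \<open>\<sigma>\<close> produces all of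
  \<open>V\<close>, and \<open>E_generated\<close> the whole space.\<close>

lemma irreducible_E: "irreducible_rep (SL UNIV) (pointwise_scale sc) E RT"
proof -
  have "W = E" if W: "fun_space.subspace W" "W \<subseteq> E" and stable: "\<And>g f. det g = 1 \<Longrightarrow> f \<in> W \<Longrightarrow> RT g f \<in> W"
    and nonzero: "W \<noteq> {0}" for W
  proof -
    have "\<exists>f\<in>W. f \<noteq> 0"
      using nonzero fun_space.subspace_0[OF W(1)] by auto
    then obtain f x where f: "f \<in> W" "f x \<noteq> 0"
      by (auto simp: fun_eq_iff)
    then have x: "det x = 1"
      using E_outside W(2) by blast
    define f1 where "f1 = RT x f"
    have f1: "f1 \<in> W" "f1 \<in> E" "f1 (mat 1) \<noteq> 0"
      using f x stable W(2) by (auto simp: f1_def right_translation_SL)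
    \<comment> \<open>\<open>M\<close> is at least \<open>l\<close> and \<open>r\<close>, so that
      \<open>\<theta>\<close> is trivial on \<open>cong_sub M\<close> and the choice of
      representatives modulo \<open>\<pi> ^ M\<close> does not matter.\<close>
    obtain M where M: "max l r \<le> M" "\<And>u x. u \<in> cong_sub M \<Longrightarrow> det x = 1 \<Longrightarrow> f1 (x ** u) = f1 x"
      using E_right[OF f1(2)] by blast
    have "\<exists>T. finite T \<and> T \<subseteq> cong_sub l \<and> (\<forall>A\<in>cong_sub l. \<exists>B\<in>T. mbd (nm \<pi> ^ M) (A - B)) \<and>
        (\<forall>A\<in>T. \<forall>B\<in>T. mbd (nm \<pi> ^ M) (A - B) \<longrightarrow> A = (B :: 'f ^ 'n ^ 'n))"
      using q_pos by (intro ex_finite_transversal[where R = 1] equivp_mbd) (auto simp: cong_sub_mint)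
    then obtain T where T: "finite T" "T \<subseteq> (cong_sub l :: ('f ^ 'n ^ 'n) set)"
      "\<forall>A\<in>cong_sub l. \<exists>B\<in>T. mbd (nm \<pi> ^ M) (A - B)"
      "\<forall>A\<in>T. \<forall>B\<in>T. mbd (nm \<pi> ^ M) (A - B) \<longrightarrow> A = B"
      by (elim exE conjE) (rule that)
    have T0: "t \<in> cong_sub 0" if "t \<in> T" for t
      using T(2) that cong_sub_imp_cong_sub_0 by blast
    define P where "P v = (\<Sum>t\<in>T. sc (inverse (\<theta> t)) (\<sigma> t v))" for v
    have P_add: "P (v + w) = P v + P w" if "v \<in> V" "w \<in> V" for v w
      using that by (simp add: P_def \<sigma>_add T0 scale_right_distrib sum.distrib)
    have P_scale: "P (sc c v) = sc c (P v)" if "v \<in> V" for c v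
      using that by (simp add: P_def \<sigma>_scale T0 scale_sum_right mult.commute)
    have "P v0 = (\<Sum>t\<in>T. v0)"
      unfolding P_def using T(2) \<theta>_nz by (intro sum.cong) (auto simp: v0(3) subset_iff)
    also have "\<dots> = sc (of_nat (card T)) v0"
      by (simp add: sum_constant_scale)
    finally have "P v0 \<noteq> 0"
      using T(1,3) cong_sub_1[of l] v0(2) by auto
    \<comment> \<open>\<open>P\<close> may annihilate the value of \<open>f1\<close> at 1, so
      \<open>f1\<close> is first moved by a suitable \<open>k\<close>. The vectors for which every
      \<open>k\<close> fails form a stable subspace that misses \<open>v0\<close>, because
      \<open>P v0\<close> is \<open>card T\<close> times \<open>v0\<close>; hence it is
      zero.\<close>
    define K where "K = {v \<in> V. \<forall>k\<in>cong_sub 0. P (\<sigma> k v) = 0}"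
    have "subspace K"
    proof (rule subspaceI)
      show "0 \<in> K"
        using P_scale[of 0 0] subspace_0[OF V] by (simp add: K_def \<sigma>_0)
      show "v + w \<in> K" if "v \<in> K" "w \<in> K" for v w
        using that by (auto simp: K_def \<sigma>_add P_add \<sigma>_closed subspace_add[OF V])
      show "sc c v \<in> K" if "v \<in> K" for c v
        using that by (auto simp: K_def \<sigma>_scale P_scale \<sigma>_closed subspace_scale[OF V])
    qed
    moreover have "\<sigma> k w \<in> K" if "k \<in> cong_sub 0" "w \<in> K" for k w
      using that by (auto simp: K_def \<sigma>_closed cong_sub_mult simp flip: \<sigma>_mult)
    moreover have "K \<subseteq> V"
      by (auto simp: K_def)
    moreover have "v0 \<notin> K"
    proof
      assume "v0 \<in> K"
      then have "P (\<sigma> (mat 1) v0) = 0"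
        unfolding K_def using cong_sub_1 by blast
      then show False
        using \<open>P v0 \<noteq> 0\<close> \<sigma>_1[OF v0(1)] by simp
    qed
    ultimately have "K = {0}"
      using \<sigma>_irreducible[of K] v0(1) by blast
    moreover have v: "f1 (mat 1) \<in> V"
      using E_V[OF f1(2)] by simp
    ultimately obtain k where k: "k \<in> cong_sub 0" "P (\<sigma> k (f1 (mat 1))) \<noteq> 0"
      using f1(3) by (auto simp: K_def)
    obtain k' where k': "k ** k' = mat 1" "k' ** k = mat 1" "k' \<in> cong_sub 0"
      using k(1) by (auto simp: cong_sub_0_iff elim: slint_inverse)
    define f2 where "f2 = RT k f1"
    have f2: "f2 \<in> W" "f2 \<in> E"
      using f1 stable W(2) cong_sub_det[OF k(1)] by (auto simp: f2_def)
    \<comment> \<open>The level \<open>M\<close> survives this translation because \<open>k\<close>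
      and its inverse are integral, so conjugation by them preserves
      \<open>cong_sub M\<close>.\<close>
    have f2_M: "f2 (x ** u) = f2 x" if "u \<in> cong_sub M" "det x = 1" for u x
    proof -
      have "k' ** u ** k \<in> cong_sub M"
        using k' k(1) that(1) cong_sub_mint by (intro cong_sub_conj) blast+
      moreover have "x ** u ** k = (x ** k) ** (k' ** u ** k)"
        by (metis k'(1) matrix_mul_assoc matrix_mul_rid)
      ultimately have "f1 (x ** u ** k) = f1 (x ** k)"
        using M(2)[of "k' ** u ** k" "x ** k"] that(2) cong_sub_det[OF k(1)] by (simp add: det_mul)
      then show ?thesis
        using that cong_sub_det[OF that(1)] by (simp add: f2_def right_translation_SL det_mul)
    qed
    have f2_1: "f2 (mat 1) = \<sigma> k (f1 (mat 1))"
      using E_left[OF f1(2) k(1), of "mat 1"] by (simp add: f2_def right_translation_SL)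
    \<comment> \<open>Projection of \<open>f2\<close> to the \<open>\<theta>\<close>-eigenspace of \<open>cong_sub l\<close>, up to a factor.\<close>
    define f3 where "f3 = (\<Sum>t\<in>T. pointwise_scale sc (inverse (\<theta> t)) (RT t f2))"
    have f3_W: "f3 \<in> W"
      unfolding f3_def using cong_sub_det[OF T0] f2(1)
      by (intro fun_space.subspace_sum[OF W(1)] fun_space.subspace_scale[OF W(1)] stable)
    then have f3_E: "f3 \<in> E"
      using W(2) by blast
    have f3_eq: "f3 x = (\<Sum>t\<in>T. sc (inverse (\<theta> t)) (f2 (x ** t)))" if "det x = 1" for x
      using that by (simp add: f3_def sum_fun_apply pointwise_scale_def right_translation_SL)
    have "f2 t = \<sigma> t (f2 (mat 1))" if "t \<in> T" for t
      using E_left[OF f2(2) T0[OF that], of "mat 1"] by simp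
    then have "f3 (mat 1) = P (\<sigma> k (f1 (mat 1)))"
      by (simp add: f3_eq P_def f2_1)
    then have f3_1: "f3 (mat 1) \<noteq> 0"
      using k(2) by simp
    have f3_\<theta>: "f3 (x ** h) = sc (\<theta> h) (f3 x)" if h: "h \<in> cong_sub l" and x: "det x = 1" for h x
    proof -
      \<comment> \<open>Left multiplication by \<open>h\<close> permutes the classes modulo
        \<open>\<pi> ^ M\<close>, hence the representatives; this takes the place of invariance of
        Haar measure.\<close>
      have "\<forall>t\<in>T. \<exists>s\<in>T. mbd (nm \<pi> ^ M) (h ** t - s)"
        using T(2,3) h cong_sub_mult by blast
      then obtain \<phi> where \<phi>: "\<And>t. t \<in> T \<Longrightarrow> \<phi> t \<in> T" "\<And>t. t \<in> T \<Longrightarrow> mbd (nm \<pi> ^ M) (h ** t - \<phi> t)"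
        by metis
      obtain h' where h': "h' ** h = mat 1" "h' \<in> cong_sub 0"
        using cong_sub_imp_cong_sub_0[OF h] by (auto simp: cong_sub_0_iff elim: slint_inverse)
      have "inj_on \<phi> T"
      proof (rule inj_onI)
        fix s t assume st: "s \<in> T" "t \<in> T" "\<phi> s = \<phi> t"
        have "mbd (nm \<pi> ^ M) ((h ** s - \<phi> s) - (h ** t - \<phi> t))"
          by (intro mbd_diff[of _ "h ** s - \<phi> s" "h ** t - \<phi> t"] \<phi> st)
        then have "mbd (nm \<pi> ^ M) (h ** s - h ** t)"
          by (simp add: st(3))
        from mbd_mult[OF cong_sub_mint[OF h'(2)] this] have "mbd (nm \<pi> ^ M) (s - t)"
          by (simp add: matrix_diff_ldistrib matrix_mul_assoc h')
        then show "s = t"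
          using T(4) st by blast
      qed
      then have bij: "bij_betw \<phi> T T"
        using T(1) \<phi>(1) by (simp add: bij_betw_def endo_inj_surj image_subsetI)
      have step: "sc (inverse (\<theta> t)) (f2 (x ** h ** t)) =
          sc (\<theta> h) (sc (inverse (\<theta> (\<phi> t))) (f2 (x ** \<phi> t)))" if t: "t \<in> T" for t
      proof -
        have tl: "t \<in> cong_sub l" "\<phi> t \<in> cong_sub l" "h ** t \<in> cong_sub l"
          using t \<phi>(1)[OF t] T(2) h cong_sub_mult by blast+
        obtain s where s: "\<phi> t ** s = mat 1" "s ** \<phi> t = mat 1" "s \<in> cong_sub 0"
          using cong_sub_imp_cong_sub_0[OF tl(2)] by (auto simp: cong_sub_0_iff elim: slint_inverse)
        define u where "u = s ** (h ** t)"
        have "u - mat 1 = s ** (h ** t - \<phi> t)"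
          by (simp add: u_def matrix_diff_ldistrib s)
        then have "mbd (nm \<pi> ^ M) (u - mat 1)"
          using mbd_mult[OF cong_sub_mint[OF s(3)] \<phi>(2)[OF t]] by simp
        then have u: "u \<in> cong_sub M"
          using cong_sub_det[OF s(3)] cong_sub_det[OF tl(3)] by (simp add: cong_sub_def u_def det_mul)
        have ht: "h ** t = \<phi> t ** u"
          by (simp add: u_def matrix_mul_assoc s)
        have "u \<in> cong_sub l" "u \<in> cong_sub r"
          using u M(1) cong_sub_antimono[of l M] cong_sub_antimono[of r M] by auto
        then have "\<theta> (\<phi> t) = \<theta> h * \<theta> t"
          using \<theta>_mult[OF tl(2), of u] \<theta>_mult[OF h tl(1)] \<theta>_trivial[of u] by (simp add: ht)
        moreover have "f2 (x ** h ** t) = f2 (x ** \<phi> t)"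
          using f2_M[OF u, of "x ** \<phi> t"] x cong_sub_det[OF tl(2)]
          by (simp add: det_mul ht flip: matrix_mul_assoc)
        ultimately show ?thesis
          using \<theta>_nz[OF h] by simp
      qed
      have "f3 (x ** h) = (\<Sum>t\<in>T. sc (\<theta> h) (sc (inverse (\<theta> (\<phi> t))) (f2 (x ** \<phi> t))))"
        using x cong_sub_det[OF h] step by (simp add: f3_eq det_mul)
      also have "\<dots> = (\<Sum>t\<in>T. sc (\<theta> h) (sc (inverse (\<theta> t)) (f2 (x ** t))))"
        using sum.reindex_bij_betw[OF bij, of "\<lambda>t. sc (\<theta> h) (sc (inverse (\<theta> t)) (f2 (x ** t)))"] .
      finally show ?thesis
        using x by (simp add: f3_eq scale_sum_right)
    qed
    \<comment> \<open>If \<open>x ** h ** x'\<close> has level \<open>r\<close>, it acts trivially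
      on the value at \<open>x\<close> from the left, while \<open>h\<close> acts from the right by
      \<open>\<theta> h\<close>. A nonzero value forces \<open>\<theta> h = 1\<close>, and
      \<open>rigid\<close> applies to the inverse of \<open>x\<close>.\<close>
    have "x \<in> cong_sub 0" if x: "det x = 1" "f3 x \<noteq> 0" for x
    proof -
      obtain x' where x': "x ** x' = mat 1" "x' ** x = mat 1" "det x' = 1"
        using det_1_inverse[OF x(1)] by blast
      have "\<theta> h = 1" if h: "h \<in> cong_sub l" "x ** h ** x' \<in> cong_sub r" for h
      proof -
        have "x ** h = (x ** h ** x') ** x"
          by (metis x'(2) matrix_mul_assoc matrix_mul_rid)
        then have "f3 (x ** h) = \<sigma> (x ** h ** x') (f3 x)"
          using E_left[OF f3_E cong_sub_imp_cong_sub_0[OF h(2)] x(1)] by simp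
        also have "\<dots> = f3 x"
          using \<sigma>_trivial[OF h(2)] E_V[OF f3_E x(1)] by blast
        finally have "sc (\<theta> h) (f3 x) = sc 1 (f3 x)"
          using f3_\<theta>[OF h(1) x(1)] by simp
        then show ?thesis
          using x(2) scale_cancel_right by blast
      qed
      then have "x' \<in> cong_sub 0"
        using rigid[OF x'(3,2)] by blast
      then show ?thesis
        using cong_sub_inverse x'(2) by blast
    qed
    then have f3_ind: "f3 = ind_fun (f3 (mat 1))"
      using supported_on_cong_sub_0[OF f3_E] by blast
    define L where "L = {v \<in> V. ind_fun v \<in> W}"
    have "subspace L"
    proof (rule subspaceI)
      show "0 \<in> L"
        using fun_space.subspace_0[OF W(1)] subspace_0[OF V] by (simp add: L_def ind_fun_0)
      show "v + w \<in> L" if "v \<in> L" "w \<in> L" for v w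
        using that by (auto simp: L_def ind_fun_add subspace_add[OF V] fun_space.subspace_add[OF W(1)])
      show "sc c v \<in> L" if "v \<in> L" for c v
        using that by (auto simp: L_def ind_fun_scale subspace_scale[OF V] fun_space.subspace_scale[OF W(1)])
    qed
    moreover have "\<sigma> k w \<in> L" if "k \<in> cong_sub 0" "w \<in> L" for k w
      using that cong_sub_det[OF that(1)] stable by (auto simp: L_def \<sigma>_closed simp flip: RT_ind_fun)
    moreover have "f3 (mat 1) \<in> L"
      using f3_ind f3_W E_V[OF f3_E, of "mat 1"] by (simp add: L_def)
    ultimately have "L = V"
      using \<sigma>_irreducible[of L] f3_1 by (auto simp: L_def)
    then have "E \<subseteq> W"
      by (intro E_generated[OF W(1) stable]) (auto simp: L_def)
    then show ?thesis
      using W(2) by blast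
  qed
  moreover have "E \<noteq> {0}"
  proof -
    have "ind_fun v0 \<noteq> 0"
      using ind_fun_1[OF v0(1)] v0(2) by (metis zero_fun_apply)
    then show ?thesis
      using ind_fun_E[OF v0(1)] by blast
  qed
  ultimately show ?thesis
    unfolding irreducible_rep_def using complex_rep_E by simp blast
qed

text \<open>Since \<open>irreducible_E\<close> is available, bounded coefficients have to be
  verified for a single nonzero vector. The level \<open>m\<close> at which the functional is fixed
  is taken at least \<open>r\<close>, where \<open>bounded\<close> applies.\<close>

lemma supercuspidal_E: "supercuspidal_rep (SL UNIV) (SL_topology nm) (pointwise_scale sc) E RT"
proof -
  have "\<exists>C. compactin (SL_topology nm) C \<and>
      {g \<in> carrier (SL UNIV). \<phi> (RT g f) \<noteq> 0} \<subseteq> group_center (SL UNIV) <#>\<^bsub>SL UNIV\<^esub> C"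
    if f: "f \<in> E" and \<phi>: "\<phi> \<in> smooth_dual (SL UNIV) (SL_topology nm) (pointwise_scale sc) E RT" for f \<phi>
  proof -
    have \<phi>_add: "\<And>f g. f \<in> E \<Longrightarrow> g \<in> E \<Longrightarrow> \<phi> (f + g) = \<phi> f + \<phi> g"
      and \<phi>_scale: "\<And>c f. f \<in> E \<Longrightarrow> \<phi> (pointwise_scale sc c f) = c * \<phi> f"
      using \<phi> by (auto simp: smooth_dual_def)
    obtain U where U: "open_subgroup (SL UNIV) (SL_topology nm) U"
      "\<And>u f. u \<in> U \<Longrightarrow> f \<in> E \<Longrightarrow> \<phi> (RT u f) = \<phi> f"
      using \<phi> by (auto simp: smooth_dual_def)
    obtain m where m: "r \<le> m" "cong_sub m \<subseteq> U"
      using open_subgroupE[OF U(1)] by blast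
    define W where "W = {f \<in> E. \<exists>R\<ge>1. \<forall>g. det g = 1 \<longrightarrow> \<phi> (RT g f) \<noteq> 0 \<longrightarrow> mbd R g}"
    have "fun_space.subspace W"
    proof (rule fun_space.subspaceI)
      have "\<phi> 0 = 0"
        using \<phi>_scale[OF fun_space.subspace_0[OF E_subspace], of 0] by simp
      moreover have "RT g 0 = 0" for g
        by (simp add: right_translation_SL fun_eq_iff)
      ultimately show "0 \<in> W"
        using fun_space.subspace_0[OF E_subspace] by (auto simp: W_def)
    next
      fix f1 f2 assume f: "f1 \<in> W" "f2 \<in> W"
      then have E: "f1 \<in> E" "f2 \<in> E"
        by (auto simp: W_def)
      obtain R where R: "R \<ge> 1" "\<And>g. det g = 1 \<Longrightarrow> \<phi> (RT g f1) \<noteq> 0 \<Longrightarrow> mbd R g"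
        using f(1) by (auto simp: W_def)
      obtain S where S: "S \<ge> 1" "\<And>g. det g = 1 \<Longrightarrow> \<phi> (RT g f2) \<noteq> 0 \<Longrightarrow> mbd S g"
        using f(2) by (auto simp: W_def)
      have "mbd (max R S) g" if g: "det g = 1" "\<phi> (RT g (f1 + f2)) \<noteq> 0" for g
      proof (cases "\<phi> (RT g f1) = 0")
        case True
        then have "\<phi> (RT g f2) \<noteq> 0"
          using g E by (simp add: RT_add \<phi>_add E_RT)
        then show ?thesis
          using S(2)[OF g(1)] by (auto elim: mbd_mono)
      next
        case False
        then show ?thesis
          using R(2)[OF g(1)] by (auto elim: mbd_mono)
      qed
      then show "f1 + f2 \<in> W"
        using R(1) fun_space.subspace_add[OF E_subspace E] by (auto simp: W_def intro!: exI[of _ "max R S"])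
    next
      fix c f1 assume f: "f1 \<in> W"
      then have E: "f1 \<in> E"
        by (auto simp: W_def)
      obtain R where R: "R \<ge> 1" "\<And>g. det g = 1 \<Longrightarrow> \<phi> (RT g f1) \<noteq> 0 \<Longrightarrow> mbd R g"
        using f by (auto simp: W_def)
      have "\<forall>g. det g = 1 \<longrightarrow> \<phi> (RT g (pointwise_scale sc c f1)) \<noteq> 0 \<longrightarrow> mbd R g"
        using R(2) E by (auto simp: RT_scale \<phi>_scale E_RT)
      then show "pointwise_scale sc c f1 \<in> W"
        using R(1) fun_space.subspace_scale[OF E_subspace E] by (auto simp: W_def)
    qed
    moreover have "RT h f1 \<in> W" if h: "det h = 1" and f1: "f1 \<in> W" for h f1
    proof -
      obtain R where R: "R \<ge> 1" "\<And>g. det g = 1 \<Longrightarrow> \<phi> (RT g f1) \<noteq> 0 \<Longrightarrow> mbd R g"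
        using f1 by (auto simp: W_def)
      obtain h' where h': "h ** h' = mat 1"
        using det_1_inverse[OF h] by blast
      obtain S where S: "1 \<le> S" "mbd S h'"
        using mbd_exists by blast
      have "mbd (R * S) g" if g: "det g = 1" "\<phi> (RT g (RT h f1)) \<noteq> 0" for g
      proof -
        have "mbd R (g ** h)"
          using g h by (intro R(2)) (auto simp: det_mul right_translation_mult)
        then have "mbd (R * S) (g ** h ** h')"
          using S(2) by (rule mbd_mult)
        then show ?thesis
          by (simp add: h' flip: matrix_mul_assoc)
      qed
      moreover have "1 \<le> R * S"
        using R(1) S(1) mult_mono[of 1 R 1 S] by simp
      moreover have "RT h f1 \<in> E"
        using f1 h by (simp add: W_def E_RT)
      ultimately show ?thesis
        unfolding W_def by blast
    qed
    moreover have "ind_fun v0 \<in> W"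
    proof -
      obtain R0 where R0: "\<And>g g'. det g = 1 \<Longrightarrow> g ** g' = mat 1 \<Longrightarrow>
          (\<And>h. h \<in> cong_sub l \<Longrightarrow> g' ** h ** g \<in> cong_sub m \<Longrightarrow> \<theta> h = 1) \<Longrightarrow> mbd R0 g"
        using bounded[OF m(1)] by blast
      define R where "R = max 1 R0"
      have f0: "ind_fun v0 \<in> E"
        by (rule ind_fun_E[OF v0(1)])
      have "mbd (R ^ CARD('n)) g" if g: "det g = 1" "\<phi> (RT g (ind_fun v0)) \<noteq> 0" for g
      proof -
        obtain g' where g': "g ** g' = mat 1" "g' ** g = mat 1" "det g' = 1"
          using det_1_inverse[OF g(1)] by blast
        \<comment> \<open>The conjugate of \<open>h\<close> fixes the functional, but moved past
          \<open>g\<close> it becomes \<open>h\<close> and scales \<open>v0\<close> by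
          \<open>\<theta> h\<close>.\<close>
        have "\<theta> h = 1" if h: "h \<in> cong_sub l" "g ** h ** g' \<in> cong_sub m" for h
        proof -
          have "RT (g ** h ** g') (RT g (ind_fun v0)) = RT (g ** h) (ind_fun v0)"
            using cong_sub_det[OF h(2)] by (simp add: g' flip: right_translation_mult matrix_mul_assoc)
          also have "\<dots> = RT g (RT h (ind_fun v0))"
            using g(1) by (simp add: right_translation_mult)
          also have "\<dots> = pointwise_scale sc (\<theta> h) (RT g (ind_fun v0))"
            using h(1) by (simp add: RT_ind_fun cong_sub_imp_cong_sub_0 v0 ind_fun_scale RT_scale)
          finally have "\<phi> (RT (g ** h ** g') (RT g (ind_fun v0))) = \<theta> h * \<phi> (RT g (ind_fun v0))"
            using \<phi>_scale[OF E_RT[OF f0 g(1)]] by simp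
          moreover have "\<phi> (RT (g ** h ** g') (RT g (ind_fun v0))) = \<phi> (RT g (ind_fun v0))"
            using U(2) m(2) h(2) E_RT[OF f0 g(1)] by blast
          ultimately show ?thesis
            using g(2) by simp
        qed
        \<comment> \<open>The conjugation here is inverse to the one in \<open>bounded\<close>,
          which therefore bounds the inverse of \<open>g\<close>; Cramer's rule returns to
          \<open>g\<close>.\<close>
        then have "mbd R0 g'"
          using R0[OF g'(3,2)] by blast
        then have "mbd R g'"
          by (rule mbd_mono) (simp add: R_def)
        then show ?thesis
          using g' by (intro inverse_bounded[of g']) (auto simp: R_def)
      qed
      moreover have "1 \<le> R ^ CARD('n)"
        by (simp add: R_def one_le_power)
      ultimately show ?thesis
        using f0 unfolding W_def by blast
    qed
    moreover have "ind_fun v0 \<noteq> 0"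
      using ind_fun_1[OF v0(1)] v0(2) by (metis zero_fun_apply)
    moreover have "W \<subseteq> E"
      by (auto simp: W_def)
    ultimately have "W = E"
      using irreducible_E unfolding irreducible_rep_def by (simp, blast)
    then obtain R where R: "\<And>g. det g = 1 \<Longrightarrow> \<phi> (RT g f) \<noteq> 0 \<Longrightarrow> mbd R g"
      using f by (auto simp: W_def)
    \<comment> \<open>The coefficients have bounded, hence compact, support, so the identity is the
      only central element that must be supplied.\<close>
    have "mat 1 \<in> group_center (SL UNIV :: ('f ^ 'n ^ 'n) monoid)"
      by (simp add: group_center_def)
    then have "{g \<in> carrier (SL UNIV). \<phi> (RT g f) \<noteq> 0} \<subseteq>
        group_center (SL UNIV) <#>\<^bsub>SL UNIV\<^esub> {A. det A = 1 \<and> mbd R A}"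
      using R by (auto simp: set_mult_def intro!: bexI[of _ "mat 1"])
    then show ?thesis
      using compactin_ball by blast
  qed
  then show ?thesis
    unfolding supercuspidal_rep_def using irreducible_E smooth_rep_E by blast
qed

end

section \<open>Reduction modulo a power of the maximal ideal\<close>

locale residue_reduction = uniformized_field nm \<pi>
  for nm :: "'f::field \<Rightarrow> real" and \<pi> +
  fixes \<rho> :: "'f \<Rightarrow> 'q::comm_ring_1" and r :: nat
  assumes residue_ring: "is_residue_ring nm \<pi> r \<rho>" and r_nz: "r \<noteq> 0"
begin

section \<open>The reduction map on integers and on matrices\<close>

lemma \<rho>_1 [simp]: "\<rho> 1 = 1"
  and \<rho>_add: "nm x \<le> 1 \<Longrightarrow> nm y \<le> 1 \<Longrightarrow> \<rho> (x + y) = \<rho> x + \<rho> y"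
  and \<rho>_mult: "nm x \<le> 1 \<Longrightarrow> nm y \<le> 1 \<Longrightarrow> \<rho> (x * y) = \<rho> x * \<rho> y"
  and \<rho>_surj: "\<exists>x. nm x \<le> 1 \<and> \<rho> x = z"
  and \<rho>_eq_0_iff: "nm x \<le> 1 \<Longrightarrow> \<rho> x = 0 \<longleftrightarrow> nm x \<le> nm \<pi> ^ r"
proof -
  show "\<rho> 1 = 1" "nm x \<le> 1 \<Longrightarrow> nm y \<le> 1 \<Longrightarrow> \<rho> (x + y) = \<rho> x + \<rho> y"
    "nm x \<le> 1 \<Longrightarrow> nm y \<le> 1 \<Longrightarrow> \<rho> (x * y) = \<rho> x * \<rho> y"
    using residue_ring by (auto simp: is_residue_ring_def ring_of_integers_def)
  have "z \<in> \<rho> ` ring_of_integers nm"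
    using residue_ring by (simp add: is_residue_ring_def)
  then show "\<exists>x. nm x \<le> 1 \<and> \<rho> x = z"
    by (auto simp: ring_of_integers_def)
  have "x \<in> {x \<in> ring_of_integers nm. \<rho> x = 0} \<longleftrightarrow> x \<in> ideal_power nm \<pi> r"
    using residue_ring by (simp add: is_residue_ring_def)
  then show "nm x \<le> 1 \<Longrightarrow> \<rho> x = 0 \<longleftrightarrow> nm x \<le> nm \<pi> ^ r"
    by (simp add: ideal_power_iff ring_of_integers_def)
qed

lemma \<rho>_0 [simp]: "\<rho> 0 = 0"
  using q_pos by (simp add: \<rho>_eq_0_iff)

lemma \<rho>_diff: "nm x \<le> 1 \<Longrightarrow> nm y \<le> 1 \<Longrightarrow> \<rho> (x - y) = \<rho> x - \<rho> y"
  using \<rho>_add[of "x - y" y] by (simp add: nm_diff_le)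

lemma \<rho>_eq_iff: "nm x \<le> 1 \<Longrightarrow> nm y \<le> 1 \<Longrightarrow> \<rho> x = \<rho> y \<longleftrightarrow> nm (x - y) \<le> nm \<pi> ^ r"
  using \<rho>_eq_0_iff[of "x - y"] by (simp add: nm_diff_le \<rho>_diff)

lemma \<rho>_sum: "(\<And>i. i \<in> I \<Longrightarrow> nm (f i) \<le> 1) \<Longrightarrow> \<rho> (sum f I) = (\<Sum>i\<in>I. \<rho> (f i))"
  by (induction I rule: infinite_finite_induct) (auto simp: \<rho>_add nm_sum_le)

lemma \<rho>_prod: "(\<And>i. i \<in> I \<Longrightarrow> nm (f i) \<le> 1) \<Longrightarrow> \<rho> (prod f I) = (\<Prod>i\<in>I. \<rho> (f i))"
  by (induction I rule: infinite_finite_induct) (auto simp: \<rho>_mult nm_prod nm_nonneg prod_le_1)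

lemma \<rho>_sign: "\<rho> (of_int (sign p)) = of_int (sign p)"
  using \<rho>_diff[of 0 1] by (simp add: sign_def)

abbreviation red :: "'f ^ 'n ^ 'm \<Rightarrow> 'q ^ 'n ^ 'm" where
  "red \<equiv> map_matrix \<rho>"

lemma red_mult: "mint A \<Longrightarrow> mint B \<Longrightarrow> red (A ** B) = red A ** red B"
  by (rule mat_eqI)
    (simp add: matrix_mult_nth mbd_def \<rho>_sum \<rho>_mult nm_mult_le[of _ 1 _ 1, simplified])

lemma red_1: "red (mat 1) = mat 1"
  by (rule mat_eqI) (simp add: mat_def)

lemma det_red: "mint A \<Longrightarrow> det (red A) = \<rho> (det A)"
proof -
  assume A: "mint A"
  have prod: "nm (\<Prod>i\<in>UNIV. A $ i $ p i) \<le> 1" for p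
    using A by (auto simp: nm_prod mbd_def nm_nonneg intro!: prod_le_1)
  then have "nm (of_int (sign p) * (\<Prod>i\<in>UNIV. A $ i $ p i)) \<le> 1" for p
    by (simp add: nm_mult nm_sign)
  then show ?thesis
    using A prod unfolding det_def by (simp add: \<rho>_sum \<rho>_mult \<rho>_prod \<rho>_sign nm_sign mbd_def)
qed

lemma red_eq_iff: "mint A \<Longrightarrow> mint B \<Longrightarrow> red A = red B \<longleftrightarrow> mbd (nm \<pi> ^ r) (A - B)"
  by (simp add: vec_eq_iff mbd_def \<rho>_eq_iff)

lemma red_cong_sub_0: "k \<in> cong_sub 0 \<Longrightarrow> det (red k) = 1"
  by (simp add: det_red cong_sub_mint cong_sub_det)

lemma red_cong_sub_r: "k \<in> cong_sub r \<Longrightarrow> red k = mat 1"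
  using red_eq_iff[OF cong_sub_mint mbd_mat_1, of k r] by (simp add: red_1 cong_sub_def)

text \<open>A lift of the entries has determinant \<open>d\<close> congruent to 1, hence a unit.
  Dividing a single row by \<open>d\<close> corrects the determinant without changing the reduction,
  because \<open>1 / d\<close> also reduces to 1.\<close>

lemma red_surj:
  assumes "det (A :: 'q ^ 'n ^ 'n) = 1"
  shows "\<exists>k\<in>cong_sub 0. red k = A"
proof -
  have "\<forall>i j. \<exists>x. nm x \<le> 1 \<and> \<rho> x = A $ i $ j"
    using \<rho>_surj by blast
  then obtain f where f: "\<And>i j. nm (f i j) \<le> 1" "\<And>i j. \<rho> (f i j) = A $ i $ j"
    by metis
  define X where "X = (\<chi> i j. f i j)"
  have X: "mint X" "red X = A"
    using f by (auto simp: X_def mbd_def vec_eq_iff)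
  define d where "d = det X"
  have "\<rho> d = 1"
    using det_red[OF X(1)] by (simp add: X(2) assms d_def)
  moreover have d1: "nm d \<le> 1"
    using nm_det_le[OF X(1)] by (simp add: d_def)
  ultimately have "nm (d - 1) \<le> nm \<pi> ^ r"
    using \<rho>_eq_iff[of d 1] by simp
  also have "nm \<pi> ^ r \<le> nm \<pi> ^ 1"
    using r_nz by (subst q_power_le_iff) simp
  finally have d: "nm d = 1"
    using q_less1 nm_eq_of_close[of d 1] by simp
  then have d0: "d \<noteq> 0"
    by auto
  have "\<rho> d * \<rho> (1 / d) = 1"
    using \<rho>_mult[of d "1 / d"] d d0 by (simp add: nm_divide)
  then have d': "\<rho> (1 / d) = 1"
    using \<open>\<rho> d = 1\<close> by simp
  define i0 :: 'n where "i0 = undefined"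
  define Y where "Y = (\<chi> i. if i = i0 then (1 / d) *s (X $ i) else X $ i)"
  have Y_nth: "Y $ i $ j = (if i = i0 then (1 / d) * X $ i $ j else X $ i $ j)" for i j
    by (simp add: Y_def)
  have "det Y = (1 / d) * det (\<chi> i. if i = i0 then X $ i else X $ i)"
    unfolding Y_def by (rule det_row_mul)
  then have "det Y = 1"
    using d0 by (simp add: d_def)
  moreover have "mint Y"
    using X(1) d by (auto simp: mbd_def Y_nth nm_mult nm_divide)
  moreover have "red Y = A"
    using X d d' by (auto simp: vec_eq_iff Y_nth \<rho>_mult nm_divide mbd_def simp del: times_divide_eq_left)
  ultimately show ?thesis
    by (auto simp: cong_sub_0_iff slint_def)
qed

lemma red_congruence_kernel: "h \<in> cong_sub l \<Longrightarrow> red h \<in> congruence_kernel nm \<pi> \<rho> l"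
proof -
  assume h: "h \<in> cong_sub l"
  have "red h $ i $ j - mat 1 $ i $ j = \<rho> ((h - mat 1) $ i $ j)" for i j
    using cong_sub_mint[OF h] mbdD[OF mbd_mat_1, of i j] red_1 by (auto simp: \<rho>_diff mbd_def mat_def)
  moreover have "(h - mat 1) $ i $ j \<in> ideal_power nm \<pi> l" for i j
    using h by (simp add: ideal_power_iff cong_sub_def mbd_def)
  ultimately have "red h $ i $ j - mat 1 $ i $ j \<in> \<rho> ` ideal_power nm \<pi> l" for i j
    by (metis imageI)
  then show ?thesis
    using h cong_sub_antimono[of 0 l] by (auto simp: congruence_kernel_def red_cong_sub_0)
qed

text \<open>The choice operator in the definition may return another lift than \<open>X\<close>. Two
  lifts agree modulo \<open>\<pi> ^ (r div 2)\<close>, so after the division the arguments of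
  \<open>\<tau>\<close> differ by an integer, on which \<open>\<tau>\<close> is trivial.\<close>

lemma congruence_character_eq:
  fixes B :: "'f ^ 'n ^ 'n"
  assumes \<tau>: "\<And>x y. \<tau> (x + y) = \<tau> x * \<tau> y" "\<And>x. nm x \<le> 1 \<Longrightarrow> \<tau> x = 1"
    and B: "mint B" and X: "mint X"
  shows "congruence_character nm \<pi> \<rho> \<tau> r B (red (mat 1 + msc (\<pi> ^ (r - r div 2)) X)) =
    \<tau> (inverse (\<pi> ^ (r div 2)) * trace (X ** B))"
proof -
  define l where "l = r - r div 2"
  define h where "h = red (mat 1 + msc (\<pi> ^ l) X)"
  have map_msc: "map_matrix (\<lambda>x. \<pi> ^ l * x) Y = msc (\<pi> ^ l) Y" for Y :: "'f ^ 'n ^ 'n"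
    by (rule mat_eqI) simp
  define Y where "Y = (SOME Y. (\<forall>i j. Y $ i $ j \<in> ring_of_integers nm) \<and>
      h = red (mat 1 + map_matrix (\<lambda>x. \<pi> ^ l * x) Y))"
  have "(\<forall>i j. Y $ i $ j \<in> ring_of_integers nm) \<and> h = red (mat 1 + map_matrix (\<lambda>x. \<pi> ^ l * x) Y)"
    unfolding Y_def by (rule someI[of _ X]) (use X in \<open>auto simp: h_def map_msc ring_of_integers_def mbd_def\<close>)
  then have Y: "mint Y" "h = red (mat 1 + msc (\<pi> ^ l) Y)"
    by (auto simp: map_msc ring_of_integers_def mbd_def)
  have int: "mint (mat 1 + msc (\<pi> ^ l) Z)" if "mint Z" for Z :: "'f ^ 'n ^ 'n"
    using that by (intro mbd_add mbd_mat_1 mint_msc) (auto simp: nm_power q_power_le_1)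
  have "mbd (nm \<pi> ^ r) ((mat 1 + msc (\<pi> ^ l) Y) - (mat 1 + msc (\<pi> ^ l) X))"
    using red_eq_iff[OF int[OF Y(1)] int[OF X]] Y(2) by (simp add: h_def)
  then have "mbd (nm \<pi> ^ r) (msc (\<pi> ^ l) (Y - X))"
    by (simp add: msc_diff)
  then have "mbd (nm (1 / \<pi> ^ l) * nm \<pi> ^ r) (msc (1 / \<pi> ^ l) (msc (\<pi> ^ l) (Y - X)))"
    by (rule mbd_msc)
  moreover have "nm (1 / \<pi> ^ l) * nm \<pi> ^ r = nm \<pi> ^ (r div 2)"
  proof -
    have "nm \<pi> ^ r = nm \<pi> ^ l * nm \<pi> ^ (r div 2)"
      by (simp add: l_def flip: power_add)
    then show ?thesis
      using q_pos by (simp add: nm_divide nm_power)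
  qed
  ultimately have "mbd (nm \<pi> ^ (r div 2)) (Y - X)"
    using pi_nz by simp
  then have "mbd (nm \<pi> ^ (r div 2) * 1) ((Y - X) ** B)"
    by (intro mbd_mult B)
  then have "nm (trace ((Y - X) ** B)) \<le> nm \<pi> ^ (r div 2)"
    unfolding trace_def using q_pos by (intro nm_sum_le) (auto simp: mbd_def)
  then have "nm (inverse (\<pi> ^ (r div 2)) * trace ((Y - X) ** B)) \<le> 1"
    using q_pos by (simp add: nm_mult nm_inverse nm_divide nm_power field_simps)
  then have "\<tau> (inverse (\<pi> ^ (r div 2)) * trace ((Y - X) ** B)) = 1"
    by (rule \<tau>(2))
  moreover have "inverse (\<pi> ^ (r div 2)) * trace (Y ** B) =
      inverse (\<pi> ^ (r div 2)) * trace (X ** B) + inverse (\<pi> ^ (r div 2)) * trace ((Y - X) ** B)"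
    by (simp add: matrix_diff_rdistrib trace_sub algebra_simps)
  ultimately have "\<tau> (inverse (\<pi> ^ (r div 2)) * trace (Y ** B)) = \<tau> (inverse (\<pi> ^ (r div 2)) * trace (X ** B))"
    by (simp add: \<tau>(1))
  then show ?thesis
    by (simp add: congruence_character_def Let_def flip: l_def h_def Y_def)
qed

end

theorem theorem2p1p1:
  fixes nm :: "'f::field \<Rightarrow> real" and \<pi> :: 'f and \<tau> :: "'f \<Rightarrow> complex"
    and \<iota> :: "'f \<Rightarrow> 'k::field" and b :: "'n::finite \<Rightarrow> 'k" and \<beta> :: 'k
    and e r :: nat
    and \<rho> :: "'f \<Rightarrow> 'q::comm_ring_1"
    and sc :: "complex \<Rightarrow> 'v::ab_group_add \<Rightarrow> 'v" and V :: "'v set"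
    and \<delta> :: "'q ^ 'n ^ 'n \<Rightarrow> 'v \<Rightarrow> 'v"
  assumes "nonarch_local_field nm"
    and "is_uniformizer nm \<pi>"
    and "residue_characteristic nm \<noteq> 2"
    and "\<not> residue_characteristic nm dvd CARD('n)"
    and "unitary_additive_character nm \<tau>"
    and "{x. \<forall>y\<in>ring_of_integers nm. \<tau> (x * y) = 1} = ring_of_integers nm"
    and "is_field_embedding \<iota>"
    and "extension_degree \<iota> = CARD('n)"
    and "is_ramification_index nm \<pi> \<iota> e"
    and "is_integral_basis nm \<iota> b"
    and "\<beta> \<in> extension_integers nm \<iota>"
    and "extension_integers nm \<iota> = adjoin_integral nm \<iota> \<beta>"
    and "field_trace \<iota> \<beta> = 0"
    and "2 \<le> r"
    and "is_residue_ring nm \<pi> r \<rho>"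
    and "irreducible_rep (SL (UNIV :: 'q set)) sc V \<delta>"
    and "contains_character sc V \<delta> (congruence_kernel nm \<pi> \<rho> (r - r div 2))
           (congruence_character nm \<pi> \<rho> \<tau> r (regular_matrix \<iota> b \<beta>))"
    and "2 * e \<le> r"
  shows "supercuspidal_rep (SL (UNIV :: 'f set)) (SL_topology nm) (pointwise_scale sc)
           (compact_ind_space (SL (UNIV :: 'f set)) (SL_topology nm)
              (carrier (SL (ring_of_integers nm))) V (\<lambda>k. \<delta> (map_matrix \<rho> k)))
           (right_translation (SL (UNIV :: 'f set) :: ('f ^ 'n ^ 'n) monoid))"
proof -
  interpret uniformized_field nm \<pi>
    using assms(1,2) by (simp add: uniformized_field_def uniformized_field_axioms_def)
  interpret K: monogenic_extension nm \<pi> \<iota> b \<beta> e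
    by unfold_locales (use assms in auto)
  interpret residue_reduction nm \<pi> \<rho> r
    by unfold_locales (use assms in auto)
  define B where "B = regular_matrix \<iota> b \<beta>"
  obtain d p Q u where "ramified_matrix nm \<pi> B d p e Q u"
    using K.regular_matrix_ramified by (auto simp: B_def)
  then interpret R: ramified_matrix nm \<pi> B d p e Q u .
  define L where "L = r div 2"
  define l where "l = r - L"
  \<comment> \<open>This is where \<open>2 * e \<le> r\<close> enters: \<open>e\<close> is nonzero,
    so \<open>e \<noteq> 1\<close> gives \<open>r \<ge> 4\<close>.\<close>
  have L: "1 \<le> L" "e = 1 \<or> 2 \<le> L" "l + L = r" "l \<le> r"
    using assms(14,18) R.e by (auto simp: L_def l_def)
  have \<tau>_add: "\<And>x y. \<tau> (x + y) = \<tau> x * \<tau> y"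
    using assms(5) by (simp add: unitary_additive_character_def)
  have \<tau>_integers: "\<tau> x = 1" if "nm x \<le> 1" for x
  proof -
    have "x \<in> {x. \<forall>y\<in>ring_of_integers nm. \<tau> (x * y) = 1}"
      unfolding assms(6) using that by (simp add: ring_of_integers_def)
    then have "\<tau> (x * 1) = 1"
      unfolding mem_Collect_eq by (rule bspec) (simp add: ring_of_integers_def)
    then show ?thesis
      by simp
  qed
  define \<theta> where "\<theta> h = congruence_character nm \<pi> \<rho> \<tau> r B (red h)" for h
  have \<theta>_eq: "\<theta> (mat 1 + msc (\<pi> ^ l) X) = \<tau> (inverse (\<pi> ^ L) * trace (X ** B))" if "mint X" for X
    unfolding \<theta>_def l_def L_def by (rule congruence_character_eq[OF \<tau>_add \<tau>_integers R.B that])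
  have intertwining: "mbd (1 / nm \<pi> ^ ((m - r) * d)) g"
    if m: "r \<le> m" and g: "det g = 1" "g ** g' = mat 1"
      and trivial: "\<And>h. h \<in> cong_sub l \<Longrightarrow> g' ** h ** g \<in> cong_sub m \<Longrightarrow> \<theta> h = 1" for m and g g' :: "'f ^ 'n ^ 'n"
  proof -
    have g': "g' ** g = mat 1"
      using g(2) by (simp add: matrix_left_right_inverse)
    have "nm (trace (X ** B)) \<le> nm \<pi> ^ L"
      if X: "mint X" "\<And>x. det (mat 1 + msc x X) = 1" "mbd (nm \<pi> ^ m) (g' ** msc (\<pi> ^ l) X ** g)" for X
    proof -
      define z where "z = inverse (\<pi> ^ L) * trace (X ** B)"
      \<comment> \<open>The value of \<open>\<tau>\<close> at \<open>z\<close> alone would not show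
        that \<open>z\<close> is integral. Scaling \<open>X\<close> by every integral
        \<open>y\<close> puts all integral multiples of \<open>z\<close> into the kernel, and then
        the condition on the conductor of \<open>\<tau>\<close> applies.\<close>
      have "\<tau> (z * y) = 1" if y: "nm y \<le> 1" for y
      proof -
        define h where "h = mat 1 + msc (\<pi> ^ l) (msc y X)"
        have yX: "mint (msc y X)"
          using X(1) y by (rule mint_msc[rotated])
        have det_h: "det h = 1"
          using X(2) by (simp add: h_def)
        have "h \<in> cong_sub l"
          using det_h mbd_msc[OF yX, of "\<pi> ^ l"] by (simp add: cong_sub_def h_def nm_power)
        moreover have "g' ** h ** g \<in> cong_sub m"
        proof -
          have "g' ** h ** g - mat 1 = msc y (g' ** msc (\<pi> ^ l) X ** g)"
            by (simp add: h_def matrix_add_ldistrib matrix_add_rdistrib g' msc_mult_left msc_mult_right mult.commute)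
          moreover have "mbd (nm \<pi> ^ m) (msc y (g' ** msc (\<pi> ^ l) X ** g))"
            using mbd_msc[OF X(3), of y] y q_pos
            by (auto elim!: mbd_mono intro!: mult_left_le_one_le simp: nm_nonneg)
          moreover have "det g' * det g = 1"
            using g' by (metis det_I det_mul)
          ultimately show ?thesis
            using det_h g(1) by (simp add: cong_sub_def det_mul)
        qed
        ultimately have "\<theta> h = 1"
          by (rule trivial)
        then show ?thesis
          using \<theta>_eq[OF yX] by (simp add: h_def z_def msc_mult_left trace_def sum_distrib_left mult_ac)
      qed
      then have "z \<in> {x. \<forall>y\<in>ring_of_integers nm. \<tau> (x * y) = 1}"
        by (simp add: ring_of_integers_def)
      then have "nm z \<le> 1"
        unfolding assms(6) by (simp add: ring_of_integers_def)
      then show ?thesis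
        using q_pos by (simp add: z_def nm_mult nm_inverse nm_divide nm_power field_simps)
    qed
    then obtain \<gamma> \<gamma>' where \<gamma>: "mint \<gamma>" "mbd (nm \<pi> ^ L) (\<gamma> - B)" "mint \<gamma>'"
      "msc (\<pi> ^ (m - (l + L))) \<gamma> ** g = g ** \<gamma>'"
      using ex_integral_approximation[OF g(2) R.B, of l L m] m L(3) by blast
    then show ?thesis
      using R.lattice_rigidity[OF \<gamma>(1,2) L(1,2) \<gamma>(3,4) g(1)] by (simp add: L(3))
  qed
  have rep: "complex_rep (SL UNIV) sc V \<delta>" and nonzero: "V \<noteq> {0}"
    and irreducible: "\<And>W. module.subspace sc W \<Longrightarrow> W \<subseteq> V \<Longrightarrow>
      (\<And>g w. det g = 1 \<Longrightarrow> w \<in> W \<Longrightarrow> \<delta> g w \<in> W) \<Longrightarrow> W = {0} \<or> W = V"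
    using assms(16) by (auto simp: irreducible_rep_def)
  interpret \<delta>: complex_rep "SL UNIV" sc V \<delta>
    by (rule rep)
  obtain v0 where v0: "v0 \<in> V" "v0 \<noteq> 0" "\<And>h. h \<in> congruence_kernel nm \<pi> \<rho> l \<Longrightarrow>
      \<delta> h v0 = sc (congruence_character nm \<pi> \<rho> \<tau> r B h) v0"
    using assms(17) by (auto simp: contains_character_def B_def l_def L_def)
  interpret induction_data nm \<pi> sc V "\<lambda>k. \<delta> (red k)" l r \<theta> v0
  proof unfold_locales
    show "\<delta>.subspace V"
      by (rule \<delta>.rep_subspace)
    show "\<delta> (red k) v \<in> V" if "k \<in> cong_sub 0" "v \<in> V" for k v
      using that by (simp add: \<delta>.rep_closed red_cong_sub_0)
    show "\<delta> (red k) (v + w) = \<delta> (red k) v + \<delta> (red k) w" if "k \<in> cong_sub 0" "v \<in> V" "w \<in> V" for k v w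
      using that by (simp add: \<delta>.rep_add red_cong_sub_0)
    show "\<delta> (red k) (sc c v) = sc c (\<delta> (red k) v)" if "k \<in> cong_sub 0" "v \<in> V" for k c v
      using that by (simp add: \<delta>.rep_scale red_cong_sub_0)
    show "\<delta> (red (k ** k')) v = \<delta> (red k) (\<delta> (red k') v)" if "k \<in> cong_sub 0" "k' \<in> cong_sub 0" "v \<in> V" for k k' v
      using \<delta>.rep_mult[of "red k" "red k'" v] that by (simp add: red_mult cong_sub_mint red_cong_sub_0)
    show "\<delta> (red k) v = v" if "k \<in> cong_sub r" "v \<in> V" for k v
      using \<delta>.rep_one[OF that(2)] red_cong_sub_r[OF that(1)] by simp
    \<comment> \<open>By \<open>red_surj\<close>, a subspace stable under the integral group is
      stable under the full quotient group.\<close>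
    show "W = {0} \<or> W = V" if W: "\<delta>.subspace W" "W \<subseteq> V"
      and stable: "\<And>k w. k \<in> cong_sub 0 \<Longrightarrow> w \<in> W \<Longrightarrow> \<delta> (red k) w \<in> W" for W
      using W by (rule irreducible) (use stable red_surj in metis)
    show "v0 \<in> V" "v0 \<noteq> 0"
      by (fact v0)+
    show "\<delta> (red k) v0 = sc (\<theta> k) v0" if "k \<in> cong_sub l" for k
      unfolding \<theta>_def using v0(3)[OF red_congruence_kernel[OF that]] .
    show "\<exists>R. \<forall>g g'. det g = 1 \<longrightarrow> g ** g' = mat 1 \<longrightarrow>
        (\<forall>h\<in>cong_sub l. g' ** h ** g \<in> cong_sub m \<longrightarrow> \<theta> h = 1) \<longrightarrow> mbd R g" if "r \<le> m" for m
      using intertwining[OF that] by blast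
    \<comment> \<open>For \<open>m = r\<close> the exponent in \<open>intertwining\<close> is 0, so
      the bound is integrality.\<close>
    show "g \<in> cong_sub 0" if "det g = 1" "g ** g' = mat 1"
      "\<And>h. h \<in> cong_sub l \<Longrightarrow> g' ** h ** g \<in> cong_sub r \<Longrightarrow> \<theta> h = 1" for g g'
      using intertwining[OF order_refl that] that(1) by (simp add: cong_sub_0_iff slint_def)
  qed
  have "carrier (SL (ring_of_integers nm)) = (cong_sub 0 :: ('f ^ 'n ^ 'n) set)"
    by (auto simp: SL_def cong_sub_0_iff slint_def mbd_def ring_of_integers_def)
  then show ?thesis
    using supercuspidal_E by simp
qed

end
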